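(* Let $\eta\ge0$. Assume that $U$ goes to infinity at infinity, that $|\nabla H|\ge h>0$ outside some large ball of $\mathbb R^{2d}$, and that $\theta(r)\le c\,e^{C_0r}$ for all $r$ sufficiently large, for some positive constants $c,C_0$. Assume there exists a (smooth) function $W$ with $W(x,y)\ge w>0$ for all $(x,y)$ and constants $\lambda,b>0$ such that $$L_\eta W(x,y)\le-\lambda H(x,y)W(x,y)+b\quad\text{for all }(x,y).$$ Then there exists $\rho>0$ such that for all smooth $g$ with $\int g^2d\mu=1$, $$\mathrm{Ent}_\mu(g^2)\le\rho\int\big(H^{-2\eta}|\nabla_xg|^2+|\nabla_yg|^2\big)d\mu .$$
   Context: $U:\mathbb R^d\to\mathbb R$ smooth, $U\ge1$, $\int e^{-U}dx<\infty$, $H(x,y)=U(x)+\frac12|y|^2$, $\mu=Z^{-1}e^{-H}dxdy$ on $\mathbb R^{2d}$. $\mathrm{Ent}_\mu(f)=\int f\ln f\,d\mu-\int fd\mu\ln\int fd\mu$. For $\eta\ge0$, $$L_\eta=H^{-2\eta}\Delta_x+\Delta_y-H^{-2\eta}\Big(2\eta\frac{\nabla_xH}{H}+\nabla_xH\Big)\cdot\nabla_x-\nabla_yH\cdot\nabla_y,$$ which is symmetric in $L^2(\mu)$ with $\int fL_\eta g\,d\mu=-\int(H^{-2\eta}\nabla_xf\cdot\nabla_xg+\nabla_yf\cdot\nabla_yg)d\mu$. $A_r=\{(x,y):H(x,y)\le r\}$ and $\theta(r)=\sup_{z\in\partial A_r}\max_{i,j=1,\dots,2d}\big|\frac{\partial^2H}{\partial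 z_i\partial z_j}(z)\big|$. *)

theory Defs
  imports "HOL-Analysis.Analysis" "HOL-Probability.Probability"
begin

definition pd :: "('a::euclidean_space \<Rightarrow> real) \<Rightarrow> 'a \<Rightarrow> 'a \<Rightarrow> real" where
  "pd f v z = frechet_derivative f (at z) v"

inductive_set iter_partials :: "('a::euclidean_space \<Rightarrow> real) \<Rightarrow> ('a \<Rightarrow> real) set"
  for f :: "'a \<Rightarrow> real" where
  base: "f \<in> iter_partials f"
| step: "g \<in> iter_partials f \<Longrightarrow> i \<in> Basis \<Longrightarrow> pd g i \<in> iter_partials f"

definition smooth :: "('a::euclidean_space \<Rightarrow> real) \<Rightarrow> bool" where
  "smooth f \<longleftrightarrow> (\<forall>g \<in> iter_partials f. \<forall>z. g differentiable (at z))"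

definition grad :: "('a::euclidean_space \<Rightarrow> real) \<Rightarrow> 'a \<Rightarrow> 'a" where
  "grad f z = (\<Sum>b\<in>Basis. pd f b z *\<^sub>R b)"

definition grad_x :: "('a::euclidean_space \<times> 'a \<Rightarrow> real) \<Rightarrow> 'a \<times> 'a \<Rightarrow> 'a" where
  "grad_x f z = (\<Sum>i\<in>Basis. pd f (i, 0) z *\<^sub>R i)"

definition grad_y :: "('a::euclidean_space \<times> 'a \<Rightarrow> real) \<Rightarrow> 'a \<times> 'a \<Rightarrow> 'a" where
  "grad_y f z = (\<Sum>i\<in>Basis. pd f (0, i) z *\<^sub>R i)"

definition lap_x :: "('a::euclidean_space \<times> 'a \<Rightarrow> real) \<Rightarrow> 'a \<times> 'a \<Rightarrow> real" where
  "lap_x f z = (\<Sum>i\<in>Basis. pd (pd f (i, 0)) (i, 0) z)"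

definition lap_y :: "('a::euclidean_space \<times> 'a \<Rightarrow> real) \<Rightarrow> 'a \<times> 'a \<Rightarrow> real" where
  "lap_y f z = (\<Sum>i\<in>Basis. pd (pd f (0, i)) (0, i) z)"

definition Ham :: "('a::euclidean_space \<Rightarrow> real) \<Rightarrow> 'a \<times> 'a \<Rightarrow> real" where
  "Ham U z = U (fst z) + (norm (snd z))\<^sup>2 / 2"

definition Zc :: "('a::euclidean_space \<Rightarrow> real) \<Rightarrow> real" where
  "Zc U = (\<integral>z. exp (- Ham U z) \<partial>(lborel :: ('a \<times> 'a) measure))"

definition mu :: "('a::euclidean_space \<Rightarrow> real) \<Rightarrow> ('a \<times> 'a) measure" where
  "mu U = density lborel (\<lambda>z. ennreal (exp (- Ham U z) / Zc U))"

definition Ent :: "'b measure \<Rightarrow> ('b \<Rightarrow> real) \<Rightarrow> real" where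
  "Ent M f = (\<integral>z. f z * ln (f z) \<partial>M) - (\<integral>z. f z \<partial>M) * ln (\<integral>z. f z \<partial>M)"

definition L_op :: "('a::euclidean_space \<Rightarrow> real) \<Rightarrow> real \<Rightarrow> ('a \<times> 'a \<Rightarrow> real) \<Rightarrow> 'a \<times> 'a \<Rightarrow> real" where
  "L_op U \<eta> f z =
     Ham U z powr (-2*\<eta>) * lap_x f z + lap_y f z
     - Ham U z powr (-2*\<eta>) *
         (((2*\<eta> / Ham U z) *\<^sub>R grad_x (Ham U) z + grad_x (Ham U) z) \<bullet> grad_x f z)
     - grad_y (Ham U) z \<bullet> grad_y f z"

definition sublevel :: "('a::euclidean_space \<Rightarrow> real) \<Rightarrow> real \<Rightarrow> ('a \<times> 'a) set" where
  "sublevel U r = {z. Ham U z \<le> r}"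

definition theta :: "('a::euclidean_space \<Rightarrow> real) \<Rightarrow> real \<Rightarrow> real" where
  "theta U r = Sup {\<bar>pd (pd (Ham U) i) j z\<bar> | z i j.
                      z \<in> frontier (sublevel U r) \<and> i \<in> Basis \<and> j \<in> Basis}"

definition energy :: "('a::euclidean_space \<Rightarrow> real) \<Rightarrow> real \<Rightarrow> ('a \<times> 'a \<Rightarrow> real) \<Rightarrow> real" where
  "energy U \<eta> g = (\<integral>z. Ham U z powr (-2*\<eta>) * (norm (grad_x g z))\<^sup>2
                         + (norm (grad_y g z))\<^sup>2 \<partial>mu U)"

end

theory Submission
  imports Defs
begin

text \<open>
  The function \<open>e\<^sup>-\<^sup>s\<^sup>H\<close> is globally Lipschitz, because it is bounded and, by the bound on \<open>\<theta>\<close>,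
  semiconvex along coordinate lines. Hence the \<open>e\<^sup>-\<^sup>C\<^sup>r\<close>-neighbourhood of \<open>A\<^sub>r\<close> stays in \<open>A\<^sub>r\<^sub>+\<^sub>1\<close>, and
  comparing \<open>f\<close> with its translates by vectors of that size gives
  \<open>\<integral>\<^sub>A\<^sub>r f\<^sup>2 d\<mu> \<le> c e\<^sup>-\<^sup>r \<E>(f) + c e\<^sup>\<kappa>\<^sup>r (\<integral>|f| d\<mu>)\<^sup>2\<close>; the loss of exponential factors coming from the density
  and from the weight \<open>H\<^sup>-\<^sup>2\<^sup>\<eta>\<close> is harmless at exponentially small scales. The Lyapunov condition
  yields \<open>\<lambda> \<integral>H f\<^sup>2 d\<mu> \<le> 2 \<E>(f) + K \<integral>f\<^sup>2 d\<mu>\<close> and so controls the part of \<open>f\<close> outside \<open>A\<^sub>r\<close>. Together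
  they form a super-Poincare inequality, which for the truncation \<open>g\<^sub>n\<close> of \<open>g\<close> to the levels
  \<open>3\<^sup>n \<le> |g| \<le> 3\<^sup>n\<^sup>+\<^sup>1\<close> and \<open>r\<close> proportional to \<open>n\<close> reads \<open>n \<integral>g\<^sub>n\<^sup>2 d\<mu> \<le> C \<E>(g\<^sub>n)\<close>. Summing over \<open>n\<close> bounds
  the entropy where \<open>|g|\<close> is large. Where \<open>|g|\<close> is bounded, the entropy is bounded by
  \<open>\<integral>(|g| - 1)\<^sup>2 d\<mu>\<close>, hence by the variance of \<open>g\<close>, and the same two ingredients give a Poincare
  inequality; so no defect has to be removed afterwards.
\<close>

section \<open>Continuously differentiable functions\<close>

text \<open>The lower bound on |grad H| makes \<open>theta\<close> usable at a given point: where
  grad H does not vanish, z is no local maximum of H, hence lies on the frontier of A_r with r =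
  H(z), so theta(H(z)) bounds the second derivatives at z itself. The translation scale is forced by
  the following trade. On A_{r+1}, passing from Lebesgue measure to mu and from the full to the
  weighted gradient costs e^((kap+1)(r+1)) with kap = 2 eta. Steps of length d produce a factor d^2,
  so d of order e^(-tau r) with tau large leaves e^(-r). The price is the volume of the d-ball, an
  exponential e^(\<kappa> r) in front of the L1 term. That price is affordable because |g| >= 3^n
  wherever g_n is nonzero and g has norm 1: Cauchy-Schwarz gives (int |g_n|)^2 <= 9^(-n) int g_n^2,
  whereas r = (n+1)/\<kappa> makes the factor only e^(n+1). What remains is the gain 1/r, of order
  1/n, which is the logarithm of g^2 on level n up to constants. The Lyapunov estimate comes from
  testing the operator on W against f^2/W. Cutoffs and truncations have just one continuous
  derivative, so the whole argument is phrased for \<open>C1\<close> instead of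
  \<open>smooth\<close>.\<close>

definition C1 :: "('a::euclidean_space \<Rightarrow> real) \<Rightarrow> bool" where
  "C1 f \<longleftrightarrow> (\<forall>z. f differentiable (at z)) \<and> (\<forall>v. continuous_on UNIV (pd f v))"

lemma pd_eqI: "(f has_derivative f') (at z) \<Longrightarrow> pd f v z = f' v"
  unfolding pd_def using frechet_derivative_at by metis

lemma has_derivative_pd:
  "f differentiable (at z) \<Longrightarrow> (f has_derivative (\<lambda>v. pd f v z)) (at z)"
  unfolding pd_def using frechet_derivative_works by blast

lemma C1_has_derivative: "C1 f \<Longrightarrow> (f has_derivative (\<lambda>v. pd f v z)) (at z)"
  unfolding C1_def using has_derivative_pd by blast

lemma C1I:
  assumes "\<And>z. (f has_derivative f' z) (at z)" and "\<And>v. continuous_on UNIV (\<lambda>z. f' z v)"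
  shows "C1 f"
proof -
  have "pd f v = (\<lambda>z. f' z v)" for v
    using assms(1) by (auto intro: pd_eqI)
  then show ?thesis
    using assms unfolding C1_def differentiable_def by auto
qed

lemma C1_continuous_on: "C1 f \<Longrightarrow> continuous_on S f"
  by (meson C1_def continuous_on_subset differentiable_imp_continuous_on differentiable_on_def
      differentiable_at_withinI)

lemma C1_continuous_on_pd: "C1 f \<Longrightarrow> continuous_on S (pd f v)"
  by (meson C1_def continuous_on_subset subset_UNIV)

lemma C1_measurable: "C1 f \<Longrightarrow> f \<in> borel_measurable borel"
  by (simp add: C1_continuous_on borel_measurable_continuous_onI)

lemma C1_pd_measurable: "C1 f \<Longrightarrow> pd f v \<in> borel_measurable borel"
  by (simp add: C1_continuous_on_pd borel_measurable_continuous_onI)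

lemma pd_sum_Basis:
  assumes "f differentiable (at z)"
  shows "pd f v z = (\<Sum>j\<in>Basis. (v \<bullet> j) * pd f j z)"
proof -
  have l: "linear (\<lambda>v. pd f v z)"
    using has_derivative_pd[OF assms] has_derivative_linear by blast
  have "pd f (\<Sum>j\<in>Basis. (v \<bullet> j) *\<^sub>R j) z = (\<Sum>j\<in>Basis. (v \<bullet> j) * pd f j z)"
    by (simp add: linear_sum[OF l] linear_scale[OF l])
  then show ?thesis by (simp add: euclidean_representation)
qed

lemma C1_Basis:
  assumes "\<And>z. f differentiable (at z)" and "\<And>j. j \<in> Basis \<Longrightarrow> continuous_on UNIV (pd f j)"
  shows "C1 f"
  unfolding C1_def
proof (intro conjI allI)
  fix v
  have "continuous_on UNIV (\<lambda>z. \<Sum>j\<in>Basis. (v \<bullet> j) * pd f j z)"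
    using assms(2) by (intro continuous_intros) auto
  also have "(\<lambda>z. \<Sum>j\<in>Basis. (v \<bullet> j) * pd f j z) = pd f v"
    by (rule ext) (rule pd_sum_Basis[OF assms(1), symmetric])
  finally show "continuous_on UNIV (pd f v)" .
qed (rule assms(1))

lemma smooth_differentiable: "smooth f \<Longrightarrow> f differentiable (at z)"
  unfolding smooth_def using iter_partials.base by blast

lemma iter_partials_trans:
  "h \<in> iter_partials g \<Longrightarrow> g \<in> iter_partials f \<Longrightarrow> h \<in> iter_partials f"
  by (induction rule: iter_partials.induct) (auto intro: iter_partials.intros)

lemma smooth_pd: "smooth f \<Longrightarrow> j \<in> Basis \<Longrightarrow> smooth (pd f j)"
  unfolding smooth_def
  by (meson iter_partials.base iter_partials.step iter_partials_trans)

text \<open>Continuity of the first partials comes from their own differentiability, one level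
  further in \<open>iter_partials\<close>.\<close>

lemma smooth_imp_C1: "smooth f \<Longrightarrow> C1 f"
  by (intro C1_Basis continuous_at_imp_continuous_on ballI differentiable_imp_continuous_within)
    (auto intro: smooth_differentiable smooth_pd)

lemma
  assumes f: "C1 f" and g: "C1 g"
  shows C1_mult: "C1 (\<lambda>z. f z * g z)"
    and pd_mult: "pd (\<lambda>z. f z * g z) v z = f z * pd g v z + pd f v z * g z"
proof -
  have d: "((\<lambda>z. f z * g z) has_derivative (\<lambda>v. f z * pd g v z + pd f v z * g z)) (at z)" for z
    by (rule has_derivative_mult[OF C1_has_derivative[OF f] C1_has_derivative[OF g]])
  show "C1 (\<lambda>z. f z * g z)"
    by (rule C1I[OF d]) (intro continuous_intros C1_continuous_on C1_continuous_on_pd f g)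
  show "pd (\<lambda>z. f z * g z) v z = f z * pd g v z + pd f v z * g z"
    by (rule pd_eqI[OF d])
qed

text \<open>The hypotheses on \<phi> are confined to the range of \<open>f\<close>, so that the
  inverse and real powers can be applied to functions that stay away from 0.\<close>

lemma
  assumes f: "C1 f" and \<phi>: "\<And>x. x \<in> range f \<Longrightarrow> (\<phi> has_real_derivative \<phi>' x) (at x)"
    and c: "continuous_on (range f) \<phi>'"
  shows C1_compose: "C1 (\<lambda>z. \<phi> (f z))"
    and pd_compose: "pd (\<lambda>z. \<phi> (f z)) v z = \<phi>' (f z) * pd f v z"
proof -
  have d: "((\<lambda>z. \<phi> (f z)) has_derivative (\<lambda>v. \<phi>' (f z) * pd f v z)) (at z)" for z
    by (rule has_derivative_compose[OF C1_has_derivative[OF f]])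
      (use \<phi>[of "f z"] in \<open>simp add: has_field_derivative_def\<close>)
  have "continuous_on UNIV (\<lambda>z. \<phi>' (f z))"
    using continuous_on_compose2[OF c C1_continuous_on[OF f, of UNIV]] by blast
  then show "C1 (\<lambda>z. \<phi> (f z))"
    by (intro C1I[OF d] continuous_intros C1_continuous_on_pd f)
  show "pd (\<lambda>z. \<phi> (f z)) v z = \<phi>' (f z) * pd f v z"
    by (rule pd_eqI[OF d])
qed

lemma C1_DERIV_line:
  assumes "C1 f"
  shows "((\<lambda>t. f (z + t *\<^sub>R v)) has_real_derivative pd f v (z + t *\<^sub>R v)) (at t)"
proof -
  have d: "((\<lambda>t. f (z + t *\<^sub>R v)) has_derivative (\<lambda>s. pd f (s *\<^sub>R v) (z + t *\<^sub>R v))) (at t)"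
    by (rule has_derivative_compose[OF _ C1_has_derivative[OF assms]])
      (auto intro!: derivative_eq_intros)
  have "linear (\<lambda>v. pd f v (z + t *\<^sub>R v0))" for v0
    using C1_has_derivative[OF assms] has_derivative_linear by blast
  from linear_scale[OF this] d show ?thesis
    by (simp add: has_field_derivative_def mult_commute_abs)
qed

section \<open>Compactly supported functions, translations and vanishing integrals of
  derivatives\<close>

lemma continuous_supported_integrable:
  fixes F :: "'a::euclidean_space \<Rightarrow> real"
  assumes "continuous_on UNIV F" and "\<And>z. norm z > R \<Longrightarrow> F z = 0"
  shows "integrable lborel F"
proof -
  have "integrable lborel (\<lambda>x. indicator (cball 0 R) x *\<^sub>R F x)"
    by (rule borel_integrable_compact) (auto intro: continuous_on_subset[OF assms(1)])
  moreover have "(\<lambda>x. indicator (cball 0 R) x *\<^sub>R F x) = F"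
    using assms(2) by (auto simp: indicator_def fun_eq_iff)
  ultimately show ?thesis by simp
qed

lemma pd_supported:
  fixes F :: "'a::euclidean_space \<Rightarrow> real"
  assumes "\<And>z. norm z > R \<Longrightarrow> F z = 0" and "norm z > R"
  shows "pd F v z = 0"
proof -
  have "((\<lambda>z. 0) has_derivative (\<lambda>v. 0)) (at z)" by simp
  then have "(F has_derivative (\<lambda>v. 0)) (at z)"
    by (rule has_derivative_transform_within_open[where s="- cball 0 R"])
      (use assms in \<open>auto simp: open_Compl\<close>)
  then show ?thesis by (rule pd_eqI)
qed

lemma nn_integral_lborel_translate:
  fixes c :: "'a::euclidean_space"
  assumes [measurable]: "f \<in> borel_measurable borel"
  shows "(\<integral>\<^sup>+z. f (z + c) \<partial>lborel) = (\<integral>\<^sup>+z. f z \<partial>lborel)"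
proof -
  have "(\<integral>\<^sup>+z. f z \<partial>lborel) = (\<integral>\<^sup>+z. f z \<partial>distr lborel borel ((+) c))"
    by (simp add: lborel_distr_plus)
  also have "\<dots> = (\<integral>\<^sup>+z. f (z + c) \<partial>lborel)"
    by (subst nn_integral_distr) (auto simp: add.commute)
  finally show ?thesis by simp
qed

lemma
  fixes c :: "'a::euclidean_space" and f :: "'a \<Rightarrow> real"
  assumes "integrable lborel f"
  shows integrable_lborel_translate: "integrable lborel (\<lambda>z. f (z + c))"
    and integral_lborel_translate: "(\<integral>z. f (z + c) \<partial>lborel) = (\<integral>z. f z \<partial>lborel)"
proof -
  have [measurable]: "f \<in> borel_measurable borel"
    using assms by auto
  have "integrable (distr lborel borel ((+) c)) f"
    using assms by (simp add: lborel_distr_plus)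
  then show "integrable lborel (\<lambda>z. f (z + c))"
    by (subst (asm) integrable_distr_eq) (auto simp: add.commute)
  have "(\<integral>z. f z \<partial>lborel) = (\<integral>z. f z \<partial>distr lborel borel ((+) c))"
    by (simp add: lborel_distr_plus)
  also have "\<dots> = (\<integral>z. f (z + c) \<partial>lborel)"
    by (subst integral_distr) (auto simp: add.commute)
  finally show "(\<integral>z. f (z + c) \<partial>lborel) = (\<integral>z. f z \<partial>lborel)" by simp
qed

text \<open>By translation invariance each difference quotient of \<open>F\<close> has integral 0;
  dominated convergence carries this over to the derivative. This is the integration by parts behind
  the Lyapunov estimate.\<close>

lemma
  fixes F :: "'a::euclidean_space \<Rightarrow> real"
  assumes F: "C1 F" and supp: "\<And>z. norm z > R \<Longrightarrow> F z = 0"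
  shows integrable_pd_supported: "integrable lborel (pd F v)"
    and integral_pd_supported: "(\<integral>z. pd F v z \<partial>lborel) = 0"
proof -
  note supp' = pd_supported[OF supp]
  show int: "integrable lborel (pd F v)"
    by (rule continuous_supported_integrable[OF C1_continuous_on_pd[OF F] supp'])
  have "compact (pd F v ` cball 0 R)"
    by (rule compact_continuous_image) (auto intro: C1_continuous_on_pd F)
  then obtain B where "\<forall>z\<in>cball 0 R. \<bar>pd F v z\<bar> \<le> B"
    using compact_imp_bounded[of "pd F v ` cball 0 R"] unfolding bounded_iff by auto
  then have B: "\<bar>pd F v z\<bar> \<le> B" if "norm z \<le> R" for z
    using that by auto
  define B' where "B' = max B 0"
  have B': "\<bar>pd F v z\<bar> \<le> B'" for z
    using B[of z] supp'[where z=z] by (cases "norm z > R") (auto simp: B'_def)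
  have lip: "\<bar>F (z + t *\<^sub>R v) - F z\<bar> \<le> t * B'" if t: "t > 0" for t z
  proof -
    obtain u where "F (z + t *\<^sub>R v) - F (z + 0 *\<^sub>R v) = (t - 0) * pd F v (z + u *\<^sub>R v)"
      using MVT2[OF t, of "\<lambda>t. F (z + t *\<^sub>R v)" "\<lambda>t. pd F v (z + t *\<^sub>R v)"] C1_DERIV_line[OF F]
      by blast
    then show ?thesis using B' t by (auto simp: abs_mult)
  qed
  define s where "s n z = real (Suc n) * (F (z + (1 / real (Suc n)) *\<^sub>R v) - F z)" for n z
  have intF: "integrable lborel F"
    by (rule continuous_supported_integrable[OF C1_continuous_on[OF F] supp])
  have s0: "(\<integral>z. s n z \<partial>lborel) = 0" for n
    unfolding s_def using intF integrable_lborel_translate[OF intF] integral_lborel_translate[OF intF]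
    by simp
  \<comment> \<open>Every step has length at most \<open>norm v\<close>, so all quotients vanish
    outside the ball of radius \<open>R + norm v\<close>; elsewhere the mean value theorem bounds
    them by \<open>B'\<close>.\<close>
  have sb: "norm (s n z) \<le> B' * indicator (cball 0 (R + norm v)) z" for n z
  proof (cases "norm z > R + norm v")
    case True
    have "norm ((1 / real (Suc n)) *\<^sub>R v) \<le> norm v"
      by (simp add: divide_le_eq mult_le_cancel_left1)
    moreover have "norm (z + (1 / real (Suc n)) *\<^sub>R v) \<ge> norm z - norm ((1 / real (Suc n)) *\<^sub>R v)"
      by (rule norm_diff_ineq)
    ultimately have "norm (z + (1 / real (Suc n)) *\<^sub>R v) > R" using True by linarith
    moreover have "norm z > R" using True norm_ge_zero[of v] by linarith
    ultimately show ?thesis unfolding s_def using supp True by simp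
  next
    case False
    have "\<bar>F (z + (1 / real (Suc n)) *\<^sub>R v) - F z\<bar> \<le> (1 / real (Suc n)) * B'"
      by (rule lip) simp
    then have "real (Suc n) * \<bar>F (z + (1 / real (Suc n)) *\<^sub>R v) - F z\<bar> \<le> B'"
      by (simp add: field_simps)
    then show ?thesis using False unfolding s_def by (simp add: abs_mult)
  qed
  have lim: "(\<lambda>n. s n z) \<longlonglongrightarrow> pd F v z" for z
  proof -
    have "((\<lambda>h. (F (z + h *\<^sub>R v) - F z) / h) \<longlongrightarrow> pd F v z) (at 0)"
      using C1_DERIV_line[OF F, of z v 0] by (simp add: DERIV_def)
    moreover have "filterlim (\<lambda>n. 1 / real (Suc n)) (at 0) sequentially"
      using LIMSEQ_Suc[OF lim_1_over_n] by (simp add: filterlim_at)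
    ultimately have "((\<lambda>n. (F (z + (1 / real (Suc n)) *\<^sub>R v) - F z) / (1 / real (Suc n))) \<longlongrightarrow> pd F v z)
        sequentially"
      by (rule filterlim_compose)
    then show ?thesis unfolding s_def by (simp add: mult.commute)
  qed
  have [measurable]: "F \<in> borel_measurable borel" "pd F v \<in> borel_measurable borel"
    by (auto intro: C1_measurable C1_pd_measurable F)
  have "(\<lambda>n. \<integral>z. s n z \<partial>lborel) \<longlonglongrightarrow> (\<integral>z. pd F v z \<partial>lborel)"
  proof (rule integral_dominated_convergence[where w="\<lambda>z. B' * indicator (cball 0 (R + norm v)) z"])
    show "integrable lborel (\<lambda>z::'a. B' * indicator (cball 0 (R + norm v)) z)"
      by (auto intro!: integrable_mult_right emeasure_compact_finite)
    show "s n \<in> borel_measurable lborel" for n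
      unfolding s_def by measurable
  qed (use sb lim in auto)
  then show "(\<integral>z. pd F v z \<partial>lborel) = 0"
    by (simp add: s0 LIMSEQ_const_iff)
qed

section \<open>Increments controlled by the gradient\<close>

definition grad_sq :: "('a::euclidean_space \<Rightarrow> real) \<Rightarrow> 'a \<Rightarrow> real" where
  "grad_sq f z = (\<Sum>j\<in>Basis. (pd f j z)\<^sup>2)"

lemma grad_sq_nonneg: "0 \<le> grad_sq f z"
  unfolding grad_sq_def by (simp add: sum_nonneg)

lemma grad_sq_measurable: "C1 f \<Longrightarrow> grad_sq f \<in> borel_measurable borel"
  unfolding grad_sq_def
  by (intro borel_measurable_sum borel_measurable_power C1_pd_measurable)

lemma pd_sq_le_grad_sq:
  assumes "f differentiable (at z)"
  shows "(pd f v z)\<^sup>2 \<le> (norm v)\<^sup>2 * grad_sq f z"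
proof -
  have "(pd f v z)\<^sup>2 \<le> (\<Sum>j\<in>Basis. (v \<bullet> j)\<^sup>2) * (\<Sum>j\<in>Basis. (pd f j z)\<^sup>2)"
    by (subst pd_sum_Basis[OF assms]) (rule Cauchy_Schwarz_ineq_sum)
  also have "(\<Sum>j\<in>Basis. (v \<bullet> j)\<^sup>2) = (norm v)\<^sup>2"
    unfolding power2_norm_eq_inner by (subst euclidean_inner) (simp add: power2_eq_square)
  finally show ?thesis by (simp add: grad_sq_def)
qed

lemma sq_increment_le_integral:
  fixes \<phi> :: "real \<Rightarrow> real"
  assumes d: "\<And>t. (\<phi> has_real_derivative \<phi>' t) (at t)" and c: "continuous_on UNIV \<phi>'"
  shows "ennreal ((\<phi> 1 - \<phi> 0)\<^sup>2) \<le> (\<integral>\<^sup>+t. ennreal ((\<phi>' t)\<^sup>2) * indicator {0..1} t \<partial>lborel)"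
proof -
  define m where "m = \<phi> 1 - \<phi> 0"
  have cont: "isCont \<phi>' x" for x using c by (simp add: continuous_on_eq_continuous_at)
  \<comment> \<open>Completing the square, \<open>2 m \<phi>' - m\<^sup>2 \<le> \<phi>'\<^sup>2\<close>, replaces Jensen's inequality.\<close>
  have h: "has_bochner_integral lborel (\<lambda>t. (2 * m * \<phi>' t - m\<^sup>2) * indicator {0..1} t)
      ((2 * m * \<phi> 1 - m\<^sup>2 * 1) - (2 * m * \<phi> 0 - m\<^sup>2 * 0))"
    by (rule has_bochner_integral_FTC_Icc_real)
      (auto intro!: derivative_eq_intros d continuous_intros cont)
  have i: "integrable lborel (\<lambda>t. (\<phi>' t)\<^sup>2 * indicator {0..1} t)"
    by (rule borel_integrable_atLeastAtMost) (intro continuous_intros cont)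
  have "m\<^sup>2 = (2 * m * \<phi> 1 - m\<^sup>2 * 1) - (2 * m * \<phi> 0 - m\<^sup>2 * 0)"
    by (simp add: m_def power2_eq_square algebra_simps)
  also have "\<dots> = (\<integral>t. (2 * m * \<phi>' t - m\<^sup>2) * indicator {0..1} t \<partial>lborel)"
    using h by (simp add: has_bochner_integral_iff)
  also have "\<dots> \<le> (\<integral>t. (\<phi>' t)\<^sup>2 * indicator {0..1} t \<partial>lborel)"
  proof (rule integral_mono)
    show "(2 * m * \<phi>' t - m\<^sup>2) * indicator {0..1} t \<le> (\<phi>' t)\<^sup>2 * indicator {0..1} t" for t
      using zero_le_power2[of "\<phi>' t - m"]
      by (auto simp: power2_diff indicator_def algebra_simps)
  qed (use h i in \<open>auto simp: has_bochner_integral_iff\<close>)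
  finally have "ennreal (m\<^sup>2) \<le> ennreal (\<integral>t. (\<phi>' t)\<^sup>2 * indicator {0..1} t \<partial>lborel)"
    by (rule ennreal_leI)
  also have "\<dots> = (\<integral>\<^sup>+t. ennreal ((\<phi>' t)\<^sup>2 * indicator {0..1} t) \<partial>lborel)"
    by (rule nn_integral_eq_integral[symmetric]) (use i in auto)
  also have "\<dots> = (\<integral>\<^sup>+t. ennreal ((\<phi>' t)\<^sup>2) * indicator {0..1} t \<partial>lborel)"
    by (intro nn_integral_cong) (auto simp: indicator_def)
  finally show ?thesis by (simp add: m_def)
qed

text \<open>Bound the squared increment along the segment from z to z + h by the integral of the
  squared derivative, exchange the integrals, and undo the shift by t h through translation
  invariance; the t-integral then has mass 1. The estimate is for Lebesgue measure, the measure
  invariant under shifts, and \<open>A'\<close> has to contain all segments starting in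
  \<open>A\<close>.\<close>

lemma nn_integral_sq_translate_diff_le:
  fixes f :: "'a::euclidean_space \<Rightarrow> real"
  assumes f: "C1 f" and [measurable]: "A \<in> sets borel" "A' \<in> sets borel"
    and sub: "\<And>z t. z \<in> A \<Longrightarrow> t \<in> {0..1} \<Longrightarrow> z + t *\<^sub>R h \<in> A'"
  shows "(\<integral>\<^sup>+z. ennreal ((f (z + h) - f z)\<^sup>2) * indicator A z \<partial>lborel)
      \<le> ennreal ((norm h)\<^sup>2) * (\<integral>\<^sup>+z. ennreal (grad_sq f z) * indicator A' z \<partial>lborel)"
proof -
  have [measurable]: "f \<in> borel_measurable borel" "pd f v \<in> borel_measurable borel" for v
    by (auto intro: C1_measurable C1_pd_measurable f)
  have [measurable]: "grad_sq f \<in> borel_measurable borel"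
    by (rule grad_sq_measurable[OF f])
  define G where "G z = ennreal ((norm h)\<^sup>2) * (ennreal (grad_sq f z) * indicator A' z)" for z
  have [measurable]: "G \<in> borel_measurable borel"
    unfolding G_def by measurable
  have pw: "ennreal ((f (z + h) - f z)\<^sup>2) * indicator A z
      \<le> (\<integral>\<^sup>+t. G (z + t *\<^sub>R h) * indicator {0..1} t \<partial>lborel)" for z
  proof (cases "z \<in> A")
    case True
    have "continuous_on UNIV (\<lambda>t. pd f h (z + t *\<^sub>R h))"
      by (rule continuous_on_compose2[OF C1_continuous_on_pd[OF f, of UNIV]])
        (auto intro!: continuous_intros)
    from sq_increment_le_integral[OF C1_DERIV_line[OF f] this]
    have "ennreal ((f (z + h) - f z)\<^sup>2)
        \<le> (\<integral>\<^sup>+t. ennreal ((pd f h (z + t *\<^sub>R h))\<^sup>2) * indicator {0..1} t \<partial>lborel)"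
      by simp
    also have "\<dots> \<le> (\<integral>\<^sup>+t. G (z + t *\<^sub>R h) * indicator {0..1} t \<partial>lborel)"
    proof (rule nn_integral_mono)
      fix t :: real
      have "ennreal ((pd f h (z + t *\<^sub>R h))\<^sup>2) \<le> G (z + t *\<^sub>R h)" if "t \<in> {0..1}"
      proof -
        have "(pd f h (z + t *\<^sub>R h))\<^sup>2 \<le> (norm h)\<^sup>2 * grad_sq f (z + t *\<^sub>R h)"
          by (rule pd_sq_le_grad_sq) (use f in \<open>auto simp: C1_def\<close>)
        then show ?thesis
          using sub[OF True that] grad_sq_nonneg[of f] unfolding G_def by (simp add: ennreal_mult[symmetric] ennreal_leI)
      qed
      then show "ennreal ((pd f h (z + t *\<^sub>R h))\<^sup>2) * indicator {0..1} t
          \<le> G (z + t *\<^sub>R h) * indicator {0..1} t"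
        by (auto simp: indicator_def)
    qed
    finally show ?thesis using True by simp
  qed simp
  have "(\<integral>\<^sup>+z. ennreal ((f (z + h) - f z)\<^sup>2) * indicator A z \<partial>lborel)
      \<le> (\<integral>\<^sup>+z. \<integral>\<^sup>+t. G (z + t *\<^sub>R h) * indicator {0..1} t \<partial>lborel \<partial>lborel)"
    by (rule nn_integral_mono) (rule pw)
  also have "\<dots> = (\<integral>\<^sup>+t. \<integral>\<^sup>+z. G (z + t *\<^sub>R h) * indicator {0..1} t \<partial>lborel \<partial>lborel)"
    by (rule lborel_pair.Fubini'[symmetric]) measurable
  also have "\<dots> = (\<integral>\<^sup>+t. (\<integral>\<^sup>+z. G z \<partial>lborel) * indicator {0..1::real} t \<partial>lborel)"
    by (simp add: nn_integral_multc nn_integral_lborel_translate)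
  also have "\<dots> = (\<integral>\<^sup>+z. G z \<partial>lborel)"
    by (simp add: nn_integral_cmult)
  also have "\<dots> = ennreal ((norm h)\<^sup>2) * (\<integral>\<^sup>+z. ennreal (grad_sq f z) * indicator A' z \<partial>lborel)"
    unfolding G_def by (rule nn_integral_cmult) measurable
  finally show ?thesis .
qed

section \<open>Lyapunov estimate\<close>

lemma DERIV_max0_sq: "((\<lambda>x::real. (max 0 x)\<^sup>2) has_real_derivative 2 * max 0 x) (at x)"
proof -
  consider "x > 0" | "x < 0" | "x = 0" by linarith
  then show ?thesis
  proof cases
    case 1
    have "((\<lambda>x::real. x\<^sup>2) has_real_derivative 2 * max 0 x) (at x)"
      using 1 by (auto intro!: derivative_eq_intros)
    then show ?thesis
      by (rule has_field_derivative_transform_within_open[where S="{0<..}"]) (use 1 in auto)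
  next
    case 2
    have "((\<lambda>x::real. 0) has_real_derivative 2 * max 0 x) (at x)"
      using 2 by (auto intro!: derivative_eq_intros)
    then show ?thesis
      by (rule has_field_derivative_transform_within_open[where S="{..<0}"]) (use 2 in auto)
  next
    case 3
    \<comment> \<open>Caratheodory's criterion at the kink: the increment is z times a continuous
      function vanishing at 0.\<close>
    have "isCont (\<lambda>z::real. max 0 z) 0"
      by (intro continuous_intros)
    moreover have "\<forall>z. (max 0 z)\<^sup>2 - (max 0 (0::real))\<^sup>2 = max 0 z * (z - 0)"
      by (auto simp: power2_eq_square max_def)
    ultimately have "\<exists>g. (\<forall>z. (max 0 z)\<^sup>2 - (max 0 (0::real))\<^sup>2 = g z * (z - 0)) \<and> isCont g 0 \<and> g 0 = 0"
      by (intro exI[of _ "\<lambda>z. max 0 z"]) auto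
    then show ?thesis
      using CARAT_DERIV[of "\<lambda>x::real. (max 0 x)\<^sup>2" 0 0] 3 by simp
  qed
qed

text \<open>The outer square smooths the kink of the positive part, and \<open>z \<bullet> z\<close>
  in place of the norm avoids the singularity at the origin.\<close>

definition cutoff :: "real \<Rightarrow> 'a::euclidean_space \<Rightarrow> real" where
  "cutoff R z = (max 0 (1 - (z \<bullet> z) / R\<^sup>2))\<^sup>2"

lemma
  fixes z v :: "'a::euclidean_space"
  shows C1_cutoff: "C1 (cutoff R :: 'a \<Rightarrow> real)"
    and pd_cutoff: "pd (cutoff R) v z = - 4 * max 0 (1 - (z \<bullet> z) / R\<^sup>2) * (z \<bullet> v) / R\<^sup>2"
proof -
  define Q :: "'a \<Rightarrow> real" where "Q z = 1 - (z \<bullet> z) / R\<^sup>2" for z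
  have d: "(Q has_derivative (\<lambda>v. - 2 * (z \<bullet> v) / R\<^sup>2)) (at z)" for z
  proof -
    have "((\<lambda>z. 1 - c * (z \<bullet> z)) has_derivative (\<lambda>v. - 2 * c * (z \<bullet> v))) (at z)" for c
      by (auto intro!: derivative_eq_intros simp: inner_commute)
    from this[of "1 / R\<^sup>2"] show ?thesis unfolding Q_def by simp
  qed
  have Q: "C1 Q"
    by (rule C1I[OF d]) (simp only: divide_inverse, intro continuous_intros)
  have eq: "cutoff R = (\<lambda>z. (max 0 (Q z))\<^sup>2)"
    by (simp add: cutoff_def Q_def fun_eq_iff)
  have c: "continuous_on (range Q) (\<lambda>x. 2 * max 0 x)"
    by (intro continuous_intros)
  show "C1 (cutoff R :: 'a \<Rightarrow> real)"
    unfolding eq by (rule C1_compose[OF Q DERIV_max0_sq c])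
  show "pd (cutoff R) v z = - 4 * max 0 (1 - (z \<bullet> z) / R\<^sup>2) * (z \<bullet> v) / R\<^sup>2"
    unfolding eq by (subst pd_compose[OF Q DERIV_max0_sq c]) (simp add: pd_eqI[OF d] Q_def)
qed

lemma cutoff_bounds: "0 \<le> cutoff R z" "cutoff R z \<le> 1"
  by (auto simp: cutoff_def max_def abs_square_le_1)

lemma cutoff_supported: "R > 0 \<Longrightarrow> norm z > R \<Longrightarrow> cutoff R z = 0"
proof -
  assume "R > 0" "norm z > R"
  then have "R\<^sup>2 \<le> z \<bullet> z"
    unfolding power2_norm_eq_inner[symmetric] by (intro power_mono) auto
  then show ?thesis using \<open>R > 0\<close> by (auto simp: cutoff_def max_def divide_simps)
qed

text \<open>The bound is uniform in \<open>R\<close>: inside the ball, |z . v| / R^2 <= 1/R <= 1,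
  which leaves the factor 4 of \<open>pd_cutoff\<close>. Uniformity is what permits the limit of
  growing cutoffs.\<close>

lemma pd_cutoff_sq_le:
  fixes z v :: "'a::euclidean_space"
  assumes "R \<ge> 1" "norm v \<le> 1"
  shows "(pd (cutoff R) v z)\<^sup>2 \<le> 16"
proof (cases "norm z > R")
  case True
  have "R > 0" using assms by simp
  then have "pd (cutoff R) v z = 0"
    using pd_supported[of R "cutoff R :: 'a \<Rightarrow> real", OF cutoff_supported True] by simp
  then show ?thesis by simp
next
  case False
  define m where "m = max 0 (1 - (z \<bullet> z) / R\<^sup>2)"
  have m: "0 \<le> m" "m \<le> 1" unfolding m_def by auto
  have "\<bar>z \<bullet> v\<bar> \<le> norm z * norm v" by (rule Cauchy_Schwarz_ineq2)
  also have "\<dots> \<le> R * 1" using False assms by (intro mult_mono) auto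
  finally have zv: "\<bar>z \<bullet> v\<bar> \<le> R" by simp
  have "\<bar>z \<bullet> v\<bar> / R\<^sup>2 \<le> R / R\<^sup>2" using zv by (intro divide_right_mono) auto
  also have "\<dots> \<le> 1" using assms by (simp add: power2_eq_square divide_simps)
  finally have "m * (\<bar>z \<bullet> v\<bar> / R\<^sup>2) \<le> 1 * 1"
    using m by (intro mult_mono) auto
  then have "\<bar>pd (cutoff R) v z\<bar> \<le> 4"
    unfolding pd_cutoff m_def[symmetric] using m by (simp add: abs_mult)
  then have "\<bar>pd (cutoff R) v z\<bar>\<^sup>2 \<le> 4\<^sup>2" by (intro power_mono) auto
  then show ?thesis by simp
qed

lemma cutoff_tendsto: "(\<lambda>n. cutoff (real (Suc n)) z) \<longlonglongrightarrow> 1"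
proof -
  have "(\<lambda>n. (z \<bullet> z) * (1 / real (Suc n))\<^sup>2) \<longlonglongrightarrow> (z \<bullet> z) * 0\<^sup>2"
    by (intro tendsto_intros LIMSEQ_Suc[OF lim_1_over_n])
  then have "(\<lambda>n. (max 0 (1 - (z \<bullet> z) * (1 / real (Suc n))\<^sup>2))\<^sup>2) \<longlonglongrightarrow> (max 0 (1 - (z \<bullet> z) * 0\<^sup>2))\<^sup>2"
    by (intro tendsto_power[OF tendsto_max[OF tendsto_const tendsto_diff[OF tendsto_const]]])
  then show ?thesis by (simp add: cutoff_def power_divide)
qed

text \<open>A diffusion with diagonal coefficients \<open>a j\<close>: the sum in
  \<open>lyapunov\<close> is the operator e^H d_j(a_j e^(-H) d_j) summed over j and applied to
  \<open>W\<close>. The coefficients may degenerate at an exponential rate in H. The growth of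
  \<open>theta\<close> and the lower bound on the gradient of H are condensed into
  \<open>exp_lipschitz\<close>.\<close>

locale lyapunov_gibbs =
  fixes H :: "'a::euclidean_space \<Rightarrow> real" and a :: "'a \<Rightarrow> 'a \<Rightarrow> real" and W :: "'a \<Rightarrow> real"
    and w lam b kap s L :: real
  assumes H_C1: "C1 H"
    and H_ge1: "1 \<le> H z"
    and H_bounded: "bounded {z. H z \<le> r}"
    and H_int: "integrable lborel (\<lambda>z. exp (- H z))"
    and a_C1: "j \<in> Basis \<Longrightarrow> C1 (a j)"
    and a_le: "j \<in> Basis \<Longrightarrow> a j z \<le> 1"
    and a_ge: "j \<in> Basis \<Longrightarrow> exp (- kap * H z) \<le> a j z"
    and kap_nonneg: "0 \<le> kap"
    and W_C1: "C1 W"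
    and W_C2: "j \<in> Basis \<Longrightarrow> C1 (pd W j)"
    and w_pos: "0 < w"
    and W_ge: "w \<le> W z"
    and lam_pos: "0 < lam"
    and b_pos: "0 < b"
    and lyapunov: "(\<Sum>j\<in>Basis. a j z * pd (pd W j) j z + (pd (a j) j z - a j z * pd H j z) * pd W j z)
        \<le> - lam * H z * W z + b"
    and s_pos: "0 < s"
    and L_pos: "0 < L"
    and exp_lipschitz: "\<bar>exp (- s * H x) - exp (- s * H y)\<bar> \<le> L * norm (x - y)"
begin

definition Z :: real where "Z = (\<integral>z. exp (- H z) \<partial>lborel)"

definition \<mu> :: "'a measure" where "\<mu> = density lborel (\<lambda>z. ennreal (exp (- H z) / Z))"

text \<open>The carre du champ of the operator in \<open>lyapunov\<close>; its \<mu>-integral is the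
  energy.\<close>

definition Gam :: "('a \<Rightarrow> real) \<Rightarrow> 'a \<Rightarrow> real" where
  "Gam f z = (\<Sum>j\<in>Basis. a j z * (pd f j z)\<^sup>2)"

section \<open>The Gibbs measure\<close>

lemma H_meas [measurable]: "H \<in> borel_measurable borel"
  by (rule C1_measurable[OF H_C1])

lemma a_pos: "j \<in> Basis \<Longrightarrow> 0 < a j z"
  using a_ge[of j z] exp_gt_zero[of "- kap * H z"] by linarith

lemma Gam_nonneg: "0 \<le> Gam f z"
  unfolding Gam_def by (intro sum_nonneg mult_nonneg_nonneg) (auto intro: less_imp_le a_pos)

lemma Gam_meas: "C1 f \<Longrightarrow> Gam f \<in> borel_measurable borel"
  unfolding Gam_def
  by (intro borel_measurable_sum borel_measurable_times borel_measurable_power C1_pd_measurable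
      C1_measurable a_C1)

lemma Gam_continuous: "C1 f \<Longrightarrow> continuous_on S (Gam f)"
  unfolding Gam_def
  by (intro continuous_intros C1_continuous_on_pd C1_continuous_on a_C1)

lemma Gam_ge: "exp (- kap * H z) * grad_sq f z \<le> Gam f z"
  unfolding Gam_def grad_sq_def sum_distrib_left
  by (intro sum_mono mult_right_mono a_ge) auto

lemma Z_pos: "0 < Z"
proof -
  have "Z \<noteq> 0"
  proof
    assume "Z = 0"
    then have "AE z in lborel. exp (- H z) = 0"
      unfolding Z_def using integral_nonneg_eq_0_iff_AE[OF H_int] by simp
    then have "emeasure lborel (UNIV :: 'a set) = 0"
      by (simp add: AE_iff_measurable[OF _ refl])
    then show False by simp
  qed
  moreover have "Z \<ge> 0" unfolding Z_def by simp
  ultimately show ?thesis by linarith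
qed

lemma sets_\<mu> [simp, measurable_cong]: "sets \<mu> = sets borel" and space_\<mu> [simp]: "space \<mu> = UNIV"
  by (auto simp: \<mu>_def)

lemma prob_space_\<mu>: "prob_space \<mu>"
proof (rule prob_spaceI)
  have "emeasure \<mu> (space \<mu>) = (\<integral>\<^sup>+z. ennreal (exp (- H z) / Z) \<partial>lborel)"
    unfolding \<mu>_def by (subst emeasure_density) auto
  also have "\<dots> = ennreal (\<integral>z. exp (- H z) / Z \<partial>lborel)"
    by (rule nn_integral_eq_integral) (use H_int Z_pos in auto)
  also have "(\<integral>z. exp (- H z) / Z \<partial>lborel) = 1"
    using Z_pos by (simp add: Z_def)
  finally show "emeasure \<mu> (space \<mu>) = 1" by simp
qed

sublocale prob_space \<mu>
  by (rule prob_space_\<mu>)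

lemma integrable_\<mu>_iff:
  fixes f :: "'a \<Rightarrow> real"
  assumes "f \<in> borel_measurable borel"
  shows "integrable \<mu> f \<longleftrightarrow> integrable lborel (\<lambda>z. f z * exp (- H z))"
proof -
  have "integrable \<mu> f \<longleftrightarrow> integrable lborel (\<lambda>z. (exp (- H z) / Z) *\<^sub>R f z)"
    unfolding \<mu>_def using assms Z_pos by (subst integrable_density) auto
  also have "\<dots> \<longleftrightarrow> integrable lborel (\<lambda>z. (1 / Z) * (f z * exp (- H z)))"
    by (simp add: mult.commute)
  also have "\<dots> \<longleftrightarrow> integrable lborel (\<lambda>z. f z * exp (- H z))"
    unfolding integrable_mult_left_iff using Z_pos by simp
  finally show ?thesis .
qed

lemma integral_\<mu>:
  fixes f :: "'a \<Rightarrow> real"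
  assumes "f \<in> borel_measurable borel"
  shows "(\<integral>z. f z * exp (- H z) \<partial>lborel) = Z * (\<integral>z. f z \<partial>\<mu>)"
proof -
  have "(\<integral>z. f z \<partial>\<mu>) = (\<integral>z. (exp (- H z) / Z) *\<^sub>R f z \<partial>lborel)"
    unfolding \<mu>_def using assms Z_pos by (subst integral_density) auto
  also have "\<dots> = (\<integral>z. (1 / Z) * (f z * exp (- H z)) \<partial>lborel)"
    by (simp add: mult.commute)
  also have "\<dots> = (1 / Z) * (\<integral>z. f z * exp (- H z) \<partial>lborel)"
    by (rule integral_mult_right_zero)
  finally show ?thesis using Z_pos by simp
qed

text \<open>The total divergence of the field a_j e^(-H) (d_j W) f^2/W integrates to 0. Expanding it
  gives LW f^2/W, bounded above by the Lyapunov condition, plus cross terms between df and dW that a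
  completed square bounds by \<open>Gam f\<close>.\<close>

lemma lyapunov_supported:
  assumes f: "C1 f" and supp: "\<And>z. norm z > R \<Longrightarrow> f z = 0"
  shows "lam * (\<integral>z. H z * (f z)\<^sup>2 * exp (- H z) \<partial>lborel)
      \<le> (\<integral>z. (Gam f z + b / w * (f z)\<^sup>2) * exp (- H z) \<partial>lborel)"
proof -
  have Wpos: "W z > 0" for z using W_ge[of z] w_pos by linarith
  define E where "E z = exp (- H z)" for z
  have dE: "((\<lambda>x. exp (- x)) has_real_derivative - exp (- x)) (at x)" for x :: real
    by (auto intro!: derivative_eq_intros)
  have cE: "continuous_on (range H) (\<lambda>x. - exp (- x))"
    by (intro continuous_intros)
  have E: "C1 E" and pdE: "pd E v z = - E z * pd H v z" for v z
    unfolding E_def using C1_compose[OF H_C1 dE cE] pd_compose[OF H_C1 dE cE] by auto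
  define I where "I z = inverse (W z)" for z
  have r0: "x > 0" if "x \<in> range W" for x using that Wpos by auto
  have dI: "(inverse has_real_derivative - (inverse x)\<^sup>2) (at x)" if "x \<in> range W" for x
    using r0[OF that] by (auto intro!: derivative_eq_intros simp: power2_eq_square)
  have cI: "continuous_on (range W) (\<lambda>x. - (inverse x)\<^sup>2)"
    using r0 by (intro continuous_intros) (metis less_irrefl)
  have I: "C1 I" and pdI: "pd I v z = - (I z)\<^sup>2 * pd W v z" for v z
    unfolding I_def using C1_compose[OF W_C1 dI cI] pd_compose[OF W_C1 dI cI] by auto
  define F where "F j z = a j z * (pd W j z * (E z * (f z * (f z * I z))))" for j z
  have F: "C1 (F j)" if "j \<in> Basis" for j
    unfolding F_def using that by (intro C1_mult a_C1 W_C2 E I f)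
  have Fsupp: "F j z = 0" if "norm z > R" for j z
    unfolding F_def using supp[OF that] by simp
  have pdF: "pd (F j) j z = E z * ((a j z * pd (pd W j) j z + (pd (a j) j z - a j z * pd H j z) * pd W j z)
        * ((f z)\<^sup>2 * I z) + a j z * (2 * pd f j z * (f z * I z * pd W j z) - (f z * I z * pd W j z)\<^sup>2))"
    if j: "j \<in> Basis" for j z
  proof -
    note C = a_C1[OF j] W_C2[OF j] E I f
    show ?thesis
      unfolding F_def
      by (simp add: pd_mult C C1_mult pdE pdI power2_eq_square algebra_simps)
  qed
  have le: "(\<Sum>j\<in>Basis. pd (F j) j z)
      \<le> (Gam f z + b / w * (f z)\<^sup>2) * exp (- H z) - lam * (H z * (f z)\<^sup>2 * exp (- H z))" for z
  proof -
    have Ipos: "I z > 0" and IW: "I z * W z = 1" and Iw: "I z \<le> 1 / w"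
      using Wpos[of z] W_ge[of z] w_pos by (auto simp: I_def inverse_eq_divide intro: divide_left_mono)
    let ?l = "\<lambda>j. a j z * pd (pd W j) j z + (pd (a j) j z - a j z * pd H j z) * pd W j z"
    have "(\<Sum>j\<in>Basis. pd (F j) j z) \<le> (\<Sum>j\<in>Basis. E z * (?l j * ((f z)\<^sup>2 * I z) + a j z * (pd f j z)\<^sup>2))"
    proof (rule sum_mono)
      fix j :: 'a assume j: "j \<in> Basis"
      \<comment> \<open>With p = d_j f and q = f d_j W / W this is 2pq - q^2 <= p^2, so the
        derivative of W disappears.\<close>
      have "2 * pd f j z * (f z * I z * pd W j z) - (f z * I z * pd W j z)\<^sup>2 \<le> (pd f j z)\<^sup>2"
        using zero_le_power2[of "pd f j z - f z * I z * pd W j z"] by (simp add: power2_diff)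
      then show "pd (F j) j z \<le> E z * (?l j * ((f z)\<^sup>2 * I z) + a j z * (pd f j z)\<^sup>2)"
        unfolding pdF[OF j] using a_pos[OF j, of z]
        by (intro mult_left_mono add_left_mono) (auto simp: E_def)
    qed
    also have "\<dots> = E z * ((\<Sum>j\<in>Basis. ?l j) * ((f z)\<^sup>2 * I z) + Gam f z)"
    proof -
      have "(\<Sum>j\<in>Basis. e * (l j * c + g j)) = e * ((\<Sum>j\<in>Basis. l j) * c + (\<Sum>j\<in>Basis. g j))"
        for e c :: real and l g :: "'a \<Rightarrow> real"
        by (simp add: sum_distrib_left[symmetric] sum_distrib_right[symmetric] sum.distrib)
      then show ?thesis unfolding Gam_def .
    qed
    also have "\<dots> \<le> E z * ((- lam * H z * W z + b) * ((f z)\<^sup>2 * I z) + Gam f z)"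
      using Ipos by (intro mult_left_mono add_right_mono mult_right_mono lyapunov) (auto simp: E_def)
    also have "(- lam * H z * W z + b) * ((f z)\<^sup>2 * I z) = - lam * H z * (f z)\<^sup>2 * (I z * W z) + b * (f z)\<^sup>2 * I z"
      by (simp add: algebra_simps)
    \<comment> \<open>In the \<open>lam\<close> term W cancels exactly; in the \<open>b\<close> term
      1/W <= 1/w.\<close>
    also have "E z * (\<dots> + Gam f z) \<le> E z * ((- lam * H z * (f z)\<^sup>2 * 1 + b * (f z)\<^sup>2 * (1 / w)) + Gam f z)"
      using Iw b_pos unfolding IW by (intro mult_left_mono add_right_mono add_left_mono) (auto simp: E_def)
    finally show ?thesis by (simp add: E_def algebra_simps)
  qed
  have i1: "integrable lborel (\<lambda>z. (Gam f z + b / w * (f z)\<^sup>2) * exp (- H z))"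
  proof (rule continuous_supported_integrable)
    show "continuous_on UNIV (\<lambda>z. (Gam f z + b / w * (f z)\<^sup>2) * exp (- H z))"
      by (intro continuous_intros C1_continuous_on H_C1 f Gam_continuous)
    show "(Gam f z + b / w * (f z)\<^sup>2) * exp (- H z) = 0" if "norm z > R" for z
      using pd_supported[OF supp that] supp[OF that] by (simp add: Gam_def)
  qed
  have i2: "integrable lborel (\<lambda>z. H z * (f z)\<^sup>2 * exp (- H z))"
  proof (rule continuous_supported_integrable)
    show "continuous_on UNIV (\<lambda>z. H z * (f z)\<^sup>2 * exp (- H z))"
      by (intro continuous_intros C1_continuous_on H_C1 f)
  qed (use supp in auto)
  have iF: "integrable lborel (pd (F j) j)" and F0: "(\<integral>z. pd (F j) j z \<partial>lborel) = 0" if "j \<in> Basis" for j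
    using integrable_pd_supported[OF F[OF that] Fsupp] integral_pd_supported[OF F[OF that] Fsupp] by auto
  have "0 = (\<integral>z. (\<Sum>j\<in>Basis. pd (F j) j z) \<partial>lborel)"
    by (subst Bochner_Integration.integral_sum) (auto simp: F0 iF)
  also have "\<dots> \<le> (\<integral>z. (Gam f z + b / w * (f z)\<^sup>2) * exp (- H z) - lam * (H z * (f z)\<^sup>2 * exp (- H z)) \<partial>lborel)"
    by (rule integral_mono)
      (intro Bochner_Integration.integrable_sum Bochner_Integration.integrable_diff
        integrable_mult_right iF i1 i2 le; assumption)+
  also have "\<dots> = (\<integral>z. (Gam f z + b / w * (f z)\<^sup>2) * exp (- H z) \<partial>lborel)
      - lam * (\<integral>z. H z * (f z)\<^sup>2 * exp (- H z) \<partial>lborel)"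
    by (subst Bochner_Integration.integral_diff[OF i1 integrable_mult_right[OF i2]]) simp
  finally show ?thesis by simp
qed

text \<open>\<open>b / w\<close> comes from the Lyapunov condition, the rest from the cutoff: each
  coordinate contributes 2 times the bound 16 on the squared derivative of
  \<open>cutoff\<close>.\<close>

definition K :: real where "K = b / w + 32 * real DIM('a)"

lemma K_pos: "0 < K"
  unfolding K_def using b_pos w_pos by (simp add: add_pos_nonneg)

text \<open>From (u + v)^2 <= 2u^2 + 2v^2 in the product rule. The upper bound 1 on the coefficients
  keeps the error proportional to f^2, with no weight.\<close>

lemma Gam_cutoff_le:
  assumes f: "C1 f" and R: "R \<ge> 1"
  shows "Gam (\<lambda>z. f z * cutoff R z) z \<le> 2 * Gam f z + 32 * real DIM('a) * (f z)\<^sup>2"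
proof -
  have "a j z * (pd (\<lambda>z. f z * cutoff R z) j z)\<^sup>2 \<le> 2 * (a j z * (pd f j z)\<^sup>2) + 32 * (f z)\<^sup>2"
    if j: "j \<in> Basis" for j
  proof -
    have eq: "pd (\<lambda>z. f z * cutoff R z) j z = f z * pd (cutoff R) j z + pd f j z * cutoff R z"
      by (rule pd_mult[OF f C1_cutoff])
    have "(f z * pd (cutoff R) j z + pd f j z * cutoff R z)\<^sup>2
        \<le> 2 * (f z * pd (cutoff R) j z)\<^sup>2 + 2 * (pd f j z * cutoff R z)\<^sup>2"
      using zero_le_power2[of "f z * pd (cutoff R) j z - pd f j z * cutoff R z"]
      by (simp add: power2_diff power2_sum)
    also have "\<dots> \<le> 2 * ((f z)\<^sup>2 * 16) + 2 * ((pd f j z)\<^sup>2 * 1)"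
      unfolding power_mult_distrib
      using pd_cutoff_sq_le[OF R, of j z] j cutoff_bounds[of R z]
      by (intro add_mono mult_left_mono) (auto simp: abs_square_le_1 intro: power_le_one)
    finally have 1: "(pd (\<lambda>z. f z * cutoff R z) j z)\<^sup>2 \<le> 32 * (f z)\<^sup>2 + 2 * (pd f j z)\<^sup>2"
      unfolding eq by simp
    have "a j z * (pd (\<lambda>z. f z * cutoff R z) j z)\<^sup>2 \<le> a j z * (32 * (f z)\<^sup>2 + 2 * (pd f j z)\<^sup>2)"
      using a_pos[OF j, of z] 1 by (intro mult_left_mono) auto
    also have "\<dots> \<le> 1 * (32 * (f z)\<^sup>2) + a j z * (2 * (pd f j z)\<^sup>2)"
      unfolding distrib_left using a_le[OF j, of z] by (intro add_right_mono mult_right_mono) auto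
    finally show ?thesis by simp
  qed
  then have "Gam (\<lambda>z. f z * cutoff R z) z \<le> (\<Sum>j\<in>(Basis::'a set). 2 * (a j z * (pd f j z)\<^sup>2) + 32 * (f z)\<^sup>2)"
    unfolding Gam_def by (rule sum_mono)
  then show ?thesis unfolding Gam_def by (simp add: sum.distrib sum_distrib_left)
qed

text \<open>Apply the compactly supported case to \<open>f\<close> times a cutoff, whose bounds do
  not depend on the radius, and let the radius grow. Fatou's lemma gives finiteness and the bound
  together, so integrability of H f^2 is a result here.\<close>

lemma
  assumes f: "C1 f" and f2: "integrable \<mu> (\<lambda>z. (f z)\<^sup>2)" and fG: "integrable \<mu> (Gam f)"
  shows integrable_H_sq: "integrable \<mu> (\<lambda>z. H z * (f z)\<^sup>2)"
    and lyapunov_bound: "lam * (\<integral>z. H z * (f z)\<^sup>2 \<partial>\<mu>) \<le> 2 * (\<integral>z. Gam f z \<partial>\<mu>) + K * (\<integral>z. (f z)\<^sup>2 \<partial>\<mu>)"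
proof -
  have [measurable]: "f \<in> borel_measurable borel" by (rule C1_measurable[OF f])
  define C where "C = (2 * (\<integral>z. Gam f z \<partial>\<mu>) + K * (\<integral>z. (f z)\<^sup>2 \<partial>\<mu>)) / lam"
  have bd: "integrable \<mu> (\<lambda>z. H z * (f z * cutoff R z)\<^sup>2)"
       "(\<integral>z. H z * (f z * cutoff R z)\<^sup>2 \<partial>\<mu>) \<le> C" if R: "R \<ge> 1" for R
  proof -
    let ?f = "\<lambda>z. f z * cutoff R z"
    have cf: "C1 ?f" by (intro C1_mult f C1_cutoff)
    have supp: "?f z = 0" if "norm z > R" for z
      using cutoff_supported[OF _ that] R by simp
    have [measurable]: "cutoff R \<in> borel_measurable borel" by (rule C1_measurable[OF C1_cutoff])
    have [measurable]: "Gam ?f \<in> borel_measurable borel" by (rule Gam_meas[OF cf])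
    have "integrable lborel (\<lambda>z. (H z * (?f z)\<^sup>2) * exp (- H z))"
    proof (rule continuous_supported_integrable)
      show "continuous_on UNIV (\<lambda>z. H z * (?f z)\<^sup>2 * exp (- H z))"
        by (intro continuous_intros C1_continuous_on H_C1 f C1_cutoff)
    qed (use supp in auto)
    then show i: "integrable \<mu> (\<lambda>z. H z * (?f z)\<^sup>2)"
      by (subst integrable_\<mu>_iff) auto
    have "lam * (Z * (\<integral>z. H z * (?f z)\<^sup>2 \<partial>\<mu>)) \<le> Z * (\<integral>z. Gam ?f z + b / w * (?f z)\<^sup>2 \<partial>\<mu>)"
      using lyapunov_supported[OF cf supp] by (subst (asm) (1 2) integral_\<mu>) auto
    then have "lam * (\<integral>z. H z * (?f z)\<^sup>2 \<partial>\<mu>) \<le> (\<integral>z. Gam ?f z + b / w * (?f z)\<^sup>2 \<partial>\<mu>)"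
      using Z_pos by (simp add: mult.left_commute)
    also have "\<dots> \<le> (\<integral>z. 2 * Gam f z + K * (f z)\<^sup>2 \<partial>\<mu>)"
    proof (rule integral_mono')
      show "integrable \<mu> (\<lambda>z. 2 * Gam f z + K * (f z)\<^sup>2)" using f2 fG by auto
      show "0 \<le> 2 * Gam f z + K * (f z)\<^sup>2" for z
        using Gam_nonneg[of f z] K_pos by simp
      show "Gam ?f z + b / w * (?f z)\<^sup>2 \<le> 2 * Gam f z + K * (f z)\<^sup>2" for z
      proof -
        have "(?f z)\<^sup>2 \<le> (f z)\<^sup>2 * 1"
          unfolding power_mult_distrib using cutoff_bounds[of R z]
          by (intro mult_left_mono) (auto simp: abs_square_le_1)
        then have "b / w * (?f z)\<^sup>2 \<le> b / w * (f z)\<^sup>2"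
          using b_pos w_pos by (intro mult_left_mono) auto
        then show ?thesis
          using Gam_cutoff_le[OF f R, of z] unfolding K_def by (simp add: algebra_simps)
      qed
    qed
    also have "\<dots> = 2 * (\<integral>z. Gam f z \<partial>\<mu>) + K * (\<integral>z. (f z)\<^sup>2 \<partial>\<mu>)"
      using f2 fG by simp
    finally show "(\<integral>z. H z * (?f z)\<^sup>2 \<partial>\<mu>) \<le> C"
      unfolding C_def using lam_pos by (simp add: field_simps)
  qed
  have Hnn: "0 \<le> H z" for z using H_ge1[of z] by linarith
  have lim: "(\<lambda>n. ennreal (H z * (f z * cutoff (real (Suc n)) z)\<^sup>2)) \<longlonglongrightarrow> ennreal (H z * (f z)\<^sup>2)" for z
  proof (rule tendsto_ennrealI)
    have "(\<lambda>n. H z * (f z * cutoff (real (Suc n)) z)\<^sup>2) \<longlonglongrightarrow> H z * (f z * 1)\<^sup>2"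
      by (intro tendsto_intros cutoff_tendsto)
    then show "(\<lambda>n. H z * (f z * cutoff (real (Suc n)) z)\<^sup>2) \<longlonglongrightarrow> H z * (f z)\<^sup>2" by simp
  qed
  have "(\<integral>\<^sup>+z. ennreal (H z * (f z)\<^sup>2) \<partial>\<mu>)
      = (\<integral>\<^sup>+z. liminf (\<lambda>n. ennreal (H z * (f z * cutoff (real (Suc n)) z)\<^sup>2)) \<partial>\<mu>)"
    by (intro nn_integral_cong lim_imp_Liminf[symmetric] lim) simp
  also have "\<dots> \<le> liminf (\<lambda>n. \<integral>\<^sup>+z. ennreal (H z * (f z * cutoff (real (Suc n)) z)\<^sup>2) \<partial>\<mu>)"
  proof (rule nn_integral_liminf)
    fix n
    have [measurable]: "cutoff (real (Suc n)) \<in> borel_measurable borel" by (rule C1_measurable[OF C1_cutoff])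
    show "(\<lambda>z. ennreal (H z * (f z * cutoff (real (Suc n)) z)\<^sup>2)) \<in> borel_measurable \<mu>"
      by measurable
  qed
  also have "\<dots> \<le> liminf (\<lambda>n. ennreal C)"
  proof (rule Liminf_mono, rule always_eventually, rule allI)
    fix n
    have 1: "real (Suc n) \<ge> 1" by simp
    have "(\<integral>\<^sup>+z. ennreal (H z * (f z * cutoff (real (Suc n)) z)\<^sup>2) \<partial>\<mu>)
        = ennreal (\<integral>z. H z * (f z * cutoff (real (Suc n)) z)\<^sup>2 \<partial>\<mu>)"
      by (rule nn_integral_eq_integral[OF bd(1)[OF 1]]) (use Hnn in auto)
    then show "(\<integral>\<^sup>+z. ennreal (H z * (f z * cutoff (real (Suc n)) z)\<^sup>2) \<partial>\<mu>) \<le> ennreal C"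
      using bd(2)[OF 1] by (simp add: ennreal_leI)
  qed
  finally have le: "(\<integral>\<^sup>+z. ennreal (H z * (f z)\<^sup>2) \<partial>\<mu>) \<le> ennreal C"
    by (simp add: Liminf_const)
  show i: "integrable \<mu> (\<lambda>z. H z * (f z)\<^sup>2)"
  proof (rule integrableI_nonneg)
    show "(\<integral>\<^sup>+z. ennreal (H z * (f z)\<^sup>2) \<partial>\<mu>) < \<infinity>"
      using le by (simp add: order.strict_trans1)
  qed (use Hnn in auto)
  have C0: "C \<ge> 0"
    unfolding C_def using lam_pos K_pos Gam_nonneg by (intro divide_nonneg_pos add_nonneg_nonneg) auto
  have "(\<integral>\<^sup>+z. ennreal (H z * (f z)\<^sup>2) \<partial>\<mu>) = ennreal (\<integral>z. H z * (f z)\<^sup>2 \<partial>\<mu>)"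
    by (rule nn_integral_eq_integral[OF i]) (use Hnn in auto)
  then have "(\<integral>z. H z * (f z)\<^sup>2 \<partial>\<mu>) \<le> C"
    using le C0 by (simp add: ennreal_le_iff)
  then show "lam * (\<integral>z. H z * (f z)\<^sup>2 \<partial>\<mu>) \<le> 2 * (\<integral>z. Gam f z \<partial>\<mu>) + K * (\<integral>z. (f z)\<^sup>2 \<partial>\<mu>)"
    unfolding C_def using lam_pos by (simp add: field_simps)
qed

end

section \<open>Super-Poincare inequality\<close>

context lyapunov_gibbs
begin

text \<open>The radius is chosen so that \<open>L\<close> times it equals exp(-s r) - exp(-s (r+1)),
  the gap between the values of exp(-s H) on the levels r and r + 1.\<close>

lemma H_le_translate:
  assumes "H z \<le> r" and "norm h \<le> (1 - exp (- s)) / L * exp (- s * r)"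
  shows "H (z + h) \<le> r + 1"
proof -
  have "\<bar>exp (- s * H (z + h)) - exp (- s * H z)\<bar> \<le> L * norm h"
    using exp_lipschitz[of "z + h" z] by simp
  moreover have "L * norm h \<le> L * ((1 - exp (- s)) / L * exp (- s * r))"
    using assms(2) L_pos by (intro mult_left_mono) auto
  moreover have "L * ((1 - exp (- s)) / L * exp (- s * r)) = exp (- s * r) - exp (- s * (r + 1))"
  proof -
    have "exp (- s * (r + 1)) = exp (- s) * exp (- s * r)"
      by (simp add: algebra_simps exp_add[symmetric])
    then show ?thesis using L_pos by (simp add: left_diff_distrib)
  qed
  moreover have "exp (- s * r) \<le> exp (- s * H z)"
    using assms(1) s_pos by simp
  ultimately have "exp (- s * (r + 1)) \<le> exp (- s * H (z + h))"
    by linarith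
  then show ?thesis using s_pos by simp
qed

section \<open>Comparison of \<mu> with Lebesgue measure\<close>

lemma nn_integral_exp_H:
  assumes "integrable \<mu> g" and "\<And>z. 0 \<le> g z"
  shows "(\<integral>\<^sup>+z. ennreal (g z * exp (- H z)) \<partial>lborel) = ennreal (Z * (\<integral>z. g z \<partial>\<mu>))"
proof -
  have m: "g \<in> borel_measurable borel" using assms(1) by auto
  show ?thesis
    using assms integrable_\<mu>_iff[OF m]
    by (subst integral_\<mu>[OF m, symmetric], subst nn_integral_eq_integral) auto
qed

lemma nn_integral_weight_le:
  assumes m: "g \<in> borel_measurable borel" and "integrable \<mu> k" and k: "\<And>z. 0 \<le> k z"
    and le: "\<And>z. z \<in> S \<Longrightarrow> g z \<le> c * (k z * exp (- H z))" and c: "0 \<le> c"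
  shows "(\<integral>\<^sup>+z. ennreal (g z) * indicator S z \<partial>lborel) \<le> ennreal (c * (Z * (\<integral>z. k z \<partial>\<mu>)))"
proof -
  have [measurable]: "k \<in> borel_measurable borel" using assms(2) by auto
  have "(\<integral>\<^sup>+z. ennreal (g z) * indicator S z \<partial>lborel) \<le> (\<integral>\<^sup>+z. ennreal c * ennreal (k z * exp (- H z)) \<partial>lborel)"
    using le k c by (intro nn_integral_mono) (auto simp: indicator_def ennreal_mult[symmetric] ennreal_leI)
  also have "\<dots> = ennreal c * ennreal (Z * (\<integral>z. k z \<partial>\<mu>))"
    by (subst nn_integral_cmult) (auto simp: nn_integral_exp_H[OF assms(2) k])
  also have "\<dots> = ennreal (c * (Z * (\<integral>z. k z \<partial>\<mu>)))"
    using c by (intro ennreal_mult'[symmetric])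
  finally show ?thesis .
qed

text \<open>Where H <= M, restoring the density costs e^M and replacing the weighted gradient by the
  full one costs e^(kap M).\<close>

lemma nn_integral_grad_sq_le:
  assumes f: "C1 f" and fG: "integrable \<mu> (Gam f)" and S: "\<And>z. z \<in> S \<Longrightarrow> H z \<le> M"
  shows "(\<integral>\<^sup>+z. ennreal (grad_sq f z) * indicator S z \<partial>lborel)
      \<le> ennreal (exp ((kap + 1) * M) * (Z * (\<integral>z. Gam f z \<partial>\<mu>)))"
proof (rule nn_integral_weight_le[OF grad_sq_measurable[OF f] fG Gam_nonneg])
  fix z assume z: "z \<in> S"
  have "exp ((kap + 1) * H z) * (Gam f z * exp (- H z)) = exp (kap * H z) * Gam f z"
    by (simp add: algebra_simps exp_add[symmetric])
  moreover have "grad_sq f z = exp (kap * H z) * (exp (- kap * H z) * grad_sq f z)"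
    by (simp add: mult.assoc[symmetric] exp_add[symmetric])
  moreover have "\<dots> \<le> exp (kap * H z) * Gam f z"
    by (intro mult_left_mono Gam_ge) auto
  moreover have "exp ((kap + 1) * H z) * (Gam f z * exp (- H z)) \<le> exp ((kap + 1) * M) * (Gam f z * exp (- H z))"
    using S[OF z] kap_nonneg Gam_nonneg[of f z] by (intro mult_right_mono) (auto intro: mult_left_mono)
  ultimately show "grad_sq f z \<le> exp ((kap + 1) * M) * (Gam f z * exp (- H z))" by linarith
qed simp

text \<open>The opposite direction is free: e^(-H) <= 1.\<close>

lemma ennreal_integral_indicator_le:
  assumes [measurable]: "g \<in> borel_measurable borel" "S \<in> sets borel"
    and "integrable \<mu> g" and g: "\<And>z. 0 \<le> g z"
  shows "ennreal (Z * (\<integral>z. g z * indicator S z \<partial>\<mu>)) \<le> (\<integral>\<^sup>+z. ennreal (g z) * indicator S z \<partial>lborel)"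
proof -
  have i: "integrable \<mu> (\<lambda>z. g z * indicator S z)"
    using integrable_mult_indicator[OF _ assms(3), of S] by (simp add: mult.commute)
  have "ennreal (Z * (\<integral>z. g z * indicator S z \<partial>\<mu>)) = (\<integral>\<^sup>+z. ennreal (g z * indicator S z * exp (- H z)) \<partial>lborel)"
    by (rule nn_integral_exp_H[symmetric]) (use i g in auto)
  also have "\<dots> \<le> (\<integral>\<^sup>+z. ennreal (g z) * indicator S z \<partial>lborel)"
  proof (rule nn_integral_mono)
    fix z
    have "H z \<ge> 0" using H_ge1[of z] by linarith
    then have "g z * exp (- H z) \<le> g z * 1" using g by (intro mult_left_mono) auto
    then show "ennreal (g z * indicator S z * exp (- H z)) \<le> ennreal (g z) * indicator S z"
      by (auto simp: indicator_def ennreal_leI)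
  qed
  finally show ?thesis .
qed

lemma integral_Gam_nonneg: "0 \<le> (\<integral>z. Gam f z \<partial>\<mu>)"
  by (rule Bochner_Integration.integral_nonneg) (rule Gam_nonneg)

lemma integrable_abs_of_sq:
  fixes f :: "'a \<Rightarrow> real"
  assumes [measurable]: "f \<in> borel_measurable borel" and "integrable \<mu> (\<lambda>z. (f z)\<^sup>2)"
  shows "integrable \<mu> (\<lambda>z. \<bar>f z\<bar>)"
proof (rule Bochner_Integration.integrable_bound[of _ "\<lambda>z. 1 + (f z)\<^sup>2"])
  have "\<bar>x\<bar> \<le> 1 + x\<^sup>2" for x :: real
    using zero_le_power2[of "\<bar>x\<bar> - 1"] by (simp add: power2_diff)
  then show "AE z in \<mu>. norm \<bar>f z\<bar> \<le> norm (1 + (f z)\<^sup>2)" by simp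
qed (use assms in auto)

text \<open>Averaging \<open>f(z)\<^sup>2 \<le> (f(z) - f(z+h))\<^sup>2 + 2 |f(z)| |f(z+h)|\<close> over a small ball of \<open>h\<close>: the first
  term is controlled by the gradient, the second by the \<open>L\<^sup>1\<close> norm.\<close>

lemma local_super_poincare_aux:
  assumes f: "C1 f" and f2: "integrable \<mu> (\<lambda>z. (f z)\<^sup>2)" and fG: "integrable \<mu> (Gam f)"
    and d: "0 < d" "d \<le> (1 - exp (- s)) / L * exp (- s * r)"
  shows "(\<integral>z. (f z)\<^sup>2 * indicator {z. H z \<le> r} z \<partial>\<mu>)
    \<le> d\<^sup>2 * exp ((kap + 1) * (r + 1)) * (\<integral>z. Gam f z \<partial>\<mu>)
      + 2 * Z * (exp (r + 1))\<^sup>2 / measure lborel (cball (0::'a) d) * (\<integral>z. \<bar>f z\<bar> \<partial>\<mu>)\<^sup>2"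
proof -
  have fm [measurable]: "f \<in> borel_measurable borel" by (rule C1_measurable[OF f])
  define A where "A = {z. H z \<le> r}"
  define A' where "A' = {z. H z \<le> r + 1}"
  define B where "B = cball (0::'a) d"
  have [measurable]: "A \<in> sets borel" "A' \<in> sets borel" "B \<in> sets borel"
    unfolding A_def A'_def B_def by measurable
  have fin: "emeasure lborel B < \<infinity>" unfolding B_def by (rule emeasure_compact_finite) simp
  define v where "v = measure lborel B"
  have ev: "emeasure lborel B = ennreal v"
    unfolding v_def using fin by (simp add: emeasure_eq_ennreal_measure)
  have v: "v > 0"
    unfolding v_def B_def using d by (simp add: content_cball_pos)
  have AA': "z + h \<in> A'" if "z \<in> A" "norm h \<le> d" for z h
    using H_le_translate[of z r h] that d unfolding A_def A'_def by auto
  define I1 where "I1 = (\<integral>z. \<bar>f z\<bar> \<partial>\<mu>)"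
  define EG where "EG = (\<integral>z. Gam f z \<partial>\<mu>)"
  define X where "X = (\<integral>\<^sup>+z. ennreal (grad_sq f z) * indicator A' z \<partial>lborel)"
  define Y where "Y = (\<integral>\<^sup>+z. ennreal \<bar>f z\<bar> * indicator A' z \<partial>lborel)"
  have X: "X \<le> ennreal (exp ((kap + 1) * (r + 1)) * (Z * EG))"
    unfolding X_def EG_def by (rule nn_integral_grad_sq_le[OF f fG]) (simp add: A'_def)
  have Y: "Y \<le> ennreal (exp (r + 1) * (Z * I1))"
    unfolding Y_def I1_def
  proof (rule nn_integral_weight_le)
    fix z assume "z \<in> A'"
    then have "1 \<le> exp (r + 1) * exp (- H z)" by (simp add: A'_def exp_add[symmetric])
    then have "\<bar>f z\<bar> * 1 \<le> \<bar>f z\<bar> * (exp (r + 1) * exp (- H z))" by (intro mult_left_mono) auto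
    then show "\<bar>f z\<bar> \<le> exp (r + 1) * (\<bar>f z\<bar> * exp (- H z))" by (simp add: algebra_simps)
  qed (auto intro: integrable_abs_of_sq f2)
  \<comment> \<open>In the product term the restriction of h to \<open>B\<close> is relaxed to z + h
    in \<open>A'\<close>. The double integral over z and h then factors into
    \<open>Y * Y\<close>.\<close>
  have pw: "ennreal ((f z)\<^sup>2) * indicator A z * indicator B h
      \<le> ennreal ((f (z + h) - f z)\<^sup>2) * indicator A z * indicator B h
        + 2 * ((ennreal \<bar>f z\<bar> * indicator A' z) * (ennreal \<bar>f (z + h)\<bar> * indicator A' (z + h)))" for z h
  proof (cases "z \<in> A \<and> h \<in> B")
    case True
    then have "z \<in> A'" "z + h \<in> A'" using AA'[of z h] AA'[of z 0] d by (auto simp: B_def)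
    have "2 * f (z + h) * f z \<le> 2 * (\<bar>f z\<bar> * \<bar>f (z + h)\<bar>)"
      using abs_ge_self[of "f (z + h) * f z"] by (simp add: abs_mult mult.commute)
    then have "(f z)\<^sup>2 \<le> (f (z + h) - f z)\<^sup>2 + 2 * (\<bar>f z\<bar> * \<bar>f (z + h)\<bar>)"
      using zero_le_power2[of "f (z + h)"] unfolding power2_diff by linarith
    then have "ennreal ((f z)\<^sup>2) \<le> ennreal ((f (z + h) - f z)\<^sup>2 + 2 * (\<bar>f z\<bar> * \<bar>f (z + h)\<bar>))"
      by (rule ennreal_leI)
    also have "\<dots> = ennreal ((f (z + h) - f z)\<^sup>2) + 2 * (ennreal \<bar>f z\<bar> * ennreal \<bar>f (z + h)\<bar>)"
      by (simp add: ennreal_mult)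
    finally show ?thesis using True \<open>z \<in> A'\<close> \<open>z + h \<in> A'\<close> by simp
  qed auto
  \<comment> \<open>Integrating over h in \<open>B\<close> multiplies the left side by the volume
    \<open>v\<close>; this averages without dividing extended reals.\<close>
  have "(\<integral>\<^sup>+z. ennreal ((f z)\<^sup>2) * indicator A z \<partial>lborel) * ennreal v
      = (\<integral>\<^sup>+h. \<integral>\<^sup>+z. ennreal ((f z)\<^sup>2) * indicator A z * indicator B h \<partial>lborel \<partial>lborel)"
    by (simp add: nn_integral_multc nn_integral_cmult ev)
  also have "\<dots> \<le> (\<integral>\<^sup>+h. \<integral>\<^sup>+z. ennreal ((f (z + h) - f z)\<^sup>2) * indicator A z * indicator B h
        + 2 * ((ennreal \<bar>f z\<bar> * indicator A' z) * (ennreal \<bar>f (z + h)\<bar> * indicator A' (z + h))) \<partial>lborel \<partial>lborel)"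
    by (intro nn_integral_mono pw)
  also have "\<dots> = (\<integral>\<^sup>+h. \<integral>\<^sup>+z. ennreal ((f (z + h) - f z)\<^sup>2) * indicator A z * indicator B h \<partial>lborel \<partial>lborel)
      + (\<integral>\<^sup>+h. \<integral>\<^sup>+z. 2 * ((ennreal \<bar>f z\<bar> * indicator A' z) * (ennreal \<bar>f (z + h)\<bar> * indicator A' (z + h))) \<partial>lborel \<partial>lborel)"
    by (subst nn_integral_add[symmetric], measurable) (intro nn_integral_cong nn_integral_add, measurable)
  also have "\<dots> \<le> (\<integral>\<^sup>+h. (ennreal (d\<^sup>2) * X) * indicator B h \<partial>lborel) + 2 * (Y * Y)"
  proof (rule add_mono)
    show "(\<integral>\<^sup>+h. \<integral>\<^sup>+z. ennreal ((f (z + h) - f z)\<^sup>2) * indicator A z * indicator B h \<partial>lborel \<partial>lborel)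
        \<le> (\<integral>\<^sup>+h. (ennreal (d\<^sup>2) * X) * indicator B h \<partial>lborel)"
    proof (rule nn_integral_mono)
      fix h :: 'a
      have "(\<integral>\<^sup>+z. ennreal ((f (z + h) - f z)\<^sup>2) * indicator A z \<partial>lborel) \<le> ennreal (d\<^sup>2) * X" if "h \<in> B"
      proof -
        have hd: "norm h \<le> d" using that by (simp add: B_def)
        have "(\<integral>\<^sup>+z. ennreal ((f (z + h) - f z)\<^sup>2) * indicator A z \<partial>lborel) \<le> ennreal ((norm h)\<^sup>2) * X"
          unfolding X_def
        proof (rule nn_integral_sq_translate_diff_le[OF f])
          fix z and t :: real assume "z \<in> A" and t: "t \<in> {0..1}"
          have "\<bar>t\<bar> * norm h \<le> 1 * norm h" using t by (intro mult_right_mono) auto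
          then show "z + t *\<^sub>R h \<in> A'" using hd by (intro AA' \<open>z \<in> A\<close>) auto
        qed measurable
        also have "\<dots> \<le> ennreal (d\<^sup>2) * X"
          using hd by (intro mult_right_mono ennreal_leI power_mono) auto
        finally show ?thesis .
      qed
      then show "(\<integral>\<^sup>+z. ennreal ((f (z + h) - f z)\<^sup>2) * indicator A z * indicator B h \<partial>lborel)
          \<le> (ennreal (d\<^sup>2) * X) * indicator B h"
        by (cases "h \<in> B") auto
    qed
    have "(\<integral>\<^sup>+h. \<integral>\<^sup>+z. 2 * ((ennreal \<bar>f z\<bar> * indicator A' z) * (ennreal \<bar>f (z + h)\<bar> * indicator A' (z + h))) \<partial>lborel \<partial>lborel)
        = (\<integral>\<^sup>+z. \<integral>\<^sup>+h. 2 * ((ennreal \<bar>f z\<bar> * indicator A' z) * (ennreal \<bar>f (z + h)\<bar> * indicator A' (z + h))) \<partial>lborel \<partial>lborel)"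
      by (rule lborel_pair.Fubini') measurable
    also have "\<dots> = (\<integral>\<^sup>+z. 2 * ((ennreal \<bar>f z\<bar> * indicator A' z) * Y) \<partial>lborel)"
    proof (rule nn_integral_cong)
      fix z
      have "(\<integral>\<^sup>+h. ennreal \<bar>f (z + h)\<bar> * indicator A' (z + h) \<partial>lborel) = Y"
        unfolding Y_def using nn_integral_lborel_translate[of "\<lambda>h. ennreal \<bar>f h\<bar> * indicator A' h" z]
        by (simp add: add.commute)
      then show "(\<integral>\<^sup>+h. 2 * ((ennreal \<bar>f z\<bar> * indicator A' z) * (ennreal \<bar>f (z + h)\<bar> * indicator A' (z + h))) \<partial>lborel)
          = 2 * ((ennreal \<bar>f z\<bar> * indicator A' z) * Y)"
        by (simp add: nn_integral_cmult)
    qed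
    also have "\<dots> = 2 * (Y * Y)"
      by (simp add: nn_integral_cmult nn_integral_multc Y_def)
    finally show "(\<integral>\<^sup>+h. \<integral>\<^sup>+z. 2 * ((ennreal \<bar>f z\<bar> * indicator A' z) * (ennreal \<bar>f (z + h)\<bar> * indicator A' (z + h))) \<partial>lborel \<partial>lborel)
        \<le> 2 * (Y * Y)" by simp
  qed
  also have "\<dots> = ennreal (d\<^sup>2) * X * ennreal v + 2 * (Y * Y)"
    by (simp add: nn_integral_cmult ev)
  also have "\<dots> \<le> ennreal (d\<^sup>2) * ennreal (exp ((kap + 1) * (r + 1)) * (Z * EG)) * ennreal v
      + 2 * (ennreal (exp (r + 1) * (Z * I1)) * ennreal (exp (r + 1) * (Z * I1)))"
    by (intro add_mono mult_mono X Y order_refl) auto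
  also have "\<dots> = ennreal (d\<^sup>2 * (exp ((kap + 1) * (r + 1)) * (Z * EG)) * v
      + 2 * ((exp (r + 1) * (Z * I1)) * (exp (r + 1) * (Z * I1))))"
  proof -
    have "EG \<ge> 0" "I1 \<ge> 0" unfolding EG_def I1_def using integral_Gam_nonneg[of f] by auto
    then show ?thesis using Z_pos v by (simp add: ennreal_mult ennreal_plus)
  qed
  finally have 1: "(\<integral>\<^sup>+z. ennreal ((f z)\<^sup>2) * indicator A z \<partial>lborel) * ennreal v \<le> \<dots>" .
  define J where "J = (\<integral>z. (f z)\<^sup>2 * indicator A z \<partial>\<mu>)"
  have "ennreal (Z * J) \<le> (\<integral>\<^sup>+z. ennreal ((f z)\<^sup>2) * indicator A z \<partial>lborel)"
    unfolding J_def by (rule ennreal_integral_indicator_le) (use f2 in auto)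
  then have "ennreal (Z * J) * ennreal v \<le> ennreal (d\<^sup>2 * (exp ((kap + 1) * (r + 1)) * (Z * EG)) * v
      + 2 * ((exp (r + 1) * (Z * I1)) * (exp (r + 1) * (Z * I1))))"
    using 1 by (meson mult_right_mono order_trans zero_le)
  moreover have "ennreal (Z * J) * ennreal v = ennreal (Z * J * v)"
    using v by (simp add: ennreal_mult'')
  moreover have "0 \<le> d\<^sup>2 * (exp ((kap + 1) * (r + 1)) * (Z * EG)) * v
      + 2 * ((exp (r + 1) * (Z * I1)) * (exp (r + 1) * (Z * I1)))"
    using Z_pos v integral_Gam_nonneg[of f] unfolding EG_def I1_def
    by (intro add_nonneg_nonneg mult_nonneg_nonneg) auto
  ultimately have "Z * J * v \<le> d\<^sup>2 * (exp ((kap + 1) * (r + 1)) * (Z * EG)) * v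
      + 2 * ((exp (r + 1) * (Z * I1)) * (exp (r + 1) * (Z * I1)))"
    by (simp add: ennreal_le_iff)
  also have "\<dots> = (Z * v) * (d\<^sup>2 * exp ((kap + 1) * (r + 1)) * EG + 2 * Z * (exp (r + 1))\<^sup>2 / v * I1\<^sup>2)"
    using v by (simp add: field_simps power2_eq_square)
  finally have "(Z * v) * J \<le> (Z * v) * (d\<^sup>2 * exp ((kap + 1) * (r + 1)) * EG + 2 * Z * (exp (r + 1))\<^sup>2 / v * I1\<^sup>2)"
    by (simp add: mult_ac)
  then have "J \<le> d\<^sup>2 * exp ((kap + 1) * (r + 1)) * EG + 2 * Z * (exp (r + 1))\<^sup>2 / v * I1\<^sup>2"
    using Z_pos v by (simp add: mult_le_cancel_left_pos)
  then show ?thesis unfolding J_def EG_def I1_def v_def B_def A_def .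
qed

lemma local_super_poincare:
  obtains C\<^sub>1 C\<^sub>2 \<kappa> where "0 < C\<^sub>1" "0 < C\<^sub>2" "0 < \<kappa>"
    "\<And>r f. 0 \<le> r \<Longrightarrow> C1 f \<Longrightarrow> integrable \<mu> (\<lambda>z. (f z)\<^sup>2) \<Longrightarrow> integrable \<mu> (Gam f) \<Longrightarrow>
      (\<integral>z. (f z)\<^sup>2 * indicator {z. H z \<le> r} z \<partial>\<mu>)
        \<le> C\<^sub>1 * exp (- r) * (\<integral>z. Gam f z \<partial>\<mu>) + C\<^sub>2 * exp (\<kappa> * r) * (\<integral>z. \<bar>f z\<bar> \<partial>\<mu>)\<^sup>2"
proof -
  define c where "c = (1 - exp (- s)) / L"
  \<comment> \<open>\<open>\<tau> \<ge> s\<close> keeps the ball within the radius of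
    \<open>H_le_translate\<close>, and 2\<tau> >= kap + 2 turns d^2 e^((kap+1)(r+1)) into a constant
    times e^(-r).\<close>
  define \<tau> where "\<tau> = s + kap + 2"
  define n where "n = DIM('a)"
  define V where "V = unit_ball_vol (real n)"
  have c: "c > 0" unfolding c_def using s_pos L_pos by simp
  have V: "V > 0" unfolding V_def by simp
  have \<tau>: "\<tau> > 0" using s_pos kap_nonneg unfolding \<tau>_def by simp
  show ?thesis
  \<comment> \<open>In the last rate, 2 comes from the squared density factor e^(r+1), and
    \<open>real n * \<tau>\<close> from the volume of a ball of radius c e^(-\<tau> r).\<close>
  proof (rule that[of "c\<^sup>2 * exp (kap + 1)" "2 * Z * exp 2 / (V * c ^ n)" "2 + real n * \<tau>"])
    show "0 < c\<^sup>2 * exp (kap + 1)" "0 < 2 * Z * exp 2 / (V * c ^ n)" "0 < 2 + real n * \<tau>"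
      using c V \<tau> Z_pos by (auto intro: add_pos_nonneg)
    fix r :: real and f assume r: "0 \<le> r" and f: "C1 f" "integrable \<mu> (\<lambda>z. (f z)\<^sup>2)" "integrable \<mu> (Gam f)"
    define d where "d = c * exp (- \<tau> * r)"
    have d: "0 < d" using c by (simp add: d_def)
    have "s * r \<le> \<tau> * r" using r kap_nonneg by (intro mult_right_mono) (auto simp: \<tau>_def)
    then have d': "d \<le> (1 - exp (- s)) / L * exp (- s * r)"
      unfolding d_def c_def[symmetric] using c by (intro mult_left_mono) auto
    have 1: "d\<^sup>2 * exp ((kap + 1) * (r + 1)) \<le> c\<^sup>2 * exp (kap + 1) * exp (- r)"
    proof -
      have "d\<^sup>2 * exp ((kap + 1) * (r + 1)) = c\<^sup>2 * exp (- 2 * \<tau> * r + (kap + 1) * (r + 1))"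
        unfolding d_def power_mult_distrib by (simp add: exp_add[symmetric] exp_double[symmetric] mult_ac)
      also have "\<dots> \<le> c\<^sup>2 * exp (kap + 1 + (- r))"
      proof -
        have "0 \<le> (2 * s + kap + 2) * r" using r s_pos kap_nonneg by (intro mult_nonneg_nonneg) auto
        then have "- 2 * \<tau> * r + (kap + 1) * (r + 1) \<le> kap + 1 + (- r)"
          unfolding \<tau>_def by (simp add: algebra_simps)
        then show ?thesis by (intro mult_left_mono) auto
      qed
      finally show ?thesis by (simp only: exp_add mult.assoc)
    qed
    have m: "measure lborel (cball (0::'a) d) = V * c ^ n * exp (- (real n * \<tau>) * r)"
    proof -
      have "emeasure lborel (cball (0::'a) d) = ennreal (V * d ^ n)"
        unfolding V_def n_def using d by (intro emeasure_cball) simp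
      then have "measure lborel (cball (0::'a) d) = V * d ^ n"
        using V d by (simp add: measure_def)
      then show ?thesis
        unfolding d_def power_mult_distrib by (simp add: exp_of_nat_mult[symmetric] mult_ac)
    qed
    have 2: "2 * Z * (exp (r + 1))\<^sup>2 / measure lborel (cball (0::'a) d)
        = 2 * Z * exp 2 / (V * c ^ n) * exp ((2 + real n * \<tau>) * r)"
    proof -
      have "(exp (r + 1))\<^sup>2 = exp 2 * exp (2 * r)"
        by (simp add: exp_double[symmetric] exp_add[symmetric] algebra_simps)
      moreover have "exp ((2 + real n * \<tau>) * r) = exp (2 * r) * exp (real n * \<tau> * r)"
        by (simp add: exp_add[symmetric] algebra_simps)
      ultimately show ?thesis
        unfolding m using V c by (simp add: exp_minus field_simps)
    qed
    have "(\<integral>z. (f z)\<^sup>2 * indicator {z. H z \<le> r} z \<partial>\<mu>)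
        \<le> d\<^sup>2 * exp ((kap + 1) * (r + 1)) * (\<integral>z. Gam f z \<partial>\<mu>)
        + 2 * Z * (exp (r + 1))\<^sup>2 / measure lborel (cball (0::'a) d) * (\<integral>z. \<bar>f z\<bar> \<partial>\<mu>)\<^sup>2"
      by (rule local_super_poincare_aux[OF f d d'])
    also have "\<dots> \<le> c\<^sup>2 * exp (kap + 1) * exp (- r) * (\<integral>z. Gam f z \<partial>\<mu>)
        + 2 * Z * exp 2 / (V * c ^ n) * exp ((2 + real n * \<tau>) * r) * (\<integral>z. \<bar>f z\<bar> \<partial>\<mu>)\<^sup>2"
      unfolding 2 using 1 integral_Gam_nonneg[of f] by (intro add_right_mono mult_right_mono) auto
    finally show "(\<integral>z. (f z)\<^sup>2 * indicator {z. H z \<le> r} z \<partial>\<mu>)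
        \<le> c\<^sup>2 * exp (kap + 1) * exp (- r) * (\<integral>z. Gam f z \<partial>\<mu>)
        + 2 * Z * exp 2 / (V * c ^ n) * exp ((2 + real n * \<tau>) * r) * (\<integral>z. \<bar>f z\<bar> \<partial>\<mu>)\<^sup>2" .
  qed
qed

text \<open>Markov's inequality for the weight H: outside the sublevel set f^2 <= H f^2 / r, and
  \<open>lyapunov_bound\<close> controls the integral of H f^2.\<close>

lemma integral_sq_split:
  assumes f: "C1 f" and f2: "integrable \<mu> (\<lambda>z. (f z)\<^sup>2)" and fG: "integrable \<mu> (Gam f)" and r: "0 < r"
  shows "(\<integral>z. (f z)\<^sup>2 \<partial>\<mu>) \<le> (\<integral>z. (f z)\<^sup>2 * indicator {z. H z \<le> r} z \<partial>\<mu>)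
      + (2 * (\<integral>z. Gam f z \<partial>\<mu>) + K * (\<integral>z. (f z)\<^sup>2 \<partial>\<mu>)) / (lam * r)"
proof -
  have S: "{z. H z \<le> r} \<in> sets borel" by measurable
  have i: "integrable \<mu> (\<lambda>z. (f z)\<^sup>2 * indicator {z. H z \<le> r} z)"
    using integrable_mult_indicator[OF _ f2, of "{z. H z \<le> r}"] S by (simp add: mult.commute)
  note iH = integrable_H_sq[OF f f2 fG]
  have "(\<integral>z. (f z)\<^sup>2 \<partial>\<mu>) \<le> (\<integral>z. (f z)\<^sup>2 * indicator {z. H z \<le> r} z + (1 / r) * (H z * (f z)\<^sup>2) \<partial>\<mu>)"
  proof (rule integral_mono[OF f2])
    show "integrable \<mu> (\<lambda>z. (f z)\<^sup>2 * indicator {z. H z \<le> r} z + (1 / r) * (H z * (f z)\<^sup>2))"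
      using i iH by (intro Bochner_Integration.integrable_add integrable_mult_right)
    fix z
    show "(f z)\<^sup>2 \<le> (f z)\<^sup>2 * indicator {z. H z \<le> r} z + (1 / r) * (H z * (f z)\<^sup>2)"
    proof (cases "H z \<le> r")
      case True
      then show ?thesis using r H_ge1[of z] by simp
    next
      case False
      then have "r * (f z)\<^sup>2 \<le> H z * (f z)\<^sup>2" by (intro mult_right_mono) auto
      then show ?thesis using False r by (simp add: field_simps)
    qed
  qed
  also have "\<dots> = (\<integral>z. (f z)\<^sup>2 * indicator {z. H z \<le> r} z \<partial>\<mu>) + (1 / r) * (\<integral>z. H z * (f z)\<^sup>2 \<partial>\<mu>)"
    by (subst Bochner_Integration.integral_add[OF i integrable_mult_right[OF iH]]) simp
  also have "(1 / r) * (\<integral>z. H z * (f z)\<^sup>2 \<partial>\<mu>)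
      \<le> (2 * (\<integral>z. Gam f z \<partial>\<mu>) + K * (\<integral>z. (f z)\<^sup>2 \<partial>\<mu>)) / (lam * r)"
    using lyapunov_bound[OF f f2 fG] lam_pos r by (simp add: field_simps)
  finally show ?thesis by simp
qed

text \<open>For r >= 1 the factor e^(-r) is at most 1/r and merges with the Lyapunov part. The L2
  term stays on the right: it can be absorbed once r is large, which \<open>trunc_poincare\<close>
  arranges.\<close>

lemma super_poincare:
  obtains C C\<^sub>2 \<kappa> where "0 < C" "0 < C\<^sub>2" "0 < \<kappa>"
    "\<And>r f. 1 \<le> r \<Longrightarrow> C1 f \<Longrightarrow> integrable \<mu> (\<lambda>z. (f z)\<^sup>2) \<Longrightarrow> integrable \<mu> (Gam f) \<Longrightarrow>
      (\<integral>z. (f z)\<^sup>2 \<partial>\<mu>) \<le> C / r * (\<integral>z. Gam f z \<partial>\<mu>) + C\<^sub>2 * exp (\<kappa> * r) * (\<integral>z. \<bar>f z\<bar> \<partial>\<mu>)\<^sup>2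
        + K / (lam * r) * (\<integral>z. (f z)\<^sup>2 \<partial>\<mu>)"
proof (rule local_super_poincare)
  fix C\<^sub>1 C\<^sub>2 \<kappa> assume C: "0 < C\<^sub>1" "0 < C\<^sub>2" "0 < \<kappa>"
    and le: "\<And>r f. 0 \<le> r \<Longrightarrow> C1 f \<Longrightarrow> integrable \<mu> (\<lambda>z. (f z)\<^sup>2) \<Longrightarrow> integrable \<mu> (Gam f) \<Longrightarrow>
      (\<integral>z. (f z)\<^sup>2 * indicator {z. H z \<le> r} z \<partial>\<mu>)
        \<le> C\<^sub>1 * exp (- r) * (\<integral>z. Gam f z \<partial>\<mu>) + C\<^sub>2 * exp (\<kappa> * r) * (\<integral>z. \<bar>f z\<bar> \<partial>\<mu>)\<^sup>2"
  show ?thesis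
  proof (rule that[of "C\<^sub>1 + 2 / lam" C\<^sub>2 \<kappa>])
    show "0 < C\<^sub>1 + 2 / lam" using C lam_pos by (simp add: add_pos_pos)
    show "0 < C\<^sub>2" "0 < \<kappa>" by fact+
    fix r :: real and f assume r: "1 \<le> r" and f: "C1 f" "integrable \<mu> (\<lambda>z. (f z)\<^sup>2)" "integrable \<mu> (Gam f)"
    have "r \<le> exp r" using exp_ge_add_one_self[of r] by linarith
    then have "exp (- r) \<le> 1 / r" using r by (simp add: exp_minus field_simps)
    then have "C\<^sub>1 * exp (- r) * (\<integral>z. Gam f z \<partial>\<mu>) \<le> C\<^sub>1 * (1 / r) * (\<integral>z. Gam f z \<partial>\<mu>)"
      using C integral_Gam_nonneg[of f] by (intro mult_right_mono mult_left_mono) auto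
    then have "(\<integral>z. (f z)\<^sup>2 \<partial>\<mu>) \<le> C\<^sub>1 * (1 / r) * (\<integral>z. Gam f z \<partial>\<mu>)
        + C\<^sub>2 * exp (\<kappa> * r) * (\<integral>z. \<bar>f z\<bar> \<partial>\<mu>)\<^sup>2
        + (2 * (\<integral>z. Gam f z \<partial>\<mu>) + K * (\<integral>z. (f z)\<^sup>2 \<partial>\<mu>)) / (lam * r)"
      using le[OF _ f, of r] integral_sq_split[OF f, of r] r by linarith
    also have "\<dots> = (C\<^sub>1 + 2 / lam) / r * (\<integral>z. Gam f z \<partial>\<mu>)
        + C\<^sub>2 * exp (\<kappa> * r) * (\<integral>z. \<bar>f z\<bar> \<partial>\<mu>)\<^sup>2 + K / (lam * r) * (\<integral>z. (f z)\<^sup>2 \<partial>\<mu>)"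
      using r lam_pos by (simp add: field_simps)
    finally show "(\<integral>z. (f z)\<^sup>2 \<partial>\<mu>) \<le> \<dots>" .
  qed
qed

text \<open>With m the mean of |g|, the left side is 2 - 2m <= 2(1 - m^2), since 0 <= m <= 1. Here 1
  - m^2 is the variance of |g|, at most the mean square distance of |g| from |c|, hence of g from c.
  The freedom in c allows averaging over c = g(y) later.\<close>

lemma integral_abs_minus_one_sq_le:
  fixes g :: "'a \<Rightarrow> real"
  assumes [measurable]: "g \<in> borel_measurable borel" and g2: "integrable \<mu> (\<lambda>z. (g z)\<^sup>2)"
    and g1: "(\<integral>z. (g z)\<^sup>2 \<partial>\<mu>) = 1"
  shows "(\<integral>z. (\<bar>g z\<bar> - 1)\<^sup>2 \<partial>\<mu>) \<le> 2 * (\<integral>z. (g z - c)\<^sup>2 \<partial>\<mu>)"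
proof -
  have ia: "integrable \<mu> (\<lambda>z. \<bar>g z\<bar>)" by (rule integrable_abs_of_sq) (use g2 in auto)
  have ig: "integrable \<mu> g" using ia by (simp add: integrable_abs_iff)
  define m where "m = (\<integral>z. \<bar>g z\<bar> \<partial>\<mu>)"
  have m0: "m \<ge> 0" unfolding m_def by simp
  have sq: "integrable \<mu> (\<lambda>z. (\<bar>g z\<bar> - t)\<^sup>2)" "(\<integral>z. (\<bar>g z\<bar> - t)\<^sup>2 \<partial>\<mu>) = 1 - 2 * t * m + t\<^sup>2" for t
  proof -
    have eq: "(\<bar>g z\<bar> - t)\<^sup>2 = (g z)\<^sup>2 - 2 * t * \<bar>g z\<bar> + t\<^sup>2" for z by (simp add: power2_diff)
    show "integrable \<mu> (\<lambda>z. (\<bar>g z\<bar> - t)\<^sup>2)" unfolding eq using g2 ia by auto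
    show "(\<integral>z. (\<bar>g z\<bar> - t)\<^sup>2 \<partial>\<mu>) = 1 - 2 * t * m + t\<^sup>2"
      unfolding eq m_def using g2 ia g1 prob_space by simp
  qed
  have "0 \<le> (\<integral>z. (\<bar>g z\<bar> - m)\<^sup>2 \<partial>\<mu>)" by simp
  then have "m\<^sup>2 \<le> 1" unfolding sq(2) by (simp add: power2_eq_square)
  then have m1: "m \<le> 1" using m0 by (simp add: power2_le_iff_abs_le abs_square_le_1)
  have "1 - m\<^sup>2 \<le> 1 - 2 * \<bar>c\<bar> * m + \<bar>c\<bar>\<^sup>2"
    using zero_le_power2[of "\<bar>c\<bar> - m"] by (simp add: power2_diff)
  also have "\<dots> = (\<integral>z. (\<bar>g z\<bar> - \<bar>c\<bar>)\<^sup>2 \<partial>\<mu>)" by (rule sq(2)[symmetric])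
  also have "\<dots> \<le> (\<integral>z. (g z - c)\<^sup>2 \<partial>\<mu>)"
  proof (rule integral_mono[OF sq(1)])
    have "(g z - c)\<^sup>2 = (g z)\<^sup>2 - 2 * c * g z + c\<^sup>2" for z by (simp add: power2_diff)
    then show "integrable \<mu> (\<lambda>z. (g z - c)\<^sup>2)" using g2 ig by auto
    fix z
    have "\<bar>\<bar>g z\<bar> - \<bar>c\<bar>\<bar> \<le> \<bar>g z - c\<bar>" by (rule abs_triangle_ineq3)
    then show "(\<bar>g z\<bar> - \<bar>c\<bar>)\<^sup>2 \<le> (g z - c)\<^sup>2" by (simp add: abs_le_square_iff)
  qed
  finally have "1 - m\<^sup>2 \<le> (\<integral>z. (g z - c)\<^sup>2 \<partial>\<mu>)" .
  moreover have "(\<integral>z. (\<bar>g z\<bar> - 1)\<^sup>2 \<partial>\<mu>) = 2 - 2 * m" unfolding sq(2) by simp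
  moreover have "m\<^sup>2 \<le> m" using m0 m1 by (simp add: power2_eq_square mult_left_le)
  ultimately show ?thesis by linarith
qed

text \<open>Put x = y + h with |h| <= 2R and apply the translation estimate for each h. The segments
  from the ball of radius R stay in the ball of radius 3R; integrating over h contributes the volume
  of the ball of radius 2R.\<close>

lemma double_integral_cball_le:
  assumes f: "C1 f" and "0 < R"
  shows "(\<integral>\<^sup>+y. (\<integral>\<^sup>+x. ennreal ((f x - f y)\<^sup>2) * indicator (cball 0 R) x \<partial>lborel) * indicator (cball (0::'a) R) y \<partial>lborel)
    \<le> ennreal (measure lborel (cball (0::'a) (2 * R)) * (2 * R)\<^sup>2)
      * (\<integral>\<^sup>+z. ennreal (grad_sq f z) * indicator (cball 0 (3 * R)) z \<partial>lborel)"
proof -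
  have [measurable]: "f \<in> borel_measurable borel" by (rule C1_measurable[OF f])
  define B where "B = cball (0::'a) R"
  define B2 where "B2 = cball (0::'a) (2 * R)"
  define X where "X = (\<integral>\<^sup>+z. ennreal (grad_sq f z) * indicator (cball 0 (3 * R)) z \<partial>lborel)"
  have [measurable]: "B \<in> sets borel" "B2 \<in> sets borel" unfolding B_def B2_def by auto
  have e2: "emeasure lborel B2 = ennreal (measure lborel B2)"
    using emeasure_compact_finite[of B2] by (intro emeasure_eq_ennreal_measure) (auto simp: B2_def)
  have "(\<integral>\<^sup>+y. (\<integral>\<^sup>+x. ennreal ((f x - f y)\<^sup>2) * indicator B x \<partial>lborel) * indicator B y \<partial>lborel)
      = (\<integral>\<^sup>+y. (\<integral>\<^sup>+h. ennreal ((f (h + y) - f y)\<^sup>2) * indicator B (h + y) \<partial>lborel) * indicator B y \<partial>lborel)"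
    by (subst nn_integral_lborel_translate) auto
  also have "\<dots> = (\<integral>\<^sup>+y. \<integral>\<^sup>+h. ennreal ((f (h + y) - f y)\<^sup>2) * indicator B (h + y) * indicator B y \<partial>lborel \<partial>lborel)"
    by (intro nn_integral_cong nn_integral_multc[symmetric]) measurable
  also have "\<dots> \<le> (\<integral>\<^sup>+y. \<integral>\<^sup>+h. ennreal ((f (y + h) - f y)\<^sup>2) * indicator B y * indicator B2 h \<partial>lborel \<partial>lborel)"
  proof (intro nn_integral_mono)
    fix y h :: 'a
    have "norm h \<le> 2 * R" if "norm (h + y) \<le> R" "norm y \<le> R"
      using norm_triangle_ineq4[of "h + y" y] that by simp
    then show "ennreal ((f (h + y) - f y)\<^sup>2) * indicator B (h + y) * indicator B y
        \<le> ennreal ((f (y + h) - f y)\<^sup>2) * indicator B y * indicator B2 h"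
      by (auto simp: indicator_def B_def B2_def add.commute)
  qed
  also have "\<dots> = (\<integral>\<^sup>+h. \<integral>\<^sup>+y. ennreal ((f (y + h) - f y)\<^sup>2) * indicator B y * indicator B2 h \<partial>lborel \<partial>lborel)"
    by (rule lborel_pair.Fubini'[symmetric]) measurable
  also have "\<dots> \<le> (\<integral>\<^sup>+h. ennreal ((2 * R)\<^sup>2) * X * indicator B2 h \<partial>lborel)"
  proof (rule nn_integral_mono)
    fix h :: 'a
    have "(\<integral>\<^sup>+y. ennreal ((f (y + h) - f y)\<^sup>2) * indicator B y \<partial>lborel) \<le> ennreal ((2 * R)\<^sup>2) * X" if "h \<in> B2"
    proof -
      have hR: "norm h \<le> 2 * R" using that by (simp add: B2_def)
      have "(\<integral>\<^sup>+y. ennreal ((f (y + h) - f y)\<^sup>2) * indicator B y \<partial>lborel) \<le> ennreal ((norm h)\<^sup>2) * X"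
        unfolding X_def
      proof (rule nn_integral_sq_translate_diff_le[OF f])
        fix z and t :: real assume z: "z \<in> B" and t: "t \<in> {0..1}"
        have "\<bar>t\<bar> * norm h \<le> 1 * norm h" using t by (intro mult_right_mono) auto
        then have "norm (z + t *\<^sub>R h) \<le> R + 2 * R"
          using norm_triangle_ineq[of z "t *\<^sub>R h"] z hR by (simp add: B_def)
        then show "z + t *\<^sub>R h \<in> cball 0 (3 * R)" by simp
      qed auto
      also have "\<dots> \<le> ennreal ((2 * R)\<^sup>2) * X"
        using hR by (intro mult_right_mono ennreal_leI power_mono) auto
      finally show ?thesis .
    qed
    then show "(\<integral>\<^sup>+y. ennreal ((f (y + h) - f y)\<^sup>2) * indicator B y * indicator B2 h \<partial>lborel)
        \<le> ennreal ((2 * R)\<^sup>2) * X * indicator B2 h"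
      by (cases "h \<in> B2") auto
  qed
  also have "\<dots> = ennreal ((2 * R)\<^sup>2) * X * ennreal (measure lborel B2)"
    by (simp add: nn_integral_cmult e2)
  also have "\<dots> = ennreal (measure lborel B2 * (2 * R)\<^sup>2) * X"
    by (simp add: ennreal_mult mult_ac)
  finally show ?thesis unfolding X_def B_def B2_def .
qed

end

section \<open>Logarithmic Sobolev inequality\<close>

text \<open>A quadratic spline step: its derivative \<open>spline'\<close> is the tent on [1, 3]
  with height 2 at t = 2, so it rises from 0 to 2 between 1 and 3.\<close>

definition spline :: "real \<Rightarrow> real" where
  "spline t = (max 0 (t - 1))\<^sup>2 - 2 * (max 0 (t - 2))\<^sup>2 + (max 0 (t - 3))\<^sup>2"

definition spline' :: "real \<Rightarrow> real" where
  "spline' t = 2 * max 0 (t - 1) - 4 * max 0 (t - 2) + 2 * max 0 (t - 3)"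

lemma DERIV_spline: "(spline has_real_derivative spline' t) (at t)"
proof -
  have d: "((\<lambda>t. (max 0 (t - c))\<^sup>2) has_real_derivative 2 * max 0 (t - c)) (at t)" for c
  proof -
    have "((\<lambda>t. t - c) has_real_derivative 1) (at t)" by (auto intro!: derivative_eq_intros)
    from DERIV_chain'[OF this DERIV_max0_sq] show ?thesis by simp
  qed
  show ?thesis
    unfolding spline_def[abs_def] spline'_def
    using DERIV_add[OF DERIV_diff[OF d[of 1] DERIV_cmult[OF d[of 2], of 2]] d[of 3]] by simp
qed

lemma spline_le1: "t \<le> 1 \<Longrightarrow> spline t = 0" "t \<le> 1 \<Longrightarrow> spline' t = 0"
  by (auto simp: spline_def spline'_def)

lemma spline_ge3: "t \<ge> 3 \<Longrightarrow> spline t = 2" "t \<ge> 3 \<Longrightarrow> spline' t = 0"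
  by (auto simp: spline_def spline'_def power2_eq_square algebra_simps)

lemma spline'_bounds: "0 \<le> spline' t" "spline' t \<le> 2"
  by (auto simp: spline'_def max_def)

lemma spline_bounds: "0 \<le> spline t" "spline t \<le> 2"
proof -
  have m: "spline x \<le> spline y" if "x \<le> y" for x y
    by (rule DERIV_nonneg_imp_nondecreasing[OF that]) (use DERIV_spline spline'_bounds in blast)
  show "0 \<le> spline t" using m[of "min t 1" t] spline_le1(1)[of "min t 1"] by simp
  show "spline t \<le> 2" using m[of t "max t 3"] spline_ge3(1)[of "max t 3"] by simp
qed

text \<open>A \<open>C\<^sup>1\<close> version of \<open>(|t| - 3\<^sup>n)\<^sub>+ \<and> 2\<cdot>3\<^sup>n\<close>. With ratio \<open>3\<close> the supports of the derivatives for
  different \<open>n\<close> do not overlap.\<close>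

definition trunc :: "nat \<Rightarrow> real \<Rightarrow> real" where
  "trunc n t = 3 ^ n * (spline (t / 3 ^ n) + spline (- (t / 3 ^ n)))"

definition trunc' :: "nat \<Rightarrow> real \<Rightarrow> real" where
  "trunc' n t = spline' (t / 3 ^ n) - spline' (- (t / 3 ^ n))"

lemma DERIV_trunc: "(trunc n has_real_derivative trunc' n t) (at t)"
proof -
  have d: "((\<lambda>t. spline (c * t)) has_real_derivative c * spline' (c * t)) (at t)" for c
  proof -
    have "((\<lambda>t. c * t) has_real_derivative c) (at t)" by (auto intro!: derivative_eq_intros)
    from DERIV_chain'[OF this DERIV_spline] show ?thesis by (simp add: mult.commute)
  qed
  have "((\<lambda>t. 3 ^ n * (spline (1 / 3 ^ n * t) + spline (- 1 / 3 ^ n * t))) has_real_derivative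
      3 ^ n * (1 / 3 ^ n * spline' (1 / 3 ^ n * t) + - 1 / 3 ^ n * spline' (- 1 / 3 ^ n * t))) (at t)"
    by (intro DERIV_cmult DERIV_add d)
  then show ?thesis
    unfolding trunc_def[abs_def] trunc'_def by (simp add: algebra_simps)
qed

lemma continuous_trunc': "continuous_on S (trunc' n)"
  unfolding trunc'_def[abs_def] spline'_def by (intro continuous_intros) auto

lemma trunc_small:
  assumes "\<bar>t\<bar> \<le> 3 ^ n"
  shows "trunc n t = 0" "trunc' n t = 0"
proof -
  have "\<bar>t / 3 ^ n\<bar> \<le> 1" using assms by (simp add: abs_divide divide_le_eq)
  then have "t / 3 ^ n \<le> 1" "- (t / 3 ^ n) \<le> 1" by linarith+
  then show "trunc n t = 0" "trunc' n t = 0" by (auto simp: trunc_def trunc'_def spline_le1)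
qed

lemma trunc_large:
  assumes "3 ^ Suc n \<le> \<bar>t\<bar>"
  shows "trunc n t = 2 * 3 ^ n" "trunc' n t = 0"
proof -
  have "3 \<le> \<bar>t / 3 ^ n\<bar>" using assms by (simp add: abs_divide le_divide_eq)
  then have "t / 3 ^ n \<ge> 3 \<and> - (t / 3 ^ n) \<le> 1 \<or> - (t / 3 ^ n) \<ge> 3 \<and> t / 3 ^ n \<le> 1"
    by linarith
  then show "trunc n t = 2 * 3 ^ n" "trunc' n t = 0"
    by (auto simp: trunc_def trunc'_def spline_le1 spline_ge3)
qed

lemma trunc'_sq_le: "(trunc' n t)\<^sup>2 \<le> 4"
proof -
  have "\<bar>trunc' n t\<bar> \<le> 2"
    unfolding trunc'_def using spline'_bounds[of "t / 3 ^ n"] spline'_bounds[of "- (t / 3 ^ n)"] by linarith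
  then have "\<bar>trunc' n t\<bar>\<^sup>2 \<le> 2\<^sup>2" by (intro power_mono) auto
  then show ?thesis by simp
qed

lemma abs_trunc_le: "\<bar>trunc n t\<bar> \<le> 2 * \<bar>t\<bar>"
proof (cases "\<bar>t\<bar> \<le> 3 ^ n")
  case True
  then show ?thesis by (simp add: trunc_small)
next
  case False
  \<comment> \<open>At most one of the two mirrored splines is nonzero.\<close>
  have "- (t / 3 ^ n) \<le> 1 \<or> t / 3 ^ n \<le> 1" by linarith
  then have "\<bar>spline (t / 3 ^ n) + spline (- (t / 3 ^ n))\<bar> \<le> 2"
    using spline_bounds[of "t / 3 ^ n"] spline_bounds[of "- (t / 3 ^ n)"]
      spline_le1(1)[of "t / 3 ^ n"] spline_le1(1)[of "- (t / 3 ^ n)"] by (auto simp: abs_le_iff)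
  then have "\<bar>trunc n t\<bar> \<le> 3 ^ n * 2"
    unfolding trunc_def by (simp add: abs_mult)
  then show ?thesis using False by linarith
qed

lemma abs_trunc_mult_le: "3 ^ n * \<bar>trunc n t\<bar> \<le> \<bar>trunc n t\<bar> * \<bar>t\<bar>"
proof (cases "\<bar>t\<bar> \<le> 3 ^ n")
  case False
  then have "3 ^ n * \<bar>trunc n t\<bar> \<le> \<bar>t\<bar> * \<bar>trunc n t\<bar>" by (intro mult_right_mono) auto
  then show ?thesis by (simp add: mult.commute)
qed (simp add: trunc_small)

text \<open>At most one summand is nonzero, the level with 3^m < |t| < 3^(m+1). Hence the energies
  of all truncations together cost at most 4 times the energy of g.\<close>

lemma suminf_trunc'_sq_le:
  "(\<Sum>n. ennreal ((trunc' n t)\<^sup>2)) \<le> 4"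
proof (cases "\<exists>m. trunc' m t \<noteq> 0")
  case True
  then obtain m where m: "trunc' m t \<noteq> 0" by blast
  have lo: "3 ^ m < \<bar>t\<bar>" and hi: "\<bar>t\<bar> < 3 ^ Suc m"
    using m trunc_small(2)[of t m] trunc_large(2)[of m t] by linarith+
  have z: "trunc' n t = 0" if "n \<noteq> m" for n
  proof (cases "n < m")
    case True
    then have "(3::real) ^ Suc n \<le> 3 ^ m" by (intro power_increasing) auto
    then show ?thesis using lo by (intro trunc_large) linarith
  next
    case False
    then have "(3::real) ^ Suc m \<le> 3 ^ n" using that by (intro power_increasing) auto
    then show ?thesis using hi by (intro trunc_small) linarith
  qed
  have "(\<Sum>n. ennreal ((trunc' n t)\<^sup>2)) = (\<Sum>n\<in>{m}. ennreal ((trunc' n t)\<^sup>2))"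
    by (rule suminf_finite) (auto simp: z)
  also have "\<dots> \<le> 4" using ennreal_leI[OF trunc'_sq_le[of m t]] by simp
  finally show ?thesis .
qed simp

text \<open>A single summand suffices: for 3^(m+1) <= |t| <= 3^(m+2) the truncation at level m is
  saturated at 2 * 3^m, while t^2 <= 81 * 9^m and ln (t^2) <= 8(m+2) <= 16(m+1). The ratio is 81 *
  16 / 4 = 324. Saturation needs one level of room, hence the threshold
  \<open>Suc N\<close>.\<close>

lemma sq_ln_le_suminf_trunc:
  assumes t: "3 ^ Suc N \<le> \<bar>t\<bar>"
  shows "ennreal (t\<^sup>2 * ln (t\<^sup>2)) \<le> 324 * (\<Sum>n. ennreal (if N \<le> n then real (Suc n) * (trunc n t)\<^sup>2 else 0))"
proof -
  define k where "k = (LEAST k. \<bar>t\<bar> < 3 ^ k)"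
  have "\<exists>k. \<bar>t\<bar> < 3 ^ k" using real_arch_pow[of 3 "\<bar>t\<bar>"] by auto
  then have k: "\<bar>t\<bar> < 3 ^ k" "\<And>j. j < k \<Longrightarrow> \<not> \<bar>t\<bar> < 3 ^ j"
    unfolding k_def by (auto intro: LeastI_ex dest: not_less_Least)
  have "Suc N < k"
  proof (rule ccontr)
    assume "\<not> Suc N < k"
    then have "(3::real) ^ k \<le> 3 ^ Suc N" by (intro power_increasing) auto
    then show False using k(1) t by linarith
  qed
  then obtain m where m: "k = Suc (Suc m)" "N \<le> m"
    using that[of "k - 2"] by simp
  have lo: "3 ^ Suc m \<le> \<bar>t\<bar>" using k(2)[of "Suc m"] m by simp
  have hi: "\<bar>t\<bar> \<le> 3 ^ Suc (Suc m)" using k(1) m by simp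
  have t1: "1 \<le> \<bar>t\<bar>" using lo one_le_power[of "3::real" "Suc m"] by linarith
  have t2: "t\<^sup>2 \<le> 9 ^ Suc (Suc m)"
  proof -
    have "\<bar>t\<bar>\<^sup>2 \<le> (3 ^ Suc (Suc m))\<^sup>2" using hi by (intro power_mono) auto
    also have "\<dots> = (3\<^sup>2) ^ Suc (Suc m)" by (simp only: power_mult[symmetric] mult.commute)
    finally show ?thesis by simp
  qed
  have t2': "1 \<le> t\<^sup>2" using t1 by (metis one_le_power power2_abs)
  have "ln (t\<^sup>2) \<le> ln (9 ^ Suc (Suc m))" using t2 t2' by (intro ln_mono) auto
  also have "\<dots> = real (Suc (Suc m)) * ln 9" by (rule ln_realpow)
  also have "\<dots> \<le> real (Suc (Suc m)) * 8" using ln_le_minus_one[of 9] by (intro mult_left_mono) auto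
  finally have ln: "ln (t\<^sup>2) \<le> real (Suc (Suc m)) * 8" .
  have "t\<^sup>2 * ln (t\<^sup>2) \<le> 9 ^ Suc (Suc m) * (real (Suc (Suc m)) * 8)"
    using t2 t2' ln by (intro mult_mono) auto
  also have "\<dots> \<le> 9 ^ Suc (Suc m) * ((2 * real (Suc m)) * 8)" by (intro mult_left_mono mult_right_mono) auto
  also have "\<dots> = 324 * (real (Suc m) * (2 * 3 ^ m)\<^sup>2)"
  proof -
    have "(9::real) ^ m = (3 ^ m)\<^sup>2" by (simp add: power2_eq_square flip: power_mult_distrib)
    then show ?thesis by (simp add: power2_eq_square algebra_simps)
  qed
  also have "2 * 3 ^ m = trunc m t" using trunc_large(1)[OF lo] by simp
  finally have "ennreal (t\<^sup>2 * ln (t\<^sup>2)) \<le> ennreal (324 * (real (Suc m) * (trunc m t)\<^sup>2))"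
    by (rule ennreal_leI)
  also have "\<dots> = 324 * ennreal (real (Suc m) * (trunc m t)\<^sup>2)"
    by (subst ennreal_mult) auto
  also have "\<dots> \<le> 324 * (\<Sum>n. ennreal (if N \<le> n then real (Suc n) * (trunc n t)\<^sup>2 else 0))"
  proof (rule mult_left_mono)
    have "(\<Sum>n\<in>{m}. ennreal (if N \<le> n then real (Suc n) * (trunc n t)\<^sup>2 else 0))
        \<le> (\<Sum>n. ennreal (if N \<le> n then real (Suc n) * (trunc n t)\<^sup>2 else 0))"
      by (rule sum_le_suminf) auto
    then show "ennreal (real (Suc m) * (trunc m t)\<^sup>2) \<le> (\<Sum>n. ennreal (if N \<le> n then real (Suc n) * (trunc n t)\<^sup>2 else 0))"
      using m by simp
  qed simp
  finally show ?thesis .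
qed

text \<open>Both bounds are ln y <= y - 1, at y = 1/x and at y = x. For x = 0 the product with
  \<open>ln\<close> is 0, the usual convention for entropy.\<close>

lemma mult_ln_minus_bounds:
  fixes x :: real
  assumes "0 \<le> x"
  shows "0 \<le> x * ln x - x + 1" "x * ln x - x + 1 \<le> (x - 1)\<^sup>2"
proof -
  have "0 \<le> x * ln x - x + 1 \<and> x * ln x - x + 1 \<le> (x - 1)\<^sup>2"
  proof (cases "x = 0")
    case False
    then have x: "x > 0" using assms by simp
    have "x * ln x \<le> x * (x - 1)" using ln_le_minus_one[OF x] x by (intro mult_left_mono) auto
    moreover have "x * ln (1 / x) \<le> x * (1 / x - 1)" using ln_le_minus_one[of "1 / x"] x by (intro mult_left_mono) auto
    moreover have "x * (1 / x - 1) = 1 - x" "ln (1 / x) = - ln x" using x by (auto simp: algebra_simps ln_div)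
    ultimately show ?thesis by (simp add: power2_eq_square algebra_simps)
  qed simp
  then show "0 \<le> x * ln x - x + 1" "x * ln x - x + 1 \<le> (x - 1)\<^sup>2" by auto
qed

context lyapunov_gibbs
begin

section \<open>Poincare inequality\<close>

lemma
  assumes "C1 g"
  shows C1_minus_const: "C1 (\<lambda>z. g z - c)" and Gam_minus_const: "Gam (\<lambda>z. g z - c) = Gam g"
proof -
  have d: "((\<lambda>x. x - c) has_real_derivative 1) (at x)" for x
    by (auto intro!: derivative_eq_intros)
  show "C1 (\<lambda>z. g z - c)"
    by (rule C1_compose[OF assms d]) (intro continuous_intros)
  show "Gam (\<lambda>z. g z - c) = Gam g"
    unfolding Gam_def using pd_compose[OF assms d continuous_on_const] by simp
qed

text \<open>Bound the left side by the mean square distance of g from a constant c, use the Lyapunov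
  splitting to reduce to a sublevel set inside a ball, then average over c = g(y) with y in that
  ball; the double integral is controlled by the gradient.\<close>

lemma poincare:
  obtains C where "0 \<le> C"
    "\<And>g. C1 g \<Longrightarrow> integrable \<mu> (\<lambda>z. (g z)\<^sup>2) \<Longrightarrow> integrable \<mu> (Gam g) \<Longrightarrow> (\<integral>z. (g z)\<^sup>2 \<partial>\<mu>) = 1 \<Longrightarrow>
      (\<integral>z. (\<bar>g z\<bar> - 1)\<^sup>2 \<partial>\<mu>) \<le> C * (\<integral>z. Gam g z \<partial>\<mu>)"
proof -
  \<comment> \<open>This level makes the L2 term of \<open>integral_sq_split\<close> exactly half of
    the left side.\<close>
  define r where "r = 2 * K / lam"
  have r: "r > 0" unfolding r_def using K_pos lam_pos by simp
  have rK: "K / (lam * r) = 1 / 2" unfolding r_def using K_pos lam_pos by simp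
  define A where "A = {z. H z \<le> r}"
  obtain R where R: "R > 0" "A \<subseteq> cball 0 R"
  proof -
    obtain R0 where "\<forall>z\<in>A. norm z \<le> R0" using H_bounded[of r] unfolding A_def bounded_iff by blast
    then show ?thesis using that[of "max R0 1"] by fastforce
  qed
  define B where "B = cball (0::'a) R"
  have [measurable]: "A \<in> sets borel" "B \<in> sets borel" unfolding A_def B_def by measurable
  have "compact (H ` cball 0 (3 * R))"
    by (rule compact_continuous_image) (auto intro: C1_continuous_on H_C1)
  then obtain M where M: "\<forall>z\<in>cball 0 (3 * R). \<bar>H z\<bar> \<le> M"
    using compact_imp_bounded[of "H ` cball 0 (3 * R)"] unfolding bounded_iff by auto
  define v where "v = measure lborel B"
  define v2 where "v2 = measure lborel (cball (0::'a) (2 * R))"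
  have v: "v > 0" unfolding v_def B_def using R by (simp add: content_cball_pos)
  have v2: "v2 \<ge> 0" unfolding v2_def by simp
  have ev: "emeasure lborel B = ennreal v"
    unfolding v_def using emeasure_compact_finite[of B]
    by (intro emeasure_eq_ennreal_measure) (auto simp: B_def)
  \<comment> \<open>Constant of the double integral over the ball, including the loss e^((kap+1)M)
    from density and weight on the ball of radius 3R.\<close>
  define Q where "Q = v2 * (2 * R)\<^sup>2 * (exp ((kap + 1) * M) * Z)"
  have Q: "Q \<ge> 0" unfolding Q_def using v2 Z_pos by simp
  define c1 where "c1 = 8 / (lam * r)"
  have c1: "c1 \<ge> 0" unfolding c1_def using lam_pos r by simp
  show ?thesis
  proof (rule that[of "c1 + 4 * Q / (v * Z)"])
    show "0 \<le> c1 + 4 * Q / (v * Z)" using c1 Q v Z_pos by simp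
    fix g assume g: "C1 g" and g2: "integrable \<mu> (\<lambda>z. (g z)\<^sup>2)" and gG: "integrable \<mu> (Gam g)"
      and g1: "(\<integral>z. (g z)\<^sup>2 \<partial>\<mu>) = 1"
    have gm [measurable]: "g \<in> borel_measurable borel" by (rule C1_measurable[OF g])
    define E where "E = (\<integral>z. Gam g z \<partial>\<mu>)"
    have E: "E \<ge> 0" unfolding E_def by (rule integral_Gam_nonneg)
    define D where "D = (\<integral>z. (\<bar>g z\<bar> - 1)\<^sup>2 \<partial>\<mu>)"
    have ig: "integrable \<mu> g"
      using integrable_abs_of_sq[OF gm g2] by (simp add: integrable_abs_iff)
    \<comment> \<open>Absorbing half of V gives 2V <= 4J + 8E/(lam r), the origin of
      \<open>c1\<close>. The left side does not involve c, so c may depend on a further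
      variable.\<close>
    have key: "ennreal (Z * D) \<le> ennreal (Z * (c1 * E)) + 4 * (\<integral>\<^sup>+x. ennreal ((g x - c)\<^sup>2) * indicator B x \<partial>lborel)" for c
    proof -
      let ?f = "\<lambda>z. g z - c"
      have "(g z - c)\<^sup>2 = (g z)\<^sup>2 - 2 * c * g z + c\<^sup>2" for z by (simp add: power2_diff)
      then have f2: "integrable \<mu> (\<lambda>z. (?f z)\<^sup>2)" using g2 ig by auto
      have fG: "integrable \<mu> (Gam ?f)" using gG Gam_minus_const[OF g] by simp
      define J where "J = (\<integral>z. (?f z)\<^sup>2 * indicator A z \<partial>\<mu>)"
      define V where "V = (\<integral>z. (?f z)\<^sup>2 \<partial>\<mu>)"
      have "V \<le> J + (2 * E + K * V) / (lam * r)"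
        using integral_sq_split[OF C1_minus_const[OF g] f2 fG r]
        unfolding J_def V_def E_def A_def Gam_minus_const[OF g] .
      also have "(2 * E + K * V) / (lam * r) = 2 / (lam * r) * E + K / (lam * r) * V"
        by (simp add: add_divide_distrib)
      finally have "V \<le> J + 2 / (lam * r) * E + V / 2" unfolding rK by simp
      moreover have "c1 * E = 4 * (2 / (lam * r) * E)" unfolding c1_def by simp
      ultimately have "2 * V \<le> 4 * J + c1 * E" by linarith
      moreover have "D \<le> 2 * V" unfolding D_def V_def by (rule integral_abs_minus_one_sq_le[OF gm g2 g1])
      ultimately have "Z * D \<le> Z * (c1 * E + 4 * J)" using Z_pos by (intro mult_left_mono) auto
      then have "ennreal (Z * D) \<le> ennreal (Z * (c1 * E) + 4 * (Z * J))"
        by (intro ennreal_leI) (simp add: algebra_simps)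
      also have "\<dots> = ennreal (Z * (c1 * E)) + 4 * ennreal (Z * J)"
      proof -
        have "J \<ge> 0" unfolding J_def by simp
        then show ?thesis using Z_pos c1 E by (simp add: ennreal_plus ennreal_mult)
      qed
      also have "ennreal (Z * J) \<le> (\<integral>\<^sup>+x. ennreal ((?f x)\<^sup>2) * indicator A x \<partial>lborel)"
        unfolding J_def by (rule ennreal_integral_indicator_le) (use f2 in auto)
      also have "(\<integral>\<^sup>+x. ennreal ((?f x)\<^sup>2) * indicator A x \<partial>lborel)
          \<le> (\<integral>\<^sup>+x. ennreal ((?f x)\<^sup>2) * indicator B x \<partial>lborel)"
        using R by (intro nn_integral_mono mult_left_mono) (auto simp: indicator_def B_def)
      finally show ?thesis by (simp add: mult_left_mono)
    qed
    \<comment> \<open>Integrate \<open>key\<close> over y in \<open>B\<close> with c = g(y).\<close>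
    have "ennreal (Z * D) * ennreal v = (\<integral>\<^sup>+y. ennreal (Z * D) * indicator B y \<partial>lborel)"
      by (simp add: nn_integral_cmult ev)
    also have "\<dots> \<le> (\<integral>\<^sup>+y. (ennreal (Z * (c1 * E)) + 4 * (\<integral>\<^sup>+x. ennreal ((g x - g y)\<^sup>2) * indicator B x \<partial>lborel)) * indicator B y \<partial>lborel)"
      by (intro nn_integral_mono mult_right_mono key) simp
    also have "\<dots> = (\<integral>\<^sup>+y. ennreal (Z * (c1 * E)) * indicator B y \<partial>lborel)
        + (\<integral>\<^sup>+y. 4 * ((\<integral>\<^sup>+x. ennreal ((g x - g y)\<^sup>2) * indicator B x \<partial>lborel) * indicator B y) \<partial>lborel)"
      by (subst nn_integral_add[symmetric]) (auto intro!: nn_integral_cong simp: distrib_right mult.assoc)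
    also have "\<dots> = ennreal (Z * (c1 * E)) * ennreal v
        + 4 * (\<integral>\<^sup>+y. (\<integral>\<^sup>+x. ennreal ((g x - g y)\<^sup>2) * indicator B x \<partial>lborel) * indicator B y \<partial>lborel)"
      by (simp add: nn_integral_cmult ev)
    also have "\<dots> \<le> ennreal (Z * (c1 * E)) * ennreal v + 4 * ennreal (Q * E)"
    proof (intro add_left_mono mult_left_mono)
      have "(\<integral>\<^sup>+y. (\<integral>\<^sup>+x. ennreal ((g x - g y)\<^sup>2) * indicator B x \<partial>lborel) * indicator B y \<partial>lborel)
          \<le> ennreal (v2 * (2 * R)\<^sup>2) * (\<integral>\<^sup>+z. ennreal (grad_sq g z) * indicator (cball 0 (3 * R)) z \<partial>lborel)"
        unfolding B_def v2_def by (rule double_integral_cball_le[OF g R(1)])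
      also have "\<dots> \<le> ennreal (v2 * (2 * R)\<^sup>2) * ennreal (exp ((kap + 1) * M) * (Z * E))"
        unfolding E_def using M by (intro mult_left_mono nn_integral_grad_sq_le[OF g gG]) fastforce+
      also have "\<dots> = ennreal (Q * E)"
        unfolding Q_def using v2 Z_pos E by (subst ennreal_mult[symmetric]) (auto simp: mult_ac)
      finally show "(\<integral>\<^sup>+y. (\<integral>\<^sup>+x. ennreal ((g x - g y)\<^sup>2) * indicator B x \<partial>lborel) * indicator B y \<partial>lborel)
          \<le> ennreal (Q * E)" .
    qed simp
    also have "\<dots> = ennreal (Z * (c1 * E) * v + 4 * (Q * E))"
      using Z_pos c1 E v Q by (simp add: ennreal_plus ennreal_mult)
    finally have "ennreal (Z * D * v) \<le> ennreal (Z * (c1 * E) * v + 4 * (Q * E))"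
      using v by (simp add: ennreal_mult'')
    then have "Z * D * v \<le> Z * (c1 * E) * v + 4 * (Q * E)"
      using Z_pos c1 E v Q by (subst (asm) ennreal_le_iff) auto
    also have "\<dots> = (Z * v) * ((c1 + 4 * Q / (v * Z)) * E)"
      using v Z_pos by (simp add: field_simps)
    finally have "(Z * v) * D \<le> (Z * v) * ((c1 + 4 * Q / (v * Z)) * E)" by (simp add: mult_ac)
    then show "(\<integral>z. (\<bar>g z\<bar> - 1)\<^sup>2 \<partial>\<mu>) \<le> (c1 + 4 * Q / (v * Z)) * (\<integral>z. Gam g z \<partial>\<mu>)"
      unfolding D_def[symmetric] E_def[symmetric] using v Z_pos by simp
  qed
qed

section \<open>Entropy of the large values through truncations\<close>

lemma
  assumes g: "C1 g"
  shows C1_trunc: "C1 (\<lambda>z. trunc n (g z))"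
    and Gam_trunc: "Gam (\<lambda>z. trunc n (g z)) z = (trunc' n (g z))\<^sup>2 * Gam g z"
proof -
  show "C1 (\<lambda>z. trunc n (g z))"
    by (rule C1_compose[OF g DERIV_trunc continuous_trunc'])
  show "Gam (\<lambda>z. trunc n (g z)) z = (trunc' n (g z))\<^sup>2 * Gam g z"
    unfolding Gam_def pd_compose[OF g DERIV_trunc continuous_trunc']
    by (simp add: sum_distrib_left power_mult_distrib mult_ac)
qed

lemma
  assumes g: "C1 g" and g2: "integrable \<mu> (\<lambda>z. (g z)\<^sup>2)" and gG: "integrable \<mu> (Gam g)"
  shows integrable_trunc_sq: "integrable \<mu> (\<lambda>z. (trunc n (g z))\<^sup>2)"
    and integrable_Gam_trunc: "integrable \<mu> (Gam (\<lambda>z. trunc n (g z)))"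
proof -
  have [measurable]: "(\<lambda>z. trunc n (g z)) \<in> borel_measurable borel"
    by (rule C1_measurable[OF C1_trunc[OF g]])
  show "integrable \<mu> (\<lambda>z. (trunc n (g z))\<^sup>2)"
  proof (rule Bochner_Integration.integrable_bound[of _ "\<lambda>z. 4 * (g z)\<^sup>2"])
    have "(trunc n t)\<^sup>2 \<le> 4 * t\<^sup>2" for t
      using power_mono[OF abs_trunc_le[of n t], of 2] by (simp add: power_mult_distrib)
    then show "AE z in \<mu>. norm ((trunc n (g z))\<^sup>2) \<le> norm (4 * (g z)\<^sup>2)" by simp
  qed (use g2 in auto)
  show "integrable \<mu> (Gam (\<lambda>z. trunc n (g z)))"
  proof (rule Bochner_Integration.integrable_bound[of _ "\<lambda>z. 4 * Gam g z"])
    show "Gam (\<lambda>z. trunc n (g z)) \<in> borel_measurable \<mu>"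
      using Gam_meas[OF C1_trunc[OF g]] by simp
    show "AE z in \<mu>. norm (Gam (\<lambda>z. trunc n (g z)) z) \<le> norm (4 * Gam g z)"
      using trunc'_sq_le Gam_nonneg[of g] by (auto simp: Gam_trunc[OF g] abs_mult mult_right_mono)
  qed (use gG in auto)
qed

text \<open>The truncation vanishes for |g| <= 3^n, so 3^n times its L1 norm is at most its pairing
  with |g|; Cauchy-Schwarz and the normalisation of g then apply.\<close>

lemma integral_abs_trunc_sq_le:
  assumes g: "C1 g" and g2: "integrable \<mu> (\<lambda>z. (g z)\<^sup>2)" and gG: "integrable \<mu> (Gam g)"
    and g1: "(\<integral>z. (g z)\<^sup>2 \<partial>\<mu>) = 1"
  shows "9 ^ n * (\<integral>z. \<bar>trunc n (g z)\<bar> \<partial>\<mu>)\<^sup>2 \<le> (\<integral>z. (trunc n (g z))\<^sup>2 \<partial>\<mu>)"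
proof -
  have [measurable]: "(\<lambda>z. trunc n (g z)) \<in> borel_measurable borel" "g \<in> borel_measurable borel"
    by (auto intro: C1_measurable C1_trunc g)
  note i2 = integrable_trunc_sq[OF g g2 gG, of n]
  have i1: "integrable \<mu> (\<lambda>z. \<bar>trunc n (g z)\<bar>)" by (rule integrable_abs_of_sq) (use i2 in auto)
  have ip: "integrable \<mu> (\<lambda>z. \<bar>trunc n (g z)\<bar> * \<bar>g z\<bar>)"
  proof (rule Bochner_Integration.integrable_bound[of _ "\<lambda>z. 2 * (g z)\<^sup>2"])
    have "\<bar>trunc n t\<bar> * \<bar>t\<bar> \<le> 2 * t\<^sup>2" for t
      using mult_right_mono[OF abs_trunc_le[of n t], of "\<bar>t\<bar>"] by (simp add: power2_eq_square)
    then show "AE z in \<mu>. norm (\<bar>trunc n (g z)\<bar> * \<bar>g z\<bar>) \<le> norm (2 * (g z)\<^sup>2)" by (simp add: abs_mult)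
  qed (use g2 in auto)
  define P where "P = (\<integral>z. \<bar>trunc n (g z)\<bar> * \<bar>g z\<bar> \<partial>\<mu>)"
  define Y where "Y = (\<integral>z. (trunc n (g z))\<^sup>2 \<partial>\<mu>)"
  \<comment> \<open>Cauchy-Schwarz by hand: as g has norm 1, expanding the square leaves Y -
    P^2.\<close>
  have "0 \<le> (\<integral>z. (\<bar>trunc n (g z)\<bar> - P * \<bar>g z\<bar>)\<^sup>2 \<partial>\<mu>)" by simp
  also have "\<dots> = (\<integral>z. (trunc n (g z))\<^sup>2 - (2 * P) * (\<bar>trunc n (g z)\<bar> * \<bar>g z\<bar>) + P\<^sup>2 * (g z)\<^sup>2 \<partial>\<mu>)"
    by (intro Bochner_Integration.integral_cong) (auto simp: power2_diff power_mult_distrib)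
  also have "\<dots> = Y - (2 * P) * P + P\<^sup>2 * 1"
    unfolding Y_def using i2 ip g2 g1 by (simp add: P_def[symmetric])
  finally have PY: "P\<^sup>2 \<le> Y" by (simp add: power2_eq_square)
  have "3 ^ n * (\<integral>z. \<bar>trunc n (g z)\<bar> \<partial>\<mu>) = (\<integral>z. 3 ^ n * \<bar>trunc n (g z)\<bar> \<partial>\<mu>)" by simp
  also have "\<dots> \<le> P"
    unfolding P_def using i1 ip by (intro integral_mono abs_trunc_mult_le) auto
  finally have "(3 ^ n * (\<integral>z. \<bar>trunc n (g z)\<bar> \<partial>\<mu>))\<^sup>2 \<le> P\<^sup>2" by (intro power_mono) auto
  moreover have "(3 ^ n)\<^sup>2 = (9 ^ n :: real)" by (simp add: power2_eq_square flip: power_mult_distrib)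
  ultimately show ?thesis using PY unfolding Y_def power_mult_distrib by simp
qed

text \<open>Take r = (n+1)/\<kappa> in \<open>super_poincare\<close>. The exponential becomes
  e^(n+1) <= 3^(n+1), which the factor 9^n of \<open>integral_abs_trunc_sq_le\<close> beats, and the
  factor 1/r of the energy becomes \<kappa>/(n+1).\<close>

lemma trunc_poincare:
  obtains C N where "0 \<le> C"
    "\<And>g n. C1 g \<Longrightarrow> integrable \<mu> (\<lambda>z. (g z)\<^sup>2) \<Longrightarrow> integrable \<mu> (Gam g) \<Longrightarrow> (\<integral>z. (g z)\<^sup>2 \<partial>\<mu>) = 1 \<Longrightarrow> N \<le> n \<Longrightarrow>
      real (Suc n) * (\<integral>z. (trunc n (g z))\<^sup>2 \<partial>\<mu>) \<le> C * (\<integral>z. Gam (\<lambda>z. trunc n (g z)) z \<partial>\<mu>)"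
proof (rule super_poincare)
  fix C C\<^sub>2 \<kappa> assume C: "0 < C" "0 < C\<^sub>2" "0 < \<kappa>"
    and le: "\<And>r f. 1 \<le> r \<Longrightarrow> C1 f \<Longrightarrow> integrable \<mu> (\<lambda>z. (f z)\<^sup>2) \<Longrightarrow> integrable \<mu> (Gam f) \<Longrightarrow>
      (\<integral>z. (f z)\<^sup>2 \<partial>\<mu>) \<le> C / r * (\<integral>z. Gam f z \<partial>\<mu>) + C\<^sub>2 * exp (\<kappa> * r) * (\<integral>z. \<bar>f z\<bar> \<partial>\<mu>)\<^sup>2
        + K / (lam * r) * (\<integral>z. (f z)\<^sup>2 \<partial>\<mu>)"
  \<comment> \<open>The first summand ensures r >= 1, the second K/(lam r) <= 1/4, and the third 12
    \<open>C\<^sub>2\<close> <= n <= 3^n, so that the L1 term is also at most a quarter. Half of the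
    left side is then absorbed.\<close>
  define N where "N = nat \<lceil>\<kappa> + 4 * K * \<kappa> / lam + 12 * C\<^sub>2\<rceil>"
  have p: "4 * K * \<kappa> / lam > 0" using K_pos lam_pos C by simp
  have N: "\<kappa> + 4 * K * \<kappa> / lam + 12 * C\<^sub>2 \<le> real N"
    unfolding N_def by (rule real_nat_ceiling_ge)
  show ?thesis
  proof (rule that[of "2 * C * \<kappa>" N])
    show "0 \<le> 2 * C * \<kappa>" using C by simp
    fix g :: "'a \<Rightarrow> real" and n assume g: "C1 g" "integrable \<mu> (\<lambda>z. (g z)\<^sup>2)" "integrable \<mu> (Gam g)"
      and g1: "(\<integral>z. (g z)\<^sup>2 \<partial>\<mu>) = 1" and "N \<le> n"
    then have Nn: "real N \<le> real n" by simp
    define r where "r = real (Suc n) / \<kappa>"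
    have r: "1 \<le> r" unfolding r_def using C N Nn p by (simp add: le_divide_eq)
    define Y where "Y = (\<integral>z. (trunc n (g z))\<^sup>2 \<partial>\<mu>)"
    define X where "X = (\<integral>z. \<bar>trunc n (g z)\<bar> \<partial>\<mu>)"
    define E where "E = (\<integral>z. Gam (\<lambda>z. trunc n (g z)) z \<partial>\<mu>)"
    have Y0: "Y \<ge> 0" unfolding Y_def by simp
    have "C\<^sub>2 * exp (\<kappa> * r) * X\<^sup>2 \<le> Y / 4"
    proof -
      have "exp (\<kappa> * r) = exp (real (Suc n) * 1)" unfolding r_def using C by simp
      also have "\<dots> = exp 1 ^ Suc n" by (rule exp_of_nat_mult)
      also have "\<dots> \<le> 3 ^ Suc n" using exp_le by (intro power_mono) auto
      finally have e: "exp (\<kappa> * r) \<le> 3 * 3 ^ n" by simp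
      have "real n \<le> 3 ^ n" by (rule order_trans[OF less_imp_le[OF of_nat_less_two_power]]) (auto intro: power_mono)
      then have "12 * C\<^sub>2 \<le> 3 ^ n" using N Nn p C by linarith
      then have "12 * C\<^sub>2 * 3 ^ n \<le> 3 ^ n * (3 ^ n :: real)" by (intro mult_right_mono) auto
      also have "\<dots> = 9 ^ n" by (simp add: power_mult_distrib[symmetric])
      finally have "4 * (C\<^sub>2 * (3 * 3 ^ n)) \<le> 9 ^ n" by simp
      moreover have "C\<^sub>2 * exp (\<kappa> * r) \<le> C\<^sub>2 * (3 * 3 ^ n)" using e C by (intro mult_left_mono) auto
      ultimately have "4 * (C\<^sub>2 * exp (\<kappa> * r)) \<le> 9 ^ n" by linarith
      then have "4 * (C\<^sub>2 * exp (\<kappa> * r)) * X\<^sup>2 \<le> 9 ^ n * X\<^sup>2" by (intro mult_right_mono) auto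
      also have "\<dots> \<le> Y" unfolding X_def Y_def by (rule integral_abs_trunc_sq_le[OF g g1])
      finally show ?thesis by simp
    qed
    moreover have "K / (lam * r) * Y \<le> 1 / 4 * Y"
    proof (rule mult_right_mono[OF _ Y0])
      have "4 * K * \<kappa> / lam \<le> real (Suc n)" using N Nn C by simp
      then have "4 * K \<le> lam * r"
        unfolding r_def using C lam_pos by (simp add: field_simps)
      moreover have "lam * r > 0" using lam_pos r by simp
      ultimately show "K / (lam * r) \<le> 1 / 4" by (simp add: divide_le_eq)
    qed
    moreover have "Y \<le> C / r * E + C\<^sub>2 * exp (\<kappa> * r) * X\<^sup>2 + K / (lam * r) * Y"
      unfolding X_def Y_def E_def
      by (rule le[OF r C1_trunc[OF g(1)] integrable_trunc_sq[OF g] integrable_Gam_trunc[OF g]])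
    ultimately have "Y \<le> 2 * (C / r * E)" by linarith
    then have "real (Suc n) * Y \<le> real (Suc n) * (2 * (C / r * E))" by (intro mult_left_mono) auto
    also have "\<dots> = 2 * C * \<kappa> * E" unfolding r_def using C by (simp add: field_simps)
    finally show "real (Suc n) * (\<integral>z. (trunc n (g z))\<^sup>2 \<partial>\<mu>)
        \<le> 2 * C * \<kappa> * (\<integral>z. Gam (\<lambda>z. trunc n (g z)) z \<partial>\<mu>)"
      unfolding Y_def E_def .
  qed
qed

text \<open>Sum \<open>trunc_poincare\<close> over the levels n >= N. By the chain rule the energies
  carry the factors \<open>(trunc' n (g z))\<^sup>2\<close>, whose sum is at most 4.\<close>

lemma nn_integral_tail_sq_ln_le:
  obtains C N where "0 \<le> C"
    "\<And>g. C1 g \<Longrightarrow> integrable \<mu> (\<lambda>z. (g z)\<^sup>2) \<Longrightarrow> integrable \<mu> (Gam g) \<Longrightarrow> (\<integral>z. (g z)\<^sup>2 \<partial>\<mu>) = 1 \<Longrightarrow>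
      (\<integral>\<^sup>+z. ennreal ((g z)\<^sup>2 * ln ((g z)\<^sup>2)) * indicator {z. 3 ^ Suc N \<le> \<bar>g z\<bar>} z \<partial>\<mu>)
        \<le> ennreal (C * (\<integral>z. Gam g z \<partial>\<mu>))"
proof (rule trunc_poincare)
  fix C N assume C: "0 \<le> C"
    and le: "\<And>g n. C1 g \<Longrightarrow> integrable \<mu> (\<lambda>z. (g z)\<^sup>2) \<Longrightarrow> integrable \<mu> (Gam g) \<Longrightarrow> (\<integral>z. (g z)\<^sup>2 \<partial>\<mu>) = 1 \<Longrightarrow> N \<le> n \<Longrightarrow>
      real (Suc n) * (\<integral>z. (trunc n (g z))\<^sup>2 \<partial>\<mu>) \<le> C * (\<integral>z. Gam (\<lambda>z. trunc n (g z)) z \<partial>\<mu>)"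
  show ?thesis
  proof (rule that[of "324 * (C * 4)" N])
    show "0 \<le> 324 * (C * 4)" using C by simp
    fix g assume g: "C1 g" "integrable \<mu> (\<lambda>z. (g z)\<^sup>2)" "integrable \<mu> (Gam g)"
      and g1: "(\<integral>z. (g z)\<^sup>2 \<partial>\<mu>) = 1"
    have tm [measurable]: "(\<lambda>z. trunc n (g z)) \<in> borel_measurable borel" for n
      by (rule C1_measurable[OF C1_trunc[OF g(1)]])
    have Gm [measurable]: "Gam g \<in> borel_measurable borel" by (rule Gam_meas[OF g(1)])
    have Gm' [measurable]: "Gam (\<lambda>z. trunc n (g z)) \<in> borel_measurable borel" for n
      by (rule Gam_meas[OF C1_trunc[OF g(1)]])
    have "(\<integral>\<^sup>+z. ennreal ((g z)\<^sup>2 * ln ((g z)\<^sup>2)) * indicator {z. 3 ^ Suc N \<le> \<bar>g z\<bar>} z \<partial>\<mu>)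
        \<le> (\<integral>\<^sup>+z. 324 * (\<Sum>n. ennreal (if N \<le> n then real (Suc n) * (trunc n (g z))\<^sup>2 else 0)) \<partial>\<mu>)"
    proof (rule nn_integral_mono)
      fix z
      show "ennreal ((g z)\<^sup>2 * ln ((g z)\<^sup>2)) * indicator {z. 3 ^ Suc N \<le> \<bar>g z\<bar>} z
          \<le> 324 * (\<Sum>n. ennreal (if N \<le> n then real (Suc n) * (trunc n (g z))\<^sup>2 else 0))"
      proof (cases "3 ^ Suc N \<le> \<bar>g z\<bar>")
        case True
        then have "z \<in> {z. 3 ^ Suc N \<le> \<bar>g z\<bar>}" by simp
        then show ?thesis using sq_ln_le_suminf_trunc[OF True] by (simp only: indicator_simps mult_1_right)
      next
        case False
        then have "z \<notin> {z. 3 ^ Suc N \<le> \<bar>g z\<bar>}" by simp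
        then have "indicator {z. 3 ^ Suc N \<le> \<bar>g z\<bar>} z = (0::ennreal)" by (rule indicator_simps)
        then show ?thesis by (simp only: mult_zero_right zero_le)
      qed
    qed
    also have "\<dots> = 324 * (\<Sum>n. \<integral>\<^sup>+z. ennreal (if N \<le> n then real (Suc n) * (trunc n (g z))\<^sup>2 else 0) \<partial>\<mu>)"
      by (subst nn_integral_cmult, measurable) (subst nn_integral_suminf, auto)
    also have "\<dots> \<le> 324 * (\<Sum>n. \<integral>\<^sup>+z. ennreal C * ennreal (Gam (\<lambda>z. trunc n (g z)) z) \<partial>\<mu>)"
    proof (intro mult_left_mono suminf_le allI)
      fix n
      show "(\<integral>\<^sup>+z. ennreal (if N \<le> n then real (Suc n) * (trunc n (g z))\<^sup>2 else 0) \<partial>\<mu>)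
          \<le> (\<integral>\<^sup>+z. ennreal C * ennreal (Gam (\<lambda>z. trunc n (g z)) z) \<partial>\<mu>)"
      proof (cases "N \<le> n")
        case True
        have "(\<integral>\<^sup>+z. ennreal (real (Suc n) * (trunc n (g z))\<^sup>2) \<partial>\<mu>)
            = ennreal (\<integral>z. real (Suc n) * (trunc n (g z))\<^sup>2 \<partial>\<mu>)"
          by (rule nn_integral_eq_integral[OF integrable_mult_right[OF integrable_trunc_sq[OF g]]]) auto
        also have "\<dots> \<le> ennreal (C * (\<integral>z. Gam (\<lambda>z. trunc n (g z)) z \<partial>\<mu>))"
          using le[OF g g1 True] by (intro ennreal_leI) simp
        also have "\<dots> = ennreal C * ennreal (\<integral>z. Gam (\<lambda>z. trunc n (g z)) z \<partial>\<mu>)"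
          using C by (rule ennreal_mult')
        also have "ennreal (\<integral>z. Gam (\<lambda>z. trunc n (g z)) z \<partial>\<mu>) = (\<integral>\<^sup>+z. ennreal (Gam (\<lambda>z. trunc n (g z)) z) \<partial>\<mu>)"
          by (rule nn_integral_eq_integral[OF integrable_Gam_trunc[OF g], symmetric]) (simp add: Gam_nonneg)
        finally show ?thesis using True by (simp add: nn_integral_cmult)
      qed simp
    qed auto
    also have "(\<Sum>n. \<integral>\<^sup>+z. ennreal C * ennreal (Gam (\<lambda>z. trunc n (g z)) z) \<partial>\<mu>)
        = (\<integral>\<^sup>+z. (\<Sum>n. ennreal C * ennreal (Gam (\<lambda>z. trunc n (g z)) z)) \<partial>\<mu>)"
      by (subst nn_integral_suminf) auto
    also have "\<dots> \<le> (\<integral>\<^sup>+z. ennreal (C * 4) * ennreal (Gam g z) \<partial>\<mu>)"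
    proof (rule nn_integral_mono)
      fix z
      have "(\<Sum>n. ennreal C * ennreal (Gam (\<lambda>z. trunc n (g z)) z))
          = (\<Sum>n. (ennreal C * ennreal (Gam g z)) * ennreal ((trunc' n (g z))\<^sup>2))"
        by (intro suminf_cong) (simp add: Gam_trunc[OF g(1)] ennreal_mult Gam_nonneg mult_ac)
      also have "\<dots> = (ennreal C * ennreal (Gam g z)) * (\<Sum>n. ennreal ((trunc' n (g z))\<^sup>2))"
        by (rule ennreal_suminf_cmult)
      also have "\<dots> \<le> (ennreal C * ennreal (Gam g z)) * 4"
        by (intro mult_left_mono suminf_trunc'_sq_le) simp
      also have "\<dots> = ennreal (C * 4) * ennreal (Gam g z)"
        using C by (simp add: ennreal_mult mult_ac)
      finally show "(\<Sum>n. ennreal C * ennreal (Gam (\<lambda>z. trunc n (g z)) z)) \<le> ennreal (C * 4) * ennreal (Gam g z)" .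
    qed
    also have "\<dots> = ennreal (C * 4) * ennreal (\<integral>z. Gam g z \<partial>\<mu>)"
      by (subst nn_integral_cmult) (auto simp: nn_integral_eq_integral[OF g(3)] Gam_nonneg)
    also have "324 * (ennreal (C * 4) * ennreal (\<integral>z. Gam g z \<partial>\<mu>)) = ennreal (324 * (C * 4) * (\<integral>z. Gam g z \<partial>\<mu>))"
    proof -
      have "ennreal (324 * (C * 4) * (\<integral>z. Gam g z \<partial>\<mu>)) = ennreal (324 * (C * 4)) * ennreal (\<integral>z. Gam g z \<partial>\<mu>)"
        by (rule ennreal_mult) (use C integral_Gam_nonneg[of g] in auto)
      also have "ennreal (324 * (C * 4)) = ennreal 324 * ennreal (C * 4)"
        by (rule ennreal_mult) (use C in auto)
      finally show ?thesis by (simp only: ennreal_numeral mult.assoc)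
    qed
    finally show "(\<integral>\<^sup>+z. ennreal ((g z)\<^sup>2 * ln ((g z)\<^sup>2)) * indicator {z. 3 ^ Suc N \<le> \<bar>g z\<bar>} z \<partial>\<mu>)
        \<le> ennreal (324 * (C * 4) * (\<integral>z. Gam g z \<partial>\<mu>))"
      by (simp add: mult_left_mono)
  qed
qed

text \<open>The integrand x ln x is replaced by x ln x - x + 1 at x = g^2, which has the same
  integral because g^2 has mean 1 but is nonnegative; integrability thus follows from a finite
  bound. For |g| < M it is at most (g^2 - 1)^2 <= (M+1)^2 (|g| - 1)^2, the Poincare part, and for
  |g| >= M it is at most g^2 ln (g^2), the tail.\<close>

theorem log_sobolev:
  obtains \<rho> where "0 < \<rho>"
    "\<And>g. C1 g \<Longrightarrow> integrable \<mu> (\<lambda>z. (g z)\<^sup>2) \<Longrightarrow> integrable \<mu> (Gam g) \<Longrightarrow> (\<integral>z. (g z)\<^sup>2 \<partial>\<mu>) = 1 \<Longrightarrow>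
      integrable \<mu> (\<lambda>z. (g z)\<^sup>2 * ln ((g z)\<^sup>2)) \<and>
      (\<integral>z. (g z)\<^sup>2 * ln ((g z)\<^sup>2) \<partial>\<mu>) \<le> \<rho> * (\<integral>z. Gam g z \<partial>\<mu>)"
proof (rule nn_integral_tail_sq_ln_le, rule poincare)
  fix C N C\<^sub>P assume C: "0 \<le> C"
    and tail: "\<And>g. C1 g \<Longrightarrow> integrable \<mu> (\<lambda>z. (g z)\<^sup>2) \<Longrightarrow> integrable \<mu> (Gam g) \<Longrightarrow> (\<integral>z. (g z)\<^sup>2 \<partial>\<mu>) = 1 \<Longrightarrow>
      (\<integral>\<^sup>+z. ennreal ((g z)\<^sup>2 * ln ((g z)\<^sup>2)) * indicator {z. 3 ^ Suc N \<le> \<bar>g z\<bar>} z \<partial>\<mu>)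
        \<le> ennreal (C * (\<integral>z. Gam g z \<partial>\<mu>))"
    and CP: "0 \<le> C\<^sub>P"
    and poin: "\<And>g. C1 g \<Longrightarrow> integrable \<mu> (\<lambda>z. (g z)\<^sup>2) \<Longrightarrow> integrable \<mu> (Gam g) \<Longrightarrow> (\<integral>z. (g z)\<^sup>2 \<partial>\<mu>) = 1 \<Longrightarrow>
      (\<integral>z. (\<bar>g z\<bar> - 1)\<^sup>2 \<partial>\<mu>) \<le> C\<^sub>P * (\<integral>z. Gam g z \<partial>\<mu>)"
  define M :: real where "M = 3 ^ Suc N"
  have M: "1 \<le> M" unfolding M_def by (rule one_le_power) simp
  \<comment> \<open>The final 1 only guarantees strict positivity.\<close>
  define \<rho> where "\<rho> = (M + 1)\<^sup>2 * C\<^sub>P + C + 1"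
  show ?thesis
  proof (rule that[of \<rho>])
    show "0 < \<rho>" unfolding \<rho>_def using C CP by (intro add_nonneg_pos add_nonneg_nonneg) auto
    fix g assume g: "C1 g" "integrable \<mu> (\<lambda>z. (g z)\<^sup>2)" "integrable \<mu> (Gam g)"
      and g1: "(\<integral>z. (g z)\<^sup>2 \<partial>\<mu>) = 1"
    have gm [measurable]: "g \<in> borel_measurable borel" by (rule C1_measurable[OF g(1)])
    define E where "E = (\<integral>z. Gam g z \<partial>\<mu>)"
    have E: "E \<ge> 0" unfolding E_def by (rule integral_Gam_nonneg)
    define T where "T z = (g z)\<^sup>2 * ln ((g z)\<^sup>2) - (g z)\<^sup>2 + 1" for z
    have [measurable]: "T \<in> borel_measurable borel" unfolding T_def by measurable
    have T0: "0 \<le> T z" for z unfolding T_def by (rule mult_ln_minus_bounds) simp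
    have ia: "integrable \<mu> (\<lambda>z. \<bar>g z\<bar>)" by (rule integrable_abs_of_sq[OF gm g(2)])
    have "(\<bar>g z\<bar> - 1)\<^sup>2 = (g z)\<^sup>2 - 2 * \<bar>g z\<bar> + 1" for z by (simp add: power2_diff)
    then have i1: "integrable \<mu> (\<lambda>z. (\<bar>g z\<bar> - 1)\<^sup>2)" using g(2) ia by auto
    have pw: "ennreal (T z) \<le> ennreal ((M + 1)\<^sup>2 * (\<bar>g z\<bar> - 1)\<^sup>2)
        + ennreal ((g z)\<^sup>2 * ln ((g z)\<^sup>2)) * indicator {z. M \<le> \<bar>g z\<bar>} z" for z
    proof (cases "M \<le> \<bar>g z\<bar>")
      case True
      then have "1 \<le> \<bar>g z\<bar>\<^sup>2" using M by (intro one_le_power) linarith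
      then have "T z \<le> (g z)\<^sup>2 * ln ((g z)\<^sup>2)" unfolding T_def by simp
      then have "ennreal (T z) \<le> ennreal ((g z)\<^sup>2 * ln ((g z)\<^sup>2))" by (rule ennreal_leI)
      then show ?thesis using True by (simp add: add_increasing)
    next
      case False
      have "T z \<le> ((g z)\<^sup>2 - 1)\<^sup>2" unfolding T_def by (rule mult_ln_minus_bounds) simp
      also have "(g z)\<^sup>2 - 1 = (\<bar>g z\<bar> + 1) * (\<bar>g z\<bar> - 1)" by (simp add: algebra_simps power2_eq_square)
      also have "(\<dots>)\<^sup>2 \<le> (M + 1)\<^sup>2 * (\<bar>g z\<bar> - 1)\<^sup>2"
        unfolding power_mult_distrib using False by (intro mult_right_mono power_mono) auto
      finally have "ennreal (T z) \<le> ennreal ((M + 1)\<^sup>2 * (\<bar>g z\<bar> - 1)\<^sup>2)" by (rule ennreal_leI)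
      then show ?thesis using False by simp
    qed
    have "(\<integral>\<^sup>+z. ennreal (T z) \<partial>\<mu>) \<le> (\<integral>\<^sup>+z. ennreal ((M + 1)\<^sup>2 * (\<bar>g z\<bar> - 1)\<^sup>2)
        + ennreal ((g z)\<^sup>2 * ln ((g z)\<^sup>2)) * indicator {z. M \<le> \<bar>g z\<bar>} z \<partial>\<mu>)"
      by (intro nn_integral_mono pw)
    also have "\<dots> = (\<integral>\<^sup>+z. ennreal ((M + 1)\<^sup>2 * (\<bar>g z\<bar> - 1)\<^sup>2) \<partial>\<mu>)
        + (\<integral>\<^sup>+z. ennreal ((g z)\<^sup>2 * ln ((g z)\<^sup>2)) * indicator {z. M \<le> \<bar>g z\<bar>} z \<partial>\<mu>)"
      by (rule nn_integral_add) measurable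
    also have "\<dots> \<le> ennreal ((M + 1)\<^sup>2 * (C\<^sub>P * E)) + ennreal (C * E)"
    proof (rule add_mono)
      have "(\<integral>\<^sup>+z. ennreal ((M + 1)\<^sup>2 * (\<bar>g z\<bar> - 1)\<^sup>2) \<partial>\<mu>) = ennreal (\<integral>z. (M + 1)\<^sup>2 * (\<bar>g z\<bar> - 1)\<^sup>2 \<partial>\<mu>)"
        by (rule nn_integral_eq_integral[OF integrable_mult_right[OF i1]]) auto
      also have "\<dots> \<le> ennreal ((M + 1)\<^sup>2 * (C\<^sub>P * E))"
        unfolding E_def using poin[OF g g1] by (intro ennreal_leI) (simp add: mult_left_mono)
      finally show "(\<integral>\<^sup>+z. ennreal ((M + 1)\<^sup>2 * (\<bar>g z\<bar> - 1)\<^sup>2) \<partial>\<mu>) \<le> ennreal ((M + 1)\<^sup>2 * (C\<^sub>P * E))" .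
      show "(\<integral>\<^sup>+z. ennreal ((g z)\<^sup>2 * ln ((g z)\<^sup>2)) * indicator {z. M \<le> \<bar>g z\<bar>} z \<partial>\<mu>) \<le> ennreal (C * E)"
        unfolding E_def M_def by (rule tail[OF g g1])
    qed
    also have "\<dots> = ennreal ((M + 1)\<^sup>2 * (C\<^sub>P * E) + C * E)"
      using C CP E by (simp add: ennreal_plus)
    also have "\<dots> \<le> ennreal (\<rho> * E)"
      unfolding \<rho>_def using E by (intro ennreal_leI) (simp add: algebra_simps)
    finally have nn: "(\<integral>\<^sup>+z. ennreal (T z) \<partial>\<mu>) \<le> ennreal (\<rho> * E)" .
    have iT: "integrable \<mu> T"
    proof (rule integrableI_nonneg)
      show "(\<integral>\<^sup>+z. ennreal (T z) \<partial>\<mu>) < \<infinity>" using nn by (simp add: order.strict_trans1)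
    qed (use T0 in auto)
    have "ennreal (\<integral>z. T z \<partial>\<mu>) \<le> ennreal (\<rho> * E)"
      using nn by (subst (asm) nn_integral_eq_integral[OF iT]) (use T0 in auto)
    then have ET: "(\<integral>z. T z \<partial>\<mu>) \<le> \<rho> * E"
      using \<open>0 < \<rho>\<close> E by (subst (asm) ennreal_le_iff) auto
    have eq: "(g z)\<^sup>2 * ln ((g z)\<^sup>2) = T z + (g z)\<^sup>2 - 1" for z unfolding T_def by simp
    have "integrable \<mu> (\<lambda>z. (g z)\<^sup>2 * ln ((g z)\<^sup>2))" unfolding eq using iT g(2) by auto
    moreover have "(\<integral>z. (g z)\<^sup>2 * ln ((g z)\<^sup>2) \<partial>\<mu>) = (\<integral>z. T z \<partial>\<mu>)"
      unfolding eq using iT g(2) g1 prob_space by simp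
    ultimately show "integrable \<mu> (\<lambda>z. (g z)\<^sup>2 * ln ((g z)\<^sup>2)) \<and>
        (\<integral>z. (g z)\<^sup>2 * ln ((g z)\<^sup>2) \<partial>\<mu>) \<le> \<rho> * (\<integral>z. Gam g z \<partial>\<mu>)"
      using ET unfolding E_def by simp
  qed
qed

end

section \<open>The Hamiltonian\<close>

text \<open>Adding C t^2 / 2 makes \<phi> convex, and the derivative of a convex function at 0 lies
  between its increments over [-1, 0] and [0, 1]. Each increment is at most 1 from the range of
  \<phi> plus C/2 in absolute value.\<close>

lemma abs_deriv_le_of_semiconvex:
  fixes \<phi> :: "real \<Rightarrow> real"
  assumes d1: "\<And>t. (\<phi> has_real_derivative \<phi>' t) (at t)"
    and d2: "\<And>t. (\<phi>' has_real_derivative \<phi>'' t) (at t)"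
    and b: "\<And>t. 0 \<le> \<phi> t" "\<And>t. \<phi> t \<le> 1" and c: "\<And>t. - C \<le> \<phi>'' t"
  shows "\<bar>\<phi>' 0\<bar> \<le> 1 + C / 2"
proof -
  define \<psi> where "\<psi> t = \<phi> t + C * t\<^sup>2 / 2" for t
  define \<psi>' where "\<psi>' t = \<phi>' t + C * t" for t
  have D1: "(\<psi> has_real_derivative \<psi>' t) (at t)" for t
    unfolding \<psi>_def \<psi>'_def by (auto intro!: derivative_eq_intros d1)
  have D2: "(\<psi>' has_real_derivative \<phi>'' t + C) (at t)" for t
    unfolding \<psi>'_def by (auto intro!: derivative_eq_intros d2)
  have mono: "\<psi>' x \<le> \<psi>' y" if "x \<le> y" for x y
  proof (rule DERIV_nonneg_imp_nondecreasing[OF that])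
    fix t
    show "\<exists>y. (\<psi>' has_real_derivative y) (at t) \<and> 0 \<le> y"
      using D2[of t] c[of t] by (intro exI[of _ "\<phi>'' t + C"]) auto
  qed
  obtain u where u: "0 < u" "\<psi> 1 - \<psi> 0 = (1 - 0) * \<psi>' u"
    using MVT2[of 0 1 \<psi> \<psi>'] D1 by auto
  obtain w where w: "w < 0" "\<psi> 0 - \<psi> (- 1) = (0 - - 1) * \<psi>' w"
    using MVT2[of "- 1" 0 \<psi> \<psi>'] D1 by auto
  have "\<phi>' 0 \<le> \<psi> 1 - \<psi> 0" "\<psi> 0 - \<psi> (- 1) \<le> \<phi>' 0"
    using u w mono[of 0 u] mono[of w 0] by (auto simp: \<psi>'_def)
  then show ?thesis
    using b(1)[of 0] b(1)[of 1] b(1)[of "- 1"] b(2)[of 0] b(2)[of 1] b(2)[of "- 1"]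
    unfolding \<psi>_def by simp
qed

lemma lipschitz_of_bounded_pd:
  fixes F :: "'a::euclidean_space \<Rightarrow> real"
  assumes F: "C1 F" and B: "\<And>j z. j \<in> Basis \<Longrightarrow> \<bar>pd F j z\<bar> \<le> B" "0 \<le> B"
  shows "\<bar>F x - F y\<bar> \<le> sqrt DIM('a) * B * norm (x - y)"
proof -
  obtain u where "F (y + 1 *\<^sub>R (x - y)) - F (y + 0 *\<^sub>R (x - y)) = (1 - 0) * pd F (x - y) (y + u *\<^sub>R (x - y))"
    using MVT2[of 0 1 "\<lambda>t. F (y + t *\<^sub>R (x - y))" "\<lambda>t. pd F (x - y) (y + t *\<^sub>R (x - y))"] C1_DERIV_line[OF F]
    by auto
  then have eq: "F x - F y = pd F (x - y) (y + u *\<^sub>R (x - y))" by simp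
  have "grad_sq F z \<le> DIM('a) * B\<^sup>2" for z
  proof -
    have "grad_sq F z \<le> (\<Sum>j\<in>(Basis::'a set). B\<^sup>2)"
      unfolding grad_sq_def
    proof (rule sum_mono)
      fix j :: 'a assume "j \<in> Basis"
      then have "\<bar>pd F j z\<bar>\<^sup>2 \<le> B\<^sup>2" using B by (intro power_mono) auto
      then show "(pd F j z)\<^sup>2 \<le> B\<^sup>2" by simp
    qed
    then show ?thesis by simp
  qed
  moreover have "(F x - F y)\<^sup>2 \<le> (norm (x - y))\<^sup>2 * grad_sq F (y + u *\<^sub>R (x - y))"
    unfolding eq by (rule pd_sq_le_grad_sq) (use F in \<open>auto simp: C1_def\<close>)
  ultimately have "(F x - F y)\<^sup>2 \<le> (norm (x - y))\<^sup>2 * (DIM('a) * B\<^sup>2)"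
    by (meson mult_left_mono order_trans zero_le_power2)
  then have "sqrt ((F x - F y)\<^sup>2) \<le> sqrt ((norm (x - y))\<^sup>2 * (DIM('a) * B\<^sup>2))"
    by (rule real_sqrt_le_mono)
  then show ?thesis using B(2) by (simp add: real_sqrt_mult mult_ac)
qed

text \<open>Along a coordinate line, \<open>(e\<^sup>-\<^sup>s\<^sup>H)'' = e\<^sup>-\<^sup>s\<^sup>H (s\<^sup>2 H'\<^sup>2 - s H'')\<close> is bounded below as soon as
  \<open>e\<^sup>-\<^sup>s\<^sup>H H''\<close> is bounded above, and a bounded semiconvex function has bounded derivative.\<close>

lemma exp_neg_lipschitz:
  fixes H :: "'a::euclidean_space \<Rightarrow> real"
  assumes H: "C1 H" and H2: "\<And>j. j \<in> Basis \<Longrightarrow> C1 (pd H j)" and H0: "\<And>z. 0 \<le> H z"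
    and s: "0 < s" and M: "\<And>j z. j \<in> Basis \<Longrightarrow> exp (- s * H z) * \<bar>pd (pd H j) j z\<bar> \<le> M"
  obtains L where "0 < L" "\<And>x y. \<bar>exp (- s * H x) - exp (- s * H y)\<bar> \<le> L * norm (x - y)"
proof -
  define F where "F z = exp (- s * H z)" for z
  have d: "((\<lambda>x. exp (- s * x)) has_real_derivative - s * exp (- s * x)) (at x)" for x
    by (auto intro!: derivative_eq_intros)
  have c: "continuous_on (range H) (\<lambda>x. - s * exp (- s * x))" by (intro continuous_intros)
  have F: "C1 F" and pdF: "pd F v z = - s * F z * pd H v z" for v z
    unfolding F_def using C1_compose[OF H d c] pd_compose[OF H d c] by auto
  have M0: "0 \<le> M"
  proof -
    obtain j :: 'a where "j \<in> Basis" using nonempty_Basis by blast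
    from order_trans[OF _ M[OF this, of 0]] show ?thesis by simp
  qed
  have bd: "\<bar>pd F j z\<bar> \<le> 1 + s * M / 2" if j: "j \<in> Basis" for j z
  proof -
    let ?l = "\<lambda>t. z + t *\<^sub>R j"
    have "\<bar>- s * F (?l 0) * pd H j (?l 0)\<bar> \<le> 1 + (s * M) / 2"
    proof (rule abs_deriv_le_of_semiconvex[where \<phi>="\<lambda>t. F (?l t)" and \<phi>'="\<lambda>t. - s * F (?l t) * pd H j (?l t)"
          and \<phi>''="\<lambda>t. s\<^sup>2 * F (?l t) * (pd H j (?l t))\<^sup>2 - s * (F (?l t) * pd (pd H j) j (?l t))"])
      fix t
      show "((\<lambda>t. F (?l t)) has_real_derivative - s * F (?l t) * pd H j (?l t)) (at t)"
        using C1_DERIV_line[OF F, of z j t] by (simp add: pdF)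
      have "((\<lambda>t. - s * F (?l t) * pd H j (?l t)) has_real_derivative
          - s * pd F j (?l t) * pd H j (?l t) + pd (pd H j) j (?l t) * (- s * F (?l t))) (at t)"
        by (intro DERIV_mult DERIV_cmult C1_DERIV_line F H2 j)
      then show "((\<lambda>t. - s * F (?l t) * pd H j (?l t)) has_real_derivative
          s\<^sup>2 * F (?l t) * (pd H j (?l t))\<^sup>2 - s * (F (?l t) * pd (pd H j) j (?l t))) (at t)"
        by (simp add: pdF power2_eq_square algebra_simps)
      show "0 \<le> F (?l t)" "F (?l t) \<le> 1" using H0[of "?l t"] s by (auto simp: F_def)
      have "F (?l t) * pd (pd H j) j (?l t) \<le> F (?l t) * \<bar>pd (pd H j) j (?l t)\<bar>"
        by (intro mult_left_mono) (auto simp: F_def)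
      also have "\<dots> \<le> M" using M[OF j] by (simp add: F_def)
      finally have "s * (F (?l t) * pd (pd H j) j (?l t)) \<le> s * M" using s by (intro mult_left_mono) auto
      moreover have "0 \<le> s\<^sup>2 * F (?l t) * (pd H j (?l t))\<^sup>2" by (simp add: F_def)
      ultimately show "- (s * M) \<le> s\<^sup>2 * F (?l t) * (pd H j (?l t))\<^sup>2 - s * (F (?l t) * pd (pd H j) j (?l t))"
        by linarith
    qed
    then show ?thesis by (simp add: pdF)
  qed
  have pos: "0 < 1 + s * M / 2" using s M0 by (simp add: add_pos_nonneg)
  show ?thesis
  proof (rule that[of "sqrt DIM('a) * (1 + s * M / 2)"])
    show "0 < sqrt DIM('a) * (1 + s * M / 2)" using pos by simp
    show "\<bar>exp (- s * H x) - exp (- s * H y)\<bar> \<le> sqrt DIM('a) * (1 + s * M / 2) * norm (x - y)" for x y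
      using lipschitz_of_bounded_pd[OF F bd less_imp_le[OF pos]] unfolding F_def .
  qed
qed

section \<open>Calculus and integrability of the Hamiltonian\<close>

lemma sum_Basis_prod:
  "(\<Sum>j\<in>(Basis :: ('a::euclidean_space \<times> 'b::euclidean_space) set). f j)
    = (\<Sum>i\<in>Basis. f (i, 0)) + (\<Sum>i\<in>Basis. f (0, i))"
proof -
  have "(\<Sum>j\<in>(Basis :: ('a \<times> 'b) set). f j) = (\<Sum>j\<in>(\<lambda>u. (u, 0)) ` Basis. f j) + (\<Sum>j\<in>(\<lambda>u. (0, u)) ` Basis. f j)"
    unfolding Basis_prod_def by (rule sum.union_disjoint) (auto dest: nonzero_Basis)
  then show ?thesis by (simp add: sum.reindex inj_on_def)
qed

lemma inner_sum_Basis: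
  "(\<Sum>i\<in>Basis. f i *\<^sub>R i) \<bullet> (\<Sum>i\<in>Basis. g i *\<^sub>R (i::'a::euclidean_space)) = (\<Sum>i\<in>Basis. f i * g i)"
  by (subst euclidean_inner) (simp add: inner_sum_left_Basis)

lemma
  fixes f :: "'a::euclidean_space \<Rightarrow> real"
  assumes "C1 f"
  shows C1_fst: "C1 (\<lambda>z::'a \<times> 'b::euclidean_space. f (fst z))"
    and pd_fst: "pd (\<lambda>z::'a \<times> 'b. f (fst z)) v z = pd f (fst v) (fst z)"
proof -
  have d: "((\<lambda>z::'a \<times> 'b. f (fst z)) has_derivative (\<lambda>v. pd f (fst v) (fst z))) (at z)" for z
    by (rule has_derivative_compose[OF _ C1_has_derivative[OF assms]]) (auto intro!: derivative_eq_intros)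
  have c: "continuous_on UNIV (\<lambda>z::'a \<times> 'b. pd f v (fst z))" for v
    by (rule continuous_on_compose2[OF C1_continuous_on_pd[OF assms, of UNIV]]) (auto intro!: continuous_intros)
  show "C1 (\<lambda>z::'a \<times> 'b. f (fst z))" by (rule C1I[OF d]) (rule c)
  show "pd (\<lambda>z::'a \<times> 'b. f (fst z)) v z = pd f (fst v) (fst z)" by (rule pd_eqI[OF d])
qed

lemma
  fixes U :: "'a::euclidean_space \<Rightarrow> real"
  assumes U: "C1 U"
  shows C1_Ham: "C1 (Ham U)"
    and pd_Ham: "pd (Ham U) v z = pd U (fst v) (fst z) + snd z \<bullet> snd v"
proof -
  have eq: "Ham U = (\<lambda>z. U (fst z) + (1 / 2) * (snd z \<bullet> snd z))"
    by (auto simp: Ham_def power2_norm_eq_inner)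
  have d: "(Ham U has_derivative (\<lambda>v. pd U (fst v) (fst z) + snd z \<bullet> snd v)) (at z)" for z
  proof -
    have "((\<lambda>z::'a \<times> 'a. (1 / 2) * (snd z \<bullet> snd z)) has_derivative (\<lambda>v. snd z \<bullet> snd v)) (at z)"
      by (auto intro!: derivative_eq_intros simp: inner_commute)
    from has_derivative_add[OF C1_has_derivative[OF C1_fst[OF U]] this]
    show ?thesis unfolding eq pd_fst[OF U] .
  qed
  have c: "continuous_on UNIV (\<lambda>z::'a \<times> 'a. pd U v (fst z))" for v
    by (rule continuous_on_compose2[OF C1_continuous_on_pd[OF U, of UNIV]]) (auto intro!: continuous_intros)
  show "C1 (Ham U)" by (rule C1I[OF d]) (intro continuous_intros c)
  show "pd (Ham U) v z = pd U (fst v) (fst z) + snd z \<bullet> snd v" by (rule pd_eqI[OF d])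
qed

lemma C1_pd_Ham:
  fixes U :: "'a::euclidean_space \<Rightarrow> real"
  assumes U: "C1 U" and U2: "\<And>i. i \<in> Basis \<Longrightarrow> C1 (pd U i)" and j: "j \<in> Basis"
  shows "C1 (pd (Ham U) j)"
proof -
  have pd0: "pd U 0 x = 0" for x
    using linear_0[OF has_derivative_linear[OF C1_has_derivative[OF U]]] .
  consider i where "i \<in> Basis" "j = (i, 0)" | i where "i \<in> Basis" "j = (0, i)"
    using j unfolding Basis_prod_def by blast
  then show ?thesis
  proof cases
    case 1
    have "pd (Ham U) j = (\<lambda>z. pd U i (fst z))" using 1 by (auto simp: pd_Ham[OF U])
    then show ?thesis using C1_fst[OF U2[OF 1(1)]] by simp
  next
    case 2
    have eq: "pd (Ham U) j = (\<lambda>z. snd z \<bullet> i)" using 2 by (auto simp: pd_Ham[OF U] pd0)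
    have d: "((\<lambda>z::'a \<times> 'a. snd z \<bullet> i) has_derivative (\<lambda>v. snd v \<bullet> i)) (at z)" for z
      by (auto intro!: derivative_eq_intros)
    show ?thesis unfolding eq by (rule C1I[OF d]) (intro continuous_intros)
  qed
qed

lemma bounded_Ham_sublevel:
  fixes U :: "'a::euclidean_space \<Rightarrow> real"
  assumes U: "\<And>x. 1 \<le> U x" and lim: "filterlim U at_top at_infinity"
  shows "bounded {z. Ham U z \<le> r}"
proof -
  have "eventually (\<lambda>x. r < U x) at_infinity"
    using lim unfolding filterlim_at_top_dense by blast
  then obtain B where B: "\<And>x. B \<le> norm x \<Longrightarrow> r < U x"
    unfolding eventually_at_infinity by blast
  have "norm z \<le> B + (1 + 2 * r)" if "Ham U z \<le> r" for z
  proof -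
    have "U (fst z) \<le> r" using that zero_le_power2[of "norm (snd z)"] unfolding Ham_def by linarith
    then have "norm (fst z) \<le> B" using B[of "fst z"] by fastforce
    moreover have "(norm (snd z))\<^sup>2 \<le> 2 * r" using that U[of "fst z"] unfolding Ham_def by linarith
    \<comment> \<open>Nonnegativity of (t - 1)^2 trades the square root for a linear bound.\<close>
    then have "norm (snd z) \<le> 1 + 2 * r"
      using zero_le_power2[of "norm (snd z) - 1"] zero_le_power2[of "norm (snd z)"]
      unfolding power2_diff by (simp only: power_one mult_1_right)
    moreover have "norm z \<le> norm (fst z) + norm (snd z)"
      using norm_Pair_le[of "fst z" "snd z"] by simp
    ultimately show ?thesis by linarith
  qed
  then show ?thesis unfolding bounded_iff by blast
qed

text \<open>The Gaussian factors over the coordinates, each factor a multiple of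
  \<open>std_normal_density\<close>.\<close>

lemma integrable_gaussian:
  "integrable lborel (\<lambda>y::'a::euclidean_space. exp (- (norm y)\<^sup>2 / 2))"
proof (rule integrableI_nonneg)
  have "integrable lborel (\<lambda>x. sqrt (2 * pi) * std_normal_density x)" by simp
  moreover have "(\<lambda>x. sqrt (2 * pi) * std_normal_density x) = (\<lambda>x. exp (- x\<^sup>2 / 2))"
    by (auto simp: std_normal_density_def)
  ultimately have i: "integrable lborel (\<lambda>x::real. exp (- x\<^sup>2 / 2))" by simp
  have "(\<integral>\<^sup>+y. ennreal (exp (- (norm (y::'a))\<^sup>2 / 2)) \<partial>lborel)
      = (\<integral>\<^sup>+y. (\<Prod>b\<in>Basis. ennreal (exp (- ((y::'a) \<bullet> b)\<^sup>2 / 2))) \<partial>lborel)"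
  proof (rule nn_integral_cong)
    fix y :: 'a
    have "(norm y)\<^sup>2 = (\<Sum>b\<in>Basis. (y \<bullet> b)\<^sup>2)"
      unfolding power2_norm_eq_inner by (subst euclidean_inner) (simp add: power2_eq_square)
    then have "exp (- (norm y)\<^sup>2 / 2) = (\<Prod>b\<in>Basis. exp (- (y \<bullet> b)\<^sup>2 / 2))"
      by (simp add: exp_sum[symmetric] sum_negf[symmetric] sum_divide_distrib)
    then show "ennreal (exp (- (norm y)\<^sup>2 / 2)) = (\<Prod>b\<in>Basis. ennreal (exp (- (y \<bullet> b)\<^sup>2 / 2)))"
      by (simp add: prod_ennreal)
  qed
  also have "\<dots> = (\<Prod>b\<in>(Basis::'a set). \<integral>\<^sup>+x. ennreal (exp (- x\<^sup>2 / 2)) \<partial>lborel)"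
    by (rule nn_integral_lborel_prod) auto
  also have "\<dots> = (\<Prod>b\<in>(Basis::'a set). ennreal (\<integral>x. exp (- x\<^sup>2 / 2) \<partial>lborel))"
    by (subst nn_integral_eq_integral[OF i]) auto
  also have "\<dots> < \<infinity>" by (simp add: prod_ennreal ennreal_power)
  finally show "(\<integral>\<^sup>+y. ennreal (exp (- (norm (y::'a))\<^sup>2 / 2)) \<partial>lborel) < \<infinity>" .
qed auto

lemma integrable_exp_Ham:
  fixes U :: "'a::euclidean_space \<Rightarrow> real"
  assumes U: "integrable lborel (\<lambda>x. exp (- U x))"
  shows "integrable lborel (\<lambda>z. exp (- Ham U z))"
proof -
  have [measurable]: "(\<lambda>x. exp (- U x)) \<in> borel_measurable borel" using U by auto
  have eq: "exp (- Ham U z) = exp (- U (fst z)) * exp (- (norm (snd z))\<^sup>2 / 2)" for z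
    by (simp add: Ham_def exp_add[symmetric])
  have "integrable (lborel \<Otimes>\<^sub>M lborel) (\<lambda>z::'a \<times> 'a. exp (- U (fst z)) * exp (- (norm (snd z))\<^sup>2 / 2))"
  proof (rule integrableI_nonneg)
    have "(\<integral>\<^sup>+z. ennreal (exp (- U (fst z)) * exp (- (norm (snd z))\<^sup>2 / 2)) \<partial>(lborel \<Otimes>\<^sub>M (lborel :: 'a measure)))
        = (\<integral>\<^sup>+x. \<integral>\<^sup>+y. ennreal (exp (- U x)) * ennreal (exp (- (norm (y::'a))\<^sup>2 / 2)) \<partial>lborel \<partial>lborel)"
      by (subst lborel.nn_integral_fst[symmetric]) (auto simp: ennreal_mult)
    also have "\<dots> = ennreal (\<integral>x. exp (- U x) \<partial>lborel) * ennreal (\<integral>y. exp (- (norm (y::'a))\<^sup>2 / 2) \<partial>lborel)"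
    proof -
      have "(\<integral>\<^sup>+y. ennreal (exp (- (norm (y::'a))\<^sup>2 / 2)) \<partial>lborel) = ennreal (\<integral>y. exp (- (norm (y::'a))\<^sup>2 / 2) \<partial>lborel)"
        by (rule nn_integral_eq_integral[OF integrable_gaussian]) simp
      then show ?thesis
        by (simp add: nn_integral_cmult nn_integral_multc nn_integral_eq_integral[OF U])
    qed
    also have "\<dots> < \<infinity>" by (simp add: ennreal_mult_less_top)
    finally show "(\<integral>\<^sup>+z. ennreal (exp (- U (fst z)) * exp (- (norm (snd z))\<^sup>2 / 2)) \<partial>(lborel \<Otimes>\<^sub>M (lborel :: 'a measure))) < \<infinity>" .
  qed auto
  then show ?thesis unfolding eq lborel_prod .
qed

text \<open>Were z interior to its own sublevel set, it would be a local maximum and the gradient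
  would vanish there.\<close>

lemma mem_frontier_sublevel:
  assumes H: "C1 (Ham U)" and g: "grad (Ham U) z \<noteq> 0"
  shows "z \<in> frontier (sublevel U (Ham U z))"
proof -
  have "z \<notin> interior (sublevel U (Ham U z))"
  proof
    assume "z \<in> interior (sublevel U (Ham U z))"
    then obtain S where S: "open S" "z \<in> S" "S \<subseteq> sublevel U (Ham U z)"
      by (auto elim: interiorE)
    have eq: "(\<lambda>v. pd (Ham U) v z) = (\<lambda>v. 0)"
      by (rule differential_zero_maxmin[OF S(2,1) C1_has_derivative[OF H]]) (use S(3) in \<open>auto simp: sublevel_def\<close>)
    have "grad (Ham U) z = 0" unfolding grad_def fun_cong[OF eq] by simp
    then show False using g by simp
  qed
  moreover have "z \<in> closure (sublevel U (Ham U z))"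
    using closure_subset[of "sublevel U (Ham U z)"] by (auto simp: sublevel_def)
  ultimately show ?thesis by (simp add: frontier_def)
qed

text \<open>A point with large H lies outside the ball, so its gradient is nonzero and it sits on
  the frontier over which \<open>theta\<close> takes the supremum at r = H(z). The remaining points
  form a compact sublevel set.\<close>

lemma exp_Ham_second_pd_bounded:
  fixes U :: "'a::euclidean_space \<Rightarrow> real"
  assumes H: "C1 (Ham U)" and H2: "\<And>j. j \<in> Basis \<Longrightarrow> C1 (pd (Ham U) j)"
    and H0: "\<And>z. 0 \<le> Ham U z" and bdd: "\<And>r. bounded {z. Ham U z \<le> r}"
    and h: "0 < h" "\<And>z. R \<le> norm z \<Longrightarrow> h \<le> norm (grad (Ham U) z)"
    and s: "0 < s" and th: "\<And>r. r0 \<le> r \<Longrightarrow> theta U r \<le> c * exp (s * r)"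
  obtains M where "\<And>j z. j \<in> Basis \<Longrightarrow> exp (- s * Ham U z) * \<bar>pd (pd (Ham U) j) j z\<bar> \<le> M"
proof -
  define G where "G z = (\<Sum>i\<in>Basis. \<Sum>j\<in>Basis. \<bar>pd (pd (Ham U) i) j z\<bar>)" for z
  have Gc: "continuous_on S G" for S
    unfolding G_def by (intro continuous_intros C1_continuous_on_pd H2)
  have G_ge: "\<bar>pd (pd (Ham U) i) j z\<bar> \<le> G z" if "i \<in> Basis" "j \<in> Basis" for i j z
  proof -
    have "\<bar>pd (pd (Ham U) i) j z\<bar> \<le> (\<Sum>j\<in>Basis. \<bar>pd (pd (Ham U) i) j z\<bar>)"
      using that by (intro member_le_sum) auto
    also have "\<dots> \<le> G z" unfolding G_def using that
      by (intro member_le_sum[of i _ "\<lambda>i. \<Sum>j\<in>Basis. \<bar>pd (pd (Ham U) i) j z\<bar>"]) (auto intro: sum_nonneg)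
    finally show ?thesis .
  qed
  have closed: "closed (sublevel U r)" for r
    unfolding sublevel_def by (intro closed_Collect_le continuous_intros C1_continuous_on H)
  have compact: "compact (sublevel U r)" for r
    using closed[of r] bdd[of r] by (simp add: compact_eq_bounded_closed sublevel_def)
  have Gb: "\<exists>B. \<forall>z\<in>sublevel U r. G z \<le> B" for r
  proof -
    have "bounded (G ` sublevel U r)"
      by (intro compact_imp_bounded compact_continuous_image Gc compact)
    then obtain B where "\<forall>z\<in>sublevel U r. \<bar>G z\<bar> \<le> B" unfolding bounded_iff by auto
    then show ?thesis by (intro exI[of _ B]) fastforce
  qed
  have "bounded (Ham U ` cball 0 R)"
    by (intro compact_imp_bounded compact_continuous_image C1_continuous_on H) simp
  then obtain M0 where M0: "\<forall>z\<in>cball 0 R. \<bar>Ham U z\<bar> \<le> M0" unfolding bounded_iff by auto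
  \<comment> \<open>Beyond \<open>r1\<close> the bound on \<open>theta\<close> is in force, and z is
    outside the ball because \<open>M0\<close> bounds H on it.\<close>
  define r1 where "r1 = max r0 (M0 + 1)"
  obtain B1 where B1: "\<forall>z\<in>sublevel U r1. G z \<le> B1" using Gb by blast
  show ?thesis
  proof (rule that[of "max c B1"])
    fix j :: "'a \<times> 'a" and z assume j: "j \<in> Basis"
    show "exp (- s * Ham U z) * \<bar>pd (pd (Ham U) j) j z\<bar> \<le> max c B1"
    proof (cases "Ham U z \<le> r1")
      case True
      have "exp (- s * Ham U z) * \<bar>pd (pd (Ham U) j) j z\<bar> \<le> 1 * G z"
        using s H0[of z] G_ge[OF j j, of z] by (intro mult_mono) auto
      moreover have "G z \<le> B1" using B1 True unfolding sublevel_def by blast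
      ultimately show ?thesis by simp
    next
      case False
      have "z \<notin> cball 0 R"
      proof
        assume "z \<in> cball 0 R"
        then have "\<bar>Ham U z\<bar> \<le> M0" using M0 by blast
        then show False using False unfolding r1_def by linarith
      qed
      then have "grad (Ham U) z \<noteq> 0" using h(2)[of z] h(1) by auto
      then have z: "z \<in> frontier (sublevel U (Ham U z))" by (rule mem_frontier_sublevel[OF H])
      obtain B where B: "\<forall>y\<in>sublevel U (Ham U z). G y \<le> B" using Gb by blast
      \<comment> \<open>A real \<open>Sup\<close> dominates its members only if the set is bounded
        above; compactness of the sublevel set provides this.\<close>
      have "\<bar>pd (pd (Ham U) j) j z\<bar> \<le> theta U (Ham U z)"
        unfolding theta_def
      proof (rule cSup_upper)
        show "\<bar>pd (pd (Ham U) j) j z\<bar> \<in> {\<bar>pd (pd (Ham U) i) j y\<bar> |y i j.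
            y \<in> frontier (sublevel U (Ham U z)) \<and> i \<in> Basis \<and> j \<in> Basis}"
          using z j by blast
        show "bdd_above {\<bar>pd (pd (Ham U) i) j y\<bar> |y i j.
            y \<in> frontier (sublevel U (Ham U z)) \<and> i \<in> Basis \<and> j \<in> Basis}"
        proof (rule bdd_aboveI[of _ B])
          fix x assume "x \<in> {\<bar>pd (pd (Ham U) i) j y\<bar> |y i j.
            y \<in> frontier (sublevel U (Ham U z)) \<and> i \<in> Basis \<and> j \<in> Basis}"
          then obtain y i k where x: "x = \<bar>pd (pd (Ham U) i) k y\<bar>" "y \<in> frontier (sublevel U (Ham U z))"
            "i \<in> Basis" "k \<in> Basis" by blast
          then have "y \<in> sublevel U (Ham U z)" using frontier_subset_closed[OF closed] by blast
          then show "x \<le> B" using G_ge[OF x(3,4), of y] B x(1) by fastforce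
        qed
      qed
      also have "\<dots> \<le> c * exp (s * Ham U z)" using False by (intro th) (simp add: r1_def)
      finally have "exp (- s * Ham U z) * \<bar>pd (pd (Ham U) j) j z\<bar> \<le> exp (- s * Ham U z) * (c * exp (s * Ham U z))"
        by (intro mult_left_mono) auto
      also have "\<dots> = c" by (simp add: exp_minus)
      finally show ?thesis by simp
    qed
  qed
qed

text \<open>The condition \<open>snd j = 0\<close> singles out the position directions (i, 0) among
  the basis vectors of the product, so that both kinds of derivative fit into a single sum over the
  basis.\<close>

definition weight :: "('a::euclidean_space \<Rightarrow> real) \<Rightarrow> real \<Rightarrow> 'a \<times> 'a \<Rightarrow> 'a \<times> 'a \<Rightarrow> real" where
  "weight U \<eta> j z = (if snd j = 0 then Ham U z powr (-2 * \<eta>) else 1)"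

lemma
  fixes U :: "'a::euclidean_space \<Rightarrow> real"
  assumes H: "C1 (Ham U)" and H1: "\<And>z. 1 \<le> Ham U z"
  shows C1_weight: "C1 (weight U \<eta> j)"
    and pd_weight: "pd (weight U \<eta> j) v z
      = (if snd j = 0 then - (2 * \<eta> / Ham U z) * Ham U z powr (-2 * \<eta>) * pd (Ham U) v z else 0)"
proof -
  have pos: "0 < x" if "x \<in> range (Ham U)" for x
    using that H1 by (auto intro: less_le_trans[of 0 1])
  have d: "((\<lambda>x. x powr (-2 * \<eta>)) has_real_derivative (-2 * \<eta>) * x powr (-2 * \<eta> - 1)) (at x)"
    if "x \<in> range (Ham U)" for x
    using pos[OF that] by (rule has_real_derivative_powr)
  have c: "continuous_on (range (Ham U)) (\<lambda>x. (-2 * \<eta>) * x powr (-2 * \<eta> - 1))"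
    using pos by (intro continuous_intros) (metis less_irrefl)
  have eq: "weight U \<eta> j = (if snd j = 0 then (\<lambda>z. Ham U z powr (-2 * \<eta>)) else (\<lambda>z. 1))"
    by (auto simp: weight_def)
  have d1: "((\<lambda>z::'a \<times> 'a. 1::real) has_derivative (\<lambda>v. 0)) (at z)" for z by simp
  show "C1 (weight U \<eta> j)"
    unfolding eq using C1_compose[OF H d c] C1I[OF d1] by auto
  have "Ham U z powr (-2 * \<eta> - 1) = Ham U z powr (-2 * \<eta>) / Ham U z"
    using H1[of z] by (subst powr_diff) auto
  then show "pd (weight U \<eta> j) v z
      = (if snd j = 0 then - (2 * \<eta> / Ham U z) * Ham U z powr (-2 * \<eta>) * pd (Ham U) v z else 0)"
    unfolding eq using pd_compose[OF H d c, of v z] pd_eqI[OF d1, of v z] by auto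
qed

text \<open>From 0 <= ln H <= H: polynomial decay in H is weaker than exponential decay, with rate
  kap = 2 eta.\<close>

lemma weight_bounds:
  fixes U :: "'a::euclidean_space \<Rightarrow> real"
  assumes H1: "\<And>z. 1 \<le> Ham U z" and "0 \<le> \<eta>"
  shows "weight U \<eta> j z \<le> 1" "exp (- (2 * \<eta>) * Ham U z) \<le> weight U \<eta> j z"
proof -
  have "ln (Ham U z) \<le> Ham U z" "0 \<le> ln (Ham U z)"
    using ln_le_minus_one[of "Ham U z"] H1[of z] by auto
  then have "\<eta> * ln (Ham U z) \<le> \<eta> * Ham U z" "0 \<le> \<eta> * ln (Ham U z)"
    using assms(2) by (auto intro: mult_left_mono)
  moreover have "Ham U z powr (-2 * \<eta>) = exp (- 2 * \<eta> * ln (Ham U z))"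
    using H1[of z] by (simp add: powr_def)
  moreover have "0 \<le> \<eta> * Ham U z" using assms(2) H1[of z] by simp
  ultimately show "weight U \<eta> j z \<le> 1" "exp (- (2 * \<eta>) * Ham U z) \<le> weight U \<eta> j z"
    by (auto simp: weight_def)
qed

text \<open>The extra drift 2 eta grad_x H / H in \<open>L_op\<close> is the derivative of the
  weight H^(-2 eta), which puts the operator into the divergence form of the locale.\<close>

lemma L_op_eq_sum:
  fixes U :: "'a::euclidean_space \<Rightarrow> real"
  assumes H: "C1 (Ham U)" and H1: "\<And>z. 1 \<le> Ham U z"
  shows "(\<Sum>j\<in>Basis. weight U \<eta> j z * pd (pd W j) j z
      + (pd (weight U \<eta> j) j z - weight U \<eta> j z * pd (Ham U) j z) * pd W j z) = L_op U \<eta> W z"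
proof -
  let ?p = "Ham U z powr (-2 * \<eta>)"
  have nz: "i \<in> Basis \<Longrightarrow> i \<noteq> 0" for i :: 'a by auto
  have "(\<Sum>j\<in>Basis. weight U \<eta> j z * pd (pd W j) j z
      + (pd (weight U \<eta> j) j z - weight U \<eta> j z * pd (Ham U) j z) * pd W j z)
    = (\<Sum>i\<in>Basis. ?p * pd (pd W (i, 0)) (i, 0) z - ?p * (2 * \<eta> / Ham U z + 1) * (pd (Ham U) (i, 0) z * pd W (i, 0) z))
      + (\<Sum>i\<in>Basis. pd (pd W (0, i)) (0, i) z - pd (Ham U) (0, i) z * pd W (0, i) z)"
    unfolding sum_Basis_prod pd_weight[OF H H1]
    by (intro arg_cong2[where f="(+)"] sum.cong refl) (auto simp: weight_def nz algebra_simps)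
  also have "\<dots> = L_op U \<eta> W z"
    unfolding L_op_def lap_x_def lap_y_def grad_x_def grad_y_def inner_add_left inner_scaleR_left
      inner_sum_Basis sum_subtractf sum_distrib_left[symmetric]
    by (simp add: algebra_simps)
  finally show ?thesis .
qed

lemma weighted_sum_pd_sq:
  fixes U :: "'a::euclidean_space \<Rightarrow> real"
  shows "(\<Sum>j\<in>Basis. weight U \<eta> j z * (pd g j z)\<^sup>2)
      = Ham U z powr (-2 * \<eta>) * (norm (grad_x g z))\<^sup>2 + (norm (grad_y g z))\<^sup>2"
proof -
  have nz: "i \<in> Basis \<Longrightarrow> i \<noteq> 0" for i :: 'a by auto
  have "(\<Sum>i\<in>Basis. weight U \<eta> (0, i) z * (pd g (0, i) z)\<^sup>2) = (\<Sum>i\<in>Basis. (pd g (0, i) z)\<^sup>2)"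
    by (intro sum.cong refl) (auto simp: weight_def nz)
  then show ?thesis
    unfolding sum_Basis_prod grad_x_def grad_y_def power2_norm_eq_inner inner_sum_Basis
    by (simp add: weight_def sum_distrib_left power2_eq_square)
qed

text \<open>Integrability is spelled out because the Bochner integral of a non-integrable function
  is 0 by convention, which would distort both the energy and the entropy.\<close>

theorem theorem2:
  fixes U :: "real ^ 'd \<Rightarrow> real" and \<eta> :: real
  assumes eta: "\<eta> \<ge> 0"
    and U_smooth: "smooth U"
    and U_ge1: "\<forall>x. U x \<ge> 1"
    and U_int: "integrable lborel (\<lambda>x. exp (- U x))"
    and U_infty: "filterlim U at_top at_infinity"
    and grad_H: "\<exists>h>0. \<exists>R. \<forall>z. norm z \<ge> R \<longrightarrow> norm (grad (Ham U) z) \<ge> h"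
    and theta_bd: "\<exists>c>0. \<exists>C0>0. \<exists>r0. \<forall>r\<ge>r0. theta U r \<le> c * exp (C0 * r)"
    and Lyap: "\<exists>W w lam b. smooth W \<and> w > 0 \<and> (\<forall>z. W z \<ge> w) \<and> lam > 0 \<and> b > 0 \<and>
                 (\<forall>z. L_op U \<eta> W z \<le> - lam * Ham U z * W z + b)"
  shows "\<exists>\<rho>>0. \<forall>g :: (real ^ 'd) \<times> (real ^ 'd) \<Rightarrow> real.
           smooth g \<and> integrable (mu U) (\<lambda>z. (g z)\<^sup>2) \<and> (\<integral>z. (g z)\<^sup>2 \<partial>mu U) = 1
           \<and> integrable (mu U) (\<lambda>z. Ham U z powr (-2*\<eta>) * (norm (grad_x g z))\<^sup>2
                                     + (norm (grad_y g z))\<^sup>2)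
           \<longrightarrow> integrable (mu U) (\<lambda>z. (g z)\<^sup>2 * ln ((g z)\<^sup>2))
               \<and> Ent (mu U) (\<lambda>z. (g z)\<^sup>2) \<le> \<rho> * energy U \<eta> g"
proof -
  have U1: "C1 U" by (rule smooth_imp_C1[OF U_smooth])
  have U2: "C1 (pd U i)" if "i \<in> Basis" for i by (rule smooth_imp_C1[OF smooth_pd[OF U_smooth that]])
  note H = C1_Ham[OF U1] and H2 = C1_pd_Ham[OF U1 U2]
  have H1: "1 \<le> Ham U z" for z
    using U_ge1[rule_format, of "fst z"] zero_le_power2[of "norm (snd z)"] unfolding Ham_def by linarith
  then have H0: "0 \<le> Ham U z" for z using order_trans zero_le_one by blast
  have bdd: "bounded {z. Ham U z \<le> r}" for r
    by (rule bounded_Ham_sublevel[OF _ U_infty]) (use U_ge1 in auto)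
  obtain h R where h: "0 < h" "\<And>z. R \<le> norm z \<Longrightarrow> h \<le> norm (grad (Ham U) z)"
    using grad_H by blast
  obtain c C0 r0 where C0: "0 < C0" and th: "\<And>r. r0 \<le> r \<Longrightarrow> theta U r \<le> c * exp (C0 * r)"
    using theta_bd by blast
  obtain M where M: "\<And>j z. j \<in> Basis \<Longrightarrow> exp (- C0 * Ham U z) * \<bar>pd (pd (Ham U) j) j z\<bar> \<le> M"
    using exp_Ham_second_pd_bounded[OF H H2 H0 bdd h C0 th] by blast
  obtain L where L: "0 < L" "\<And>x y. \<bar>exp (- C0 * Ham U x) - exp (- C0 * Ham U y)\<bar> \<le> L * norm (x - y)"
    using exp_neg_lipschitz[OF H H2 H0 C0 M] by blast
  obtain W w lam b where W: "smooth W" "0 < w" "\<And>z. w \<le> W z" "0 < lam" "0 < b"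
    "\<And>z. L_op U \<eta> W z \<le> - lam * Ham U z * W z + b"
    using Lyap by blast
  \<comment> \<open>The exponential scale is the growth rate \<open>C0\<close> of
    \<open>theta\<close>, and the degeneracy rate of the weight is 2 eta.\<close>
  interpret lyapunov_gibbs "Ham U" "weight U \<eta>" W w lam b "2 * \<eta>" C0 L
  proof
    show "0 \<le> 2 * \<eta>" using eta by simp
    show "(\<Sum>j\<in>Basis. weight U \<eta> j z * pd (pd W j) j z
        + (pd (weight U \<eta> j) j z - weight U \<eta> j z * pd (Ham U) j z) * pd W j z) \<le> - lam * Ham U z * W z + b" for z
      unfolding L_op_eq_sum[OF H H1] by (rule W(6))
  qed (use H H1 bdd integrable_exp_Ham[OF U_int] C1_weight[OF H H1] weight_bounds[OF H1 eta]
      smooth_imp_C1[OF W(1)] smooth_imp_C1[OF smooth_pd[OF W(1)]] W(2-5) C0 L in auto)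
  have mu: "mu U = \<mu>" unfolding mu_def \<mu>_def Zc_def Z_def ..
  have Gam: "Gam g = (\<lambda>z. Ham U z powr (-2*\<eta>) * (norm (grad_x g z))\<^sup>2 + (norm (grad_y g z))\<^sup>2)" for g
    unfolding Gam_def weighted_sum_pd_sq ..
  show ?thesis
  proof (rule log_sobolev)
    fix \<rho> :: real assume "0 < \<rho>"
      and le: "\<And>g. C1 g \<Longrightarrow> integrable \<mu> (\<lambda>z. (g z)\<^sup>2) \<Longrightarrow> integrable \<mu> (Gam g) \<Longrightarrow> (\<integral>z. (g z)\<^sup>2 \<partial>\<mu>) = 1 \<Longrightarrow>
        integrable \<mu> (\<lambda>z. (g z)\<^sup>2 * ln ((g z)\<^sup>2)) \<and>
        (\<integral>z. (g z)\<^sup>2 * ln ((g z)\<^sup>2) \<partial>\<mu>) \<le> \<rho> * (\<integral>z. Gam g z \<partial>\<mu>)"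
    \<comment> \<open>As g^2 has integral 1, the subtracted term of \<open>Ent\<close> is 1 times ln
      1, which is 0.\<close>
    show ?thesis
      unfolding mu Ent_def energy_def Gam[symmetric]
      using \<open>0 < \<rho>\<close> le smooth_imp_C1 by (intro exI[of _ \<rho>]) auto
  qed
qed

end
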